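(* Let $G$ be a countable discrete abelian group and let $\varphi,\psi:G\to G$ be homomorphisms such that $\varphi(G)$, $\psi(G)$ and $(\varphi-\psi)(G)$ all have finite index in $G$. For any $E\subseteq G$ with $d^*(E)>0$ and any $\varepsilon>0$, the set $$\left\{ g\in G : d^*\left(E\cap(E-\varphi(g))\cap(E-\psi(g))\right) > d^*(E)^3-\varepsilon\right\}$$ is syndetic.
   Context: A Følner sequence in $G$ is a sequence of finite sets $F_N\subseteq G$ with $|(F_N+g)\triangle F_N|/|F_N|\to0$ for every $g\in G$. The upper Banach density of $E\subseteq G$ is $d^*(E)=\sup\{\limsup_{N\to\infty}|E\cap F_N|/|F_N| : (F_N)\text{ a Følner sequence in }G\}$. For $E\subseteq G$, $h\in G$, $E-h=\{e-h:e\in E\}$. A subset $S\subseteq G$ is syndetic if finitely many translates of $S$ cover $G$. *)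

theory Defs
  imports "HOL-Analysis.Analysis"
begin

definition translate :: "'g::ab_group_add set \<Rightarrow> 'g \<Rightarrow> 'g set" where
  "translate A g = (\<lambda>a. a + g) ` A"

definition additive_hom :: "('g::ab_group_add \<Rightarrow> 'g) \<Rightarrow> bool" where
  "additive_hom f \<longleftrightarrow> (\<forall>x y. f (x + y) = f x + f y)"

definition finite_index :: "'g::ab_group_add set \<Rightarrow> bool" where
  "finite_index H \<longleftrightarrow> finite (range (translate H))"

definition folner :: "(nat \<Rightarrow> 'g::ab_group_add set) \<Rightarrow> bool" where
  "folner F \<longleftrightarrow> (\<forall>N. finite (F N) \<and> F N \<noteq> {}) \<and>
     (\<forall>g. (\<lambda>N. real (card ((translate (F N) g - F N) \<union> (F N - translate (F N) g)))
                / real (card (F N))) \<longlonglongrightarrow> 0)"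

definition upper_banach_density :: "'g::ab_group_add set \<Rightarrow> ereal" where
  "upper_banach_density E =
     (SUP F \<in> {F. folner F}.
        limsup (\<lambda>N. ereal (real (card (E \<inter> F N)) / real (card (F N)))))"

definition syndetic :: "'g::ab_group_add set \<Rightarrow> bool" where
  "syndetic S \<longleftrightarrow> (\<exists>T. finite T \<and> (\<Union>t\<in>T. translate S t) = UNIV)"

end

theory Submission
  imports Defs
begin

text \<open>
  The whole argument takes place in the algebra of bounded real functions on the group, with invariant
  means in the role of invariant measures. Among the means maximising the measure of \<open>E\<close> choose an
  extreme point \<open>m\<close> of the set of all invariant means; extremality says that \<open>m\<close> is ergodic.
  If the set of good \<open>g\<close> were not syndetic, some invariant mean \<open>M\<close> in the variable \<open>g\<close> would
  vanish on it.

  Write \<open>f\<close> for the indicator of \<open>E\<close> and approximate its projection to the (uniformly) almost periodic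
  functions by a coarse \<open>F1\<close> and a much finer \<open>F2\<close>. Two applications of van der Corput bound the
  \<open>M\<close>-average of \<open>m (f * tr (\<phi> g) f * tr (\<psi> g) (f - F2))\<close>, even with an almost periodic weight in
  \<open>g\<close>, by a box norm of \<open>f - F2\<close> along the groups \<open>range \<psi>\<close> and \<open>range (\<psi> - \<phi>)\<close>. Because these have
  finite index, the box norm is at most a constant times the mean square of the autocorrelation of
  \<open>f - F2\<close>, and this is small because \<open>f - F2\<close> is nearly orthogonal to all almost periodic functions.
  Weighting by the times \<open>g\<close> at which \<open>\<phi> g\<close> and \<open>\<psi> g\<close> almost fix \<open>F1\<close>, the average of the triple
  correlation is nearly \<open>m (f * F1 * F1)\<close>, which is nearly \<open>m (F1 ^ 3) \<ge> (m F1) ^ 3\<close>.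
\<close>

section \<open>Bounded functions and invariant means\<close>

text \<open>Two levels of approximation are forced by the order of choices. The weight in
  \<open>g\<close> is built from the return times of \<open>F1\<close>; the accuracy needed of the
  averaged terms depends on that weight (on its mean and on a finite net of its translates); only
  then can \<open>F2\<close> be chosen. The difference \<open>F2 - F1\<close> is small only in mean
  square, at the scale of the first approximation, but this is enough because it is estimated for
  each single \<open>g\<close>. The terms with \<open>f - F2\<close> are controlled only after
  averaging over \<open>g\<close>. One has \<open>f - F2\<close> in the \<open>\<psi>\<close> slot,
  the other in the \<open>\<phi>\<close> slot; exchanging the roles of the two maps is where all
  three finite-index hypotheses enter. The inner product \<open>m (u * v)\<close> lives on bounded
  functions, which need not be complete for it. Hence projections and Riesz vectors are near
  minimisers of quadratic functionals. The mean \<open>M\<close> is dictated by the failure of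
  syndeticity and need not be ergodic; ergodicity of \<open>m\<close> makes averages of its
  correlations along an arbitrary \<open>M\<close> computable.\<close>

typedef 'g bfun = "{f :: 'g \<Rightarrow> real. bounded (range f)}"
  morphisms ap Bfun
  by (rule exI[of _ "\<lambda>_. 0"]) (auto simp: bounded_iff)

setup_lifting type_definition_bfun

lemma bounded_range_iff: "bounded (range f) \<longleftrightarrow> (\<exists>B. \<forall>x. \<bar>f x\<bar> \<le> (B::real))"
  by (auto simp: bounded_iff)

lemma bfun_eqI: "(\<And>x. ap f x = ap g x) \<Longrightarrow> f = g"
  by (metis ap_inject ext)

instantiation bfun :: (type) comm_ring_1
begin

lift_definition zero_bfun :: "'g bfun" is "\<lambda>_. 0" by (auto simp: bounded_iff)
lift_definition one_bfun :: "'g bfun" is "\<lambda>_. 1" by (auto simp: bounded_iff)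
lift_definition plus_bfun :: "'g bfun \<Rightarrow> 'g bfun \<Rightarrow> 'g bfun" is "\<lambda>f g x. f x + g x"
  by (rule bounded_plus_comp)
lift_definition uminus_bfun :: "'g bfun \<Rightarrow> 'g bfun" is "\<lambda>f x. - f x"
  by (auto simp: bounded_iff)
lift_definition minus_bfun :: "'g bfun \<Rightarrow> 'g bfun \<Rightarrow> 'g bfun" is "\<lambda>f g x. f x - g x"
  by (rule bounded_minus_comp)
lift_definition times_bfun :: "'g bfun \<Rightarrow> 'g bfun \<Rightarrow> 'g bfun" is "\<lambda>f g x. f x * g x"
proof -
  fix f g :: "'g \<Rightarrow> real"
  assume "bounded (range f)" "bounded (range g)"
  then obtain B C where "\<And>x. \<bar>f x\<bar> \<le> B" "\<And>x. \<bar>g x\<bar> \<le> C"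
    unfolding bounded_range_iff by auto
  then have "\<bar>f x * g x\<bar> \<le> B * C" for x
    unfolding abs_mult by (meson abs_ge_zero mult_mono order_trans)
  then show "bounded (range (\<lambda>x. f x * g x))"
    unfolding bounded_range_iff by blast
qed

instance
  by standard (transfer, auto simp: algebra_simps fun_eq_iff)+

end

instantiation bfun :: (type) real_vector
begin

lift_definition scaleR_bfun :: "real \<Rightarrow> 'g bfun \<Rightarrow> 'g bfun" is "\<lambda>c f x. c * f x"
  by (rule bounded_subset[OF bounded_scaling]) auto

instance
  by standard (transfer, auto simp: algebra_simps)+

end

lift_definition tr :: "'g::ab_group_add \<Rightarrow> 'g bfun \<Rightarrow> 'g bfun" is "\<lambda>g f x. f (x + g)"
  by (erule bounded_subset) auto

lemma ap_simps [simp]: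
  "ap 0 x = 0" "ap 1 x = 1" "ap (f + g) x = ap f x + ap g x" "ap (f - g) x = ap f x - ap g x"
  "ap (- f) x = - ap f x" "ap (f * g) x = ap f x * ap g x" "ap (c *\<^sub>R f) x = c * ap f x"
  "ap (tr t h) y = ap h (y + t)"
  by (transfer; simp)+

definition bnd :: "('i \<Rightarrow> real) \<Rightarrow> bool" where
  "bnd F \<longleftrightarrow> bounded (range F)"

text \<open>One bound for the whole family makes \<open>m (X i)\<close> a bounded function of
  \<open>i\<close>, so that a second mean can be applied to it. \<open>Bfun\<close> is meaningful
  only on bounded functions, so every nested average carries this side condition.\<close>

definition ubnd :: "('i \<Rightarrow> 'g bfun) \<Rightarrow> bool" where
  "ubnd X \<longleftrightarrow> (\<exists>B. \<forall>i x. \<bar>ap (X i) x\<bar> \<le> B)"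

lemma bndI: "(\<And>x. \<bar>F x\<bar> \<le> B) \<Longrightarrow> bnd F"
  unfolding bnd_def bounded_range_iff by blast

lemma bndE: assumes "bnd F" obtains B where "B \<ge> 0" "\<And>x. \<bar>F x\<bar> \<le> B"
proof -
  from assms obtain B where B: "\<And>x. \<bar>F x\<bar> \<le> B"
    unfolding bnd_def bounded_range_iff by blast
  then show thesis using that[of B] abs_ge_zero[of "F undefined"] order_trans by blast
qed

lemma ubndE: assumes "ubnd X" obtains B where "B \<ge> 0" "\<And>i x. \<bar>ap (X i) x\<bar> \<le> B"
proof -
  from assms obtain B where B: "\<And>i x. \<bar>ap (X i) x\<bar> \<le> B"
    unfolding ubnd_def by blast
  then show thesis using that[of B] abs_ge_zero[of "ap (X undefined) undefined"] order_trans by blast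
qed

lemma ap_Bfun [simp]: "bnd F \<Longrightarrow> ap (Bfun F) = F"
  unfolding bnd_def by (simp add: Bfun_inverse)

lemma bnd_ap: "bnd (ap f)"
  unfolding bnd_def using ap[of f] by simp

lemma bnd_const: "bnd (\<lambda>_. c)" by (rule bndI[of _ "\<bar>c\<bar>"]) simp
lemma bnd_add: "bnd F \<Longrightarrow> bnd G \<Longrightarrow> bnd (\<lambda>x. F x + G x)"
  unfolding bnd_def by (rule bounded_plus_comp)
lemma bnd_diff: "bnd F \<Longrightarrow> bnd G \<Longrightarrow> bnd (\<lambda>x. F x - G x)"
  unfolding bnd_def by (rule bounded_minus_comp)
lemma bnd_uminus: "bnd F \<Longrightarrow> bnd (\<lambda>x. - F x)"
  by (erule bndE, rule bndI, simp)
lemma bnd_abs: "bnd F \<Longrightarrow> bnd (\<lambda>x. \<bar>F x\<bar>)"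
  by (erule bndE, rule bndI, simp)
lemma bnd_mult: "bnd F \<Longrightarrow> bnd G \<Longrightarrow> bnd (\<lambda>x. F x * G x)"
  by (elim bndE, rule bndI, simp only: abs_mult, rule mult_mono) auto
lemma bnd_power: "bnd F \<Longrightarrow> bnd (\<lambda>x. F x ^ n)"
  by (induction n) (auto intro: bnd_const bnd_mult)
lemma bnd_comp: "bnd F \<Longrightarrow> bnd (\<lambda>x. F (k x))"
  by (erule bndE, rule bndI)
lemma bnd_sum: "(\<And>i. i \<in> I \<Longrightarrow> bnd (F i)) \<Longrightarrow> bnd (\<lambda>x. \<Sum>i\<in>I. F i x)"
  by (induction I rule: infinite_finite_induct) (auto intro: bnd_const bnd_add)
lemma bnd_divide: "bnd F \<Longrightarrow> bnd (\<lambda>x. F x / c)"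
  using bnd_mult[OF _ bnd_const[of "1/c"], of F] by simp
lemma bnd_ap_comp: "bnd (\<lambda>i. ap f (k i))"
  by (rule bnd_comp[OF bnd_ap])

lemma ubnd_const: "ubnd (\<lambda>_. f)"
  using bnd_ap[of f] unfolding ubnd_def by (elim bndE) blast
lemma ubnd_add: assumes "ubnd X" "ubnd Y" shows "ubnd (\<lambda>i. X i + Y i)"
proof -
  from assms obtain B C where "\<And>i x. \<bar>ap (X i) x\<bar> \<le> B" "\<And>i x. \<bar>ap (Y i) x\<bar> \<le> C"
    by (elim ubndE) blast
  then have "\<bar>ap (X i + Y i) x\<bar> \<le> B + C" for i x
    using abs_triangle_ineq[of "ap (X i) x" "ap (Y i) x"] by (smt (verit, best) ap_simps(3))
  then show ?thesis unfolding ubnd_def by blast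
qed
lemma ubnd_scaleR: assumes "bnd c" "ubnd X" shows "ubnd (\<lambda>i. c i *\<^sub>R X i)"
proof -
  from assms obtain B C where "\<And>i. \<bar>c i\<bar> \<le> B" "\<And>i x. \<bar>ap (X i) x\<bar> \<le> C" "B \<ge> 0"
    by (elim ubndE bndE) blast
  then have "\<bar>ap (c i *\<^sub>R X i) x\<bar> \<le> B * C" for i x
    by (simp add: abs_mult mult_mono')
  then show ?thesis unfolding ubnd_def by blast
qed
lemma ubnd_mult: assumes "ubnd X" "ubnd Y" shows "ubnd (\<lambda>i. X i * Y i)"
proof -
  from assms obtain B C where "\<And>i x. \<bar>ap (X i) x\<bar> \<le> B" "\<And>i x. \<bar>ap (Y i) x\<bar> \<le> C" "B \<ge> 0"
    by (elim ubndE) blast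
  then have "\<bar>ap (X i * Y i) x\<bar> \<le> B * C" for i x
    by (simp add: abs_mult mult_mono')
  then show ?thesis unfolding ubnd_def by blast
qed
lemma ubnd_diff: assumes "ubnd X" "ubnd Y" shows "ubnd (\<lambda>i. X i - Y i)"
  using ubnd_add[OF assms(1) ubnd_scaleR[OF bnd_const[of "-1"] assms(2)]] by simp
lemma ubnd_tr: "ubnd X \<Longrightarrow> ubnd (\<lambda>i. tr (k i) (X i))"
  unfolding ubnd_def by auto
lemma ubnd_sum: "(\<And>j. j \<in> J \<Longrightarrow> ubnd (X j)) \<Longrightarrow> ubnd (\<lambda>i. \<Sum>j\<in>J. X j i)"
  by (induction J rule: infinite_finite_induct) (auto intro: ubnd_const ubnd_add)

lemmas bnd_intros = bnd_const bnd_add bnd_diff bnd_uminus bnd_abs bnd_mult bnd_power bnd_sum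
  bnd_divide bnd_ap_comp ubnd_const ubnd_add ubnd_diff ubnd_scaleR ubnd_mult ubnd_tr ubnd_sum

lemma ap_sum: "ap (\<Sum>i\<in>I. f i) x = (\<Sum>i\<in>I. ap (f i) x)"
  by (induction I rule: infinite_finite_induct) auto

lemma tr_simps:
  "tr t (f + g) = tr t f + tr t g" "tr t (f - g) = tr t f - tr t g" "tr t (f * g) = tr t f * tr t g"
  "tr t (c *\<^sub>R f) = c *\<^sub>R tr t f" "tr t 1 = 1" "tr t 0 = 0" "tr 0 f = f" "tr s (tr t f) = tr (s + t) f"
  by (rule bfun_eqI; simp add: algebra_simps)+

lemma tr_sum: "tr t (\<Sum>i\<in>I. f i) = (\<Sum>i\<in>I. tr t (f i))"
  by (rule bfun_eqI) (simp add: ap_sum)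

lemma bfun_scaleR_mult: "(c *\<^sub>R f) * g = c *\<^sub>R (f * g)" "f * (c *\<^sub>R g) = c *\<^sub>R (f * (g :: 'g bfun))"
  by (rule bfun_eqI; simp)+

text \<open>Common engine of Cauchy-Schwarz (\<open>e\<close> is a squared norm) and of the
  near-minimiser arguments (\<open>e\<close> is the allowed distance from the infimum):
  nonnegativity under all perturbations \<open>s\<close> bounds the linear coefficient.\<close>

lemma quadratic_nonneg_discriminant:
  fixes a b e :: real
  assumes "\<And>s. a * s\<^sup>2 + 2 * b * s + e \<ge> 0" and "a \<ge> 0"
  shows "b\<^sup>2 \<le> a * e"
proof (cases "a = 0")
  case True
  have "b = 0"
  proof (rule ccontr)
    assume "b \<noteq> 0"
    \<comment> \<open>At this \<open>s\<close> the affine function takes the value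
      \<open>e - \<bar>e\<bar> - 1 < 0\<close>.\<close>
    then show False using assms(1)[of "- (\<bar>e\<bar> + 1) / (2 * b)"] True by auto
  qed
  then show ?thesis using True by simp
next
  case False
  then have "a > 0" using assms by simp
  have "0 \<le> a * (a * (- b / a)\<^sup>2 + 2 * b * (- b / a) + e)"
    using assms(1)[of "- b / a"] assms(2) by (rule mult_nonneg_nonneg[rotated])
  also have "\<dots> = a * e - b\<^sup>2"
    using \<open>a > 0\<close> by (simp add: field_simps power2_eq_square)
  finally show ?thesis by simp
qed

lemma abs_mult_le_1: "\<bar>x\<bar> \<le> 1 \<Longrightarrow> \<bar>y\<bar> \<le> 1 \<Longrightarrow> \<bar>x * y\<bar> \<le> (1::real)"
  using mult_mono[of "\<bar>x\<bar>" 1 "\<bar>y\<bar>" 1] by (simp add: abs_mult)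

section \<open>Calculus of invariant means\<close>

locale inv_mean =
  fixes m :: "'g::ab_group_add bfun \<Rightarrow> real"
  assumes m_add: "m (f + g) = m f + m g"
    and m_scale: "m (c *\<^sub>R f) = c * m f"
    and m_nonneg: "(\<And>x. 0 \<le> ap f x) \<Longrightarrow> 0 \<le> m f"
    and m_one [simp]: "m 1 = 1"
    and m_tr [simp]: "m (tr t f) = m f"
begin

lemma m_zero [simp]: "m 0 = 0"
  using m_scale[of 0 0] by simp

lemma m_diff: "m (f - g) = m f - m g"
  using m_add[of "f - g" g] by simp

lemma m_sum: "m (\<Sum>i\<in>I. f i) = (\<Sum>i\<in>I. m (f i))"
  by (induction I rule: infinite_finite_induct) (auto simp: m_add)

lemma m_mono: "(\<And>x. ap f x \<le> ap g x) \<Longrightarrow> m f \<le> m g"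
  using m_nonneg[of "g - f"] by (simp add: m_diff)

lemma m_const: "m (c *\<^sub>R 1) = c"
  by (simp add: m_scale)

lemma m_le: "(\<And>x. ap f x \<le> B) \<Longrightarrow> m f \<le> B"
  using m_mono[of f "B *\<^sub>R 1"] by (simp add: m_const)

lemma m_ge: "(\<And>x. B \<le> ap f x) \<Longrightarrow> B \<le> m f"
  using m_mono[of "B *\<^sub>R 1" f] by (simp add: m_const)

lemma m_abs_le: "(\<And>x. \<bar>ap f x\<bar> \<le> B) \<Longrightarrow> \<bar>m f\<bar> \<le> B"
  using m_le[of f B] m_ge[of "-B" f] by (simp add: abs_le_iff minus_le_iff)

lemma bnd_m: "ubnd X \<Longrightarrow> bnd (\<lambda>i. m (X i))"
  by (erule ubndE, rule bndI, rule m_abs_le)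

lemma m_self_nonneg: "0 \<le> m (f * f)"
  by (rule m_nonneg) simp

lemma m_expand: "m ((f + s *\<^sub>R g) * (f + s *\<^sub>R g)) = m (g * g) * s\<^sup>2 + 2 * m (f * g) * s + m (f * f)"
proof -
  have "(f + s *\<^sub>R g) * (f + s *\<^sub>R g) = (s\<^sup>2) *\<^sub>R (g * g) + (2 * s) *\<^sub>R (f * g) + f * f"
    by (rule bfun_eqI, simp only: ap_simps) (simp add: algebra_simps power2_eq_square)
  then show ?thesis by (simp add: m_add m_scale)
qed

lemma m_CS: "(m (f * g))\<^sup>2 \<le> m (f * f) * m (g * g)"
proof -
  have "(m (f * g))\<^sup>2 \<le> m (g * g) * m (f * f)"
    by (rule quadratic_nonneg_discriminant)
       (simp_all add: m_expand[symmetric] m_self_nonneg)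
  then show ?thesis by (simp add: mult.commute)
qed

abbreviation mean :: "('g \<Rightarrow> real) \<Rightarrow> real" where
  "mean F \<equiv> m (Bfun F)"

lemma mean_add: "bnd F \<Longrightarrow> bnd G \<Longrightarrow> mean (\<lambda>x. F x + G x) = mean F + mean G"
  unfolding m_add[symmetric] by (rule arg_cong[of _ _ m], rule bfun_eqI) (simp add: bnd_intros)

lemma mean_diff: "bnd F \<Longrightarrow> bnd G \<Longrightarrow> mean (\<lambda>x. F x - G x) = mean F - mean G"
  unfolding m_diff[symmetric] by (rule arg_cong[of _ _ m], rule bfun_eqI) (simp add: bnd_intros)

lemma mean_cmult: "bnd F \<Longrightarrow> mean (\<lambda>x. c * F x) = c * mean F"
  unfolding m_scale[symmetric] by (rule arg_cong[of _ _ m], rule bfun_eqI) (simp add: bnd_intros)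

lemma mean_const: "mean (\<lambda>_. c) = c"
proof -
  have "Bfun (\<lambda>_. c) = (c *\<^sub>R 1 :: 'g bfun)" by (rule bfun_eqI) (simp add: bnd_const)
  then show ?thesis by (simp add: m_const)
qed

lemma mean_sum: "finite I \<Longrightarrow> (\<And>i. i \<in> I \<Longrightarrow> bnd (F i)) \<Longrightarrow> mean (\<lambda>x. \<Sum>i\<in>I. F i x) = (\<Sum>i\<in>I. mean (F i))"
  by (induction I rule: finite_induct) (auto simp: mean_const mean_add bnd_intros)

lemma mean_shift: "bnd F \<Longrightarrow> mean (\<lambda>x. F (x + t)) = mean F"
  unfolding m_tr[of t "Bfun F", symmetric]
  by (rule arg_cong[of _ _ m], rule bfun_eqI) (simp add: bnd_comp[of F "\<lambda>x. x + t"])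

lemma mean_mono: "bnd F \<Longrightarrow> bnd G \<Longrightarrow> (\<And>x. F x \<le> G x) \<Longrightarrow> mean F \<le> mean G"
  by (rule m_mono) simp

lemma mean_le: "bnd F \<Longrightarrow> (\<And>x. F x \<le> B) \<Longrightarrow> mean F \<le> B"
  by (rule m_le) simp

lemma mean_ge: "bnd F \<Longrightarrow> (\<And>x. B \<le> F x) \<Longrightarrow> B \<le> mean F"
  by (rule m_ge) simp

lemma mean_abs: "bnd F \<Longrightarrow> \<bar>mean F\<bar> \<le> mean (\<lambda>x. \<bar>F x\<bar>)"
  using mean_mono[of F "\<lambda>x. \<bar>F x\<bar>"] mean_mono[of "\<lambda>x. - 1 * F x" "\<lambda>x. \<bar>F x\<bar>"] mean_cmult[of F "-1"]
  by (simp add: abs_le_iff bnd_intros)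

lemma mean_CS:
  assumes "bnd F" "bnd G"
  shows "(mean (\<lambda>x. F x * G x))\<^sup>2 \<le> mean (\<lambda>x. (F x)\<^sup>2) * mean (\<lambda>x. (G x)\<^sup>2)"
proof -
  have "Bfun F * Bfun G = Bfun (\<lambda>x. F x * G x)" "Bfun F * Bfun F = Bfun (\<lambda>x. (F x)\<^sup>2)"
    "Bfun G * Bfun G = Bfun (\<lambda>x. (G x)\<^sup>2)"
    by (rule bfun_eqI; simp add: assms bnd_intros power2_eq_square)+
  then show ?thesis using m_CS[of "Bfun F" "Bfun G"] by simp
qed

lemma mean_square: "bnd F \<Longrightarrow> (mean F)\<^sup>2 \<le> mean (\<lambda>x. (F x)\<^sup>2)"
  using mean_CS[of F "\<lambda>_. 1"] by (simp add: mean_const bnd_const)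

lemma mean_sum_shift:
  assumes "finite I" "bnd F"
  shows "mean (\<lambda>x. \<Sum>i\<in>I. F (x + k i)) = real (card I) * mean F"
proof -
  have "mean (\<lambda>x. \<Sum>i\<in>I. F (x + k i)) = (\<Sum>i\<in>I. mean (\<lambda>x. F (x + k i)))"
    by (intro mean_sum bnd_comp[OF assms(2)] assms(1))
  then show ?thesis by (simp add: mean_shift assms)
qed

lemma m_self_le_1: "(\<And>x. \<bar>ap f x\<bar> \<le> 1) \<Longrightarrow> m (f * f) \<le> 1"
  by (rule m_le, simp only: ap_simps) (metis abs_le_D1 abs_mult_le_1)

lemma m_CS_1:
  assumes "\<And>x. \<bar>ap f x\<bar> \<le> 1"
  shows "(m (f * g))\<^sup>2 \<le> m (g * g)"
  using m_CS[of f g] mult_right_mono[OF m_self_le_1[OF assms] m_self_nonneg[of g]] by simp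

text \<open>Choosing the points one at a time, each below average against its predecessors, makes all
  off-diagonal pairs average to at most the mean.\<close>

lemma greedy_differences:
  fixes D :: "'g \<Rightarrow> real"
  assumes D: "bnd D" "\<And>x. D (- x) = D x" and "\<eta> > 0"
  obtains n :: nat and h :: "nat \<Rightarrow> 'g" where "n > 0"
    "(\<Sum>i<n. \<Sum>j<n. D (h i - h j)) \<le> (real n)\<^sup>2 * (mean D + \<eta>)"
proof -
  \<comment> \<open>The induction step adds at most \<open>2 * (n * mean D + 1) + D 0\<close>, while
    the main term grows by \<open>(2 * n + 1) * mean D\<close>; the surplus is
    \<open>2 + D 0 - mean D\<close>. The absolute value makes \<open>n > C / \<eta>\<close> imply
    \<open>n > 0\<close>.\<close>
  define C where "C = \<bar>2 + D 0 - mean D\<bar>"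
  have "\<exists>h. (\<Sum>i<n. \<Sum>j<n. D (h i - h j)) \<le> (real n)\<^sup>2 * mean D + real n * C" for n
  proof (induction n)
    case 0
    then show ?case by simp
  next
    case (Suc n)
    then obtain h where h: "(\<Sum>i<n. \<Sum>j<n. D (h i - h j)) \<le> (real n)\<^sup>2 * mean D + real n * C" by blast
    have b: "bnd (\<lambda>x. D (x + - h i))" for i
      using D(1) by (rule bnd_comp)
    \<comment> \<open>The slack \<open>1\<close> gives the strict gap needed for the contradiction.
      Over all steps it costs an amount linear in \<open>n\<close>, against a main term of order
      \<open>n^2\<close>.\<close>
    have "\<exists>x. (\<Sum>i<n. D (x + - h i)) \<le> real n * mean D + 1"
    proof (rule ccontr)
      assume "\<nexists>x. (\<Sum>i<n. D (x + - h i)) \<le> real n * mean D + 1"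
      then have "real n * mean D + 1 \<le> mean (\<lambda>x. \<Sum>i<n. D (x + - h i))"
        by (intro mean_ge bnd_sum b) (auto simp: not_le intro: less_imp_le)
      also have "\<dots> = real n * mean D"
        by (subst mean_sum) (use b D(1) in \<open>auto simp: mean_shift simp del: add_uminus_conv_diff\<close>)
      finally show False by simp
    qed
    then obtain x where x: "(\<Sum>i<n. D (x - h i)) \<le> real n * mean D + 1" by auto
    have x': "(\<Sum>i<n. D (h i - x)) = (\<Sum>i<n. D (x - h i))"
      by (rule sum.cong) (use D(2) in \<open>metis minus_diff_eq\<close>)+
    have "(\<Sum>i<Suc n. \<Sum>j<Suc n. D ((h(n := x)) i - (h(n := x)) j))
        = (\<Sum>i<n. \<Sum>j<n. D (h i - h j)) + 2 * (\<Sum>i<n. D (x - h i)) + D 0"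
      using x' by (simp add: sum.distrib)
    also have "\<dots> \<le> (real n)\<^sup>2 * mean D + real n * C + 2 * (real n * mean D + 1) + D 0"
      using add_mono[OF h mult_left_mono[OF x, of 2]] by simp
    also have "\<dots> \<le> (real (Suc n))\<^sup>2 * mean D + real (Suc n) * C"
      by (simp add: algebra_simps power2_eq_square C_def)
    finally show ?case by blast
  qed
  moreover obtain n where n: "real n > C / \<eta>" using reals_Archimedean2 by blast
  ultimately obtain h where h: "(\<Sum>i<n. \<Sum>j<n. D (h i - h j)) \<le> (real n)\<^sup>2 * mean D + real n * C" by blast
  have "C / \<eta> \<ge> 0" using \<open>\<eta> > 0\<close> by (simp add: C_def)
  then have "n > 0" using n by (simp add: zero_less_iff_neq_zero)
  moreover have "real n * C \<le> real n * (real n * \<eta>)"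
    using n \<open>\<eta> > 0\<close> by (intro mult_left_mono) (auto simp: field_simps)
  then have "(\<Sum>i<n. \<Sum>j<n. D (h i - h j)) \<le> (real n)\<^sup>2 * mean D + real n * (real n * \<eta>)"
    using h by linarith
  then have "(\<Sum>i<n. \<Sum>j<n. D (h i - h j)) \<le> (real n)\<^sup>2 * (mean D + \<eta>)"
    by (simp add: power2_eq_square algebra_simps)
  ultimately show ?thesis by (rule that)
qed

end

section \<open>Extreme invariant means and upper Banach density\<close>

text \<open>Faces in midpoint form, inside the space of all real functions on \<open>'i\<close> with
  pointwise convergence. A point \<open>p\<close> of \<open>X\<close> is extreme when
  \<open>{p}\<close> is extremal in \<open>X\<close>.\<close>

definition extremal_in :: "('i \<Rightarrow> real) set \<Rightarrow> ('i \<Rightarrow> real) set \<Rightarrow> bool" where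
  "extremal_in X S \<longleftrightarrow> (\<forall>a\<in>X. \<forall>b\<in>X. (\<lambda>i. (a i + b i) / 2) \<in> S \<longrightarrow> a \<in> S \<and> b \<in> S)"

lemma extremal_in_max_face:
  assumes "extremal_in X S" "\<And>y. y \<in> S \<Longrightarrow> y i \<le> v"
  shows "extremal_in X {y \<in> S. y i = v}"
  unfolding extremal_in_def
proof (intro ballI impI)
  fix a b
  assume ab: "a \<in> X" "b \<in> X" and mid: "(\<lambda>i. (a i + b i) / 2) \<in> {y \<in> S. y i = v}"
  then have "a \<in> S" "b \<in> S"
    using assms(1) unfolding extremal_in_def by blast+
  moreover from this have "a i \<le> v" "b i \<le> v" using assms(2) by auto
  moreover have "(a i + b i) / 2 = v" using mid by simp
  ultimately show "a \<in> {y \<in> S. y i = v} \<and> b \<in> {y \<in> S. y i = v}" by auto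
qed

lemma closed_coordinate_eq: "closed {y :: 'i \<Rightarrow> real. y i = v}"
  by (intro closed_Collect_eq continuous_on_const continuous_on_product_coordinates)

text \<open>Krein-Milman by Zorn: a minimal nonempty closed face inside \<open>S0\<close> is a
  single point, because otherwise some coordinate is nonconstant on it and the set where that
  coordinate is maximal is a smaller closed face. Being a face of \<open>X\<close>, the point is
  extreme in all of \<open>X\<close>.\<close>

lemma extreme_point_in_face:
  fixes X S0 :: "('i \<Rightarrow> real) set"
  assumes X: "compact X" and S0: "closed S0" "S0 \<subseteq> X" "S0 \<noteq> {}" "extremal_in X S0"
  obtains p where "p \<in> S0" "extremal_in X {p}"
proof -
  define \<F> where "\<F> = {S. S \<noteq> {} \<and> closed S \<and> S \<subseteq> S0 \<and> extremal_in X S}"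
  have "S0 \<in> \<F>" using S0 by (auto simp: \<F>_def)
  \<comment> \<open>Complements turn the search for a minimal face into one for a maximal set, as
    \<open>subset_Zorn\<close> requires.\<close>
  have "\<exists>U\<in>uminus ` \<F>. \<forall>c\<in>C. c \<subseteq> U" if C: "subset.chain (uminus ` \<F>) C" for C
  proof (cases "C = {}")
    case True
    then show ?thesis using \<open>S0 \<in> \<F>\<close> by blast
  next
    case False
    have C\<F>: "- c \<in> \<F>" if "c \<in> C" for c
      using C that unfolding subset_chain_def by auto
    have chain: "subset.chain (uminus ` \<F>) C'" if "C' \<subseteq> C" for C'
      using C that unfolding subset_chain_def by (meson subset_iff)
    have "S0 \<inter> \<Inter> (uminus ` C) \<noteq> {}"
    proof (rule compact_imp_fip)
      show "compact S0" using compact_Int_closed[OF X S0(1)] S0(2) by (simp add: Int_absorb1)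
      show "closed T" if "T \<in> uminus ` C" for T using C\<F> that by (auto simp: \<F>_def)
      fix \<G> assume "finite \<G>" "\<G> \<subseteq> uminus ` C"
      then obtain C' where C': "finite C'" "C' \<subseteq> C" "\<G> = uminus ` C'"
        by (meson finite_subset_image)
      show "S0 \<inter> \<Inter> \<G> \<noteq> {}"
      proof (cases "C' = {}")
        case True
        then show ?thesis using C' S0 by auto
      next
        case False
        \<comment> \<open>A finite chain contains its union; in terms of faces this is a smallest
          one, and it is nonempty. That is the finite intersection property.\<close>
        then have "\<Union> C' \<in> C'" using Union_in_chain[OF C'(1) False chain[OF C'(2)]] by simp
        then have "- \<Union> C' \<in> \<F>" using C' C\<F> by auto
        moreover have "- \<Union> C' = \<Inter> \<G>" using C'(3) by auto
        ultimately show ?thesis by (auto simp: \<F>_def)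
      qed
    qed
    moreover have "closed (\<Inter> (uminus ` C))" using C\<F> by (auto simp: \<F>_def)
    moreover have "\<Inter> (uminus ` C) \<subseteq> S0" using C\<F> False by (force simp: \<F>_def)
    moreover have "extremal_in X (\<Inter> (uminus ` C))"
      unfolding extremal_in_def
    proof (intro ballI impI)
      fix a b
      assume "a \<in> X" "b \<in> X" "(\<lambda>i. (a i + b i) / 2) \<in> \<Inter> (uminus ` C)"
      then have "a \<in> - c \<and> b \<in> - c" if "c \<in> C" for c
        using C\<F>[OF that] that unfolding \<F>_def extremal_in_def by blast
      then show "a \<in> \<Inter> (uminus ` C) \<and> b \<in> \<Inter> (uminus ` C)" by blast
    qed
    ultimately have "\<Inter> (uminus ` C) \<in> \<F>" unfolding \<F>_def by blast
    then have "- \<Inter> (uminus ` C) \<in> uminus ` \<F>" by blast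
    then show ?thesis by (intro bexI[of _ "- \<Inter> (uminus ` C)"]) auto
  qed
  then obtain U where "U \<in> uminus ` \<F>" and max: "\<forall>V\<in>uminus ` \<F>. U \<subseteq> V \<longrightarrow> V = U"
    using subset_Zorn[of "uminus ` \<F>"] by blast
  then obtain S where S: "S \<in> \<F>" and "U = - S" by blast
  with max have min: "T = S" if "T \<in> \<F>" "T \<subseteq> S" for T
  proof -
    have "- T \<in> uminus ` \<F>" "U \<subseteq> - T" using that \<open>U = - S\<close> by auto
    then have "- T = - S" using max \<open>U = - S\<close> by blast
    then show ?thesis by simp
  qed
  obtain p where "p \<in> S" using S by (auto simp: \<F>_def)
  have "S = {p}"
  proof (rule ccontr)
    assume "S \<noteq> {p}"
    then obtain b where "b \<in> S" "b \<noteq> p" using \<open>p \<in> S\<close> by blast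
    then obtain i where i: "b i \<noteq> p i" by blast
    have "compact S" using compact_Int_closed[OF X, of S] S S0(2) by (auto simp: \<F>_def Int_absorb1)
    then obtain y where y: "y \<in> S" "\<And>z. z \<in> S \<Longrightarrow> z i \<le> y i"
      using continuous_attains_sup[of S "\<lambda>y. y i"] \<open>p \<in> S\<close>
      by (auto intro: continuous_on_product_coordinates continuous_on_subset)
    have "{z \<in> S. z i = y i} \<in> \<F>"
      using S y extremal_in_max_face[of X S i "y i"] closed_Int[OF _ closed_coordinate_eq[of i "y i"], of S]
      by (auto simp: \<F>_def Collect_conj_eq)
    then have "{z \<in> S. z i = y i} = S" by (rule min) auto
    then show False using i \<open>b \<in> S\<close> \<open>p \<in> S\<close> by (metis (mono_tags, lifting) mem_Collect_eq)
  qed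
  then show ?thesis using that[of p] S by (auto simp: \<F>_def)
qed

section \<open>Compactness of the set of invariant means\<close>

lemma ap_le_SUP: "\<bar>ap f x\<bar> \<le> (SUP x. \<bar>ap f x\<bar>)"
proof (rule cSUP_upper)
  show "bdd_above (range (\<lambda>x. \<bar>ap f x\<bar>))"
    using bnd_ap[of f] by (elim bndE) (auto simp: bdd_above_def)
qed auto

lemma compact_box: "compact (\<Pi>\<^sub>E i\<in>(UNIV :: 'i set). {a i..b i :: real})"
proof -
  have "compactin (product_topology (\<lambda>_. euclidean) UNIV) (\<Pi>\<^sub>E i\<in>(UNIV :: 'i set). {a i..b i :: real})"
    unfolding compactin_PiE by auto
  then show ?thesis by (simp add: euclidean_product_topology)
qed

text \<open>Each axiom is an equation or inequality between finitely many coordinates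
  \<open>m f\<close>, hence closed for pointwise convergence.\<close>

lemma closed_inv_means: "closed {m :: 'g::ab_group_add bfun \<Rightarrow> real. inv_mean m}"
proof -
  have eq: "{m :: 'g bfun \<Rightarrow> real. inv_mean m} =
      (\<Inter>f. \<Inter>g. {m. m (f + g) = m f + m g}) \<inter> (\<Inter>c. \<Inter>f. {m. m (c *\<^sub>R f) = c * m f})
      \<inter> (\<Inter>f\<in>{f. \<forall>x. 0 \<le> ap f x}. {m. 0 \<le> m f}) \<inter> {m. m 1 = 1} \<inter> (\<Inter>t. \<Inter>f. {m. m (tr t f) = m f})"
    by (auto simp: inv_mean_def)
  show ?thesis
    unfolding eq
    by (intro closed_Int closed_INT ballI closed_Collect_eq closed_Collect_le continuous_intros
        continuous_on_product_coordinates)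
qed

text \<open>Banach-Alaoglu by Tychonoff: positivity and \<open>m 1 = 1\<close> confine each
  coordinate \<open>m f\<close> to an interval given by the sup norm of \<open>f\<close>.\<close>

lemma compact_inv_means: "compact {m :: 'g::ab_group_add bfun \<Rightarrow> real. inv_mean m}"
proof -
  define B where "B f = (SUP x. \<bar>ap f x\<bar>)" for f :: "'g bfun"
  have B: "\<bar>ap f x\<bar> \<le> B f" for f x
    unfolding B_def by (rule ap_le_SUP)
  define P where "P = (\<Pi>\<^sub>E f\<in>(UNIV :: 'g bfun set). {- B f..B f})"
  have "compact P" unfolding P_def by (rule compact_box)
  moreover have "{m :: 'g bfun \<Rightarrow> real. inv_mean m} \<subseteq> P"
    using inv_mean.m_abs_le[OF _ B] by (auto simp: P_def abs_le_iff minus_le_iff)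
  ultimately show ?thesis
    using compact_Int_closed[OF _ closed_inv_means] by (metis inf.absorb_iff2)
qed

section \<open>Means obtained from Folner sequences\<close>

definition set_average :: "'g set \<Rightarrow> 'g bfun \<Rightarrow> real" where
  "set_average A f = (\<Sum>x\<in>A. ap f x) / real (card A)"

text \<open>Summing \<open>tr t f\<close> over \<open>A\<close> is summing \<open>f\<close> over the
  translate; the common part cancels and only the symmetric difference remains.\<close>

lemma set_average_tr_le:
  assumes "finite A" "A \<noteq> {}" "\<And>x. \<bar>ap f x\<bar> \<le> B"
  shows "\<bar>set_average A (tr t f) - set_average A f\<bar>
    \<le> B * (real (card ((translate A t - A) \<union> (A - translate A t))) / real (card A))"
proof -
  let ?T = "translate A t"
  have "finite ?T" using assms by (simp add: translate_def)
  have "(\<Sum>x\<in>A. ap (tr t f) x) = (\<Sum>x\<in>?T. ap f x)"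
    unfolding translate_def by (subst sum.reindex) (auto simp: inj_on_def)
  then have "(\<Sum>x\<in>A. ap (tr t f) x) - (\<Sum>x\<in>A. ap f x) = (\<Sum>x\<in>?T - A. ap f x) - (\<Sum>x\<in>A - ?T. ap f x)"
    using sum.Int_Diff[OF \<open>finite ?T\<close>, of "ap f" A] sum.Int_Diff[OF \<open>finite A\<close>, of "ap f" ?T]
    by (simp add: Int_commute)
  also have "\<bar>\<dots>\<bar> \<le> (\<Sum>x\<in>?T - A. \<bar>ap f x\<bar>) + (\<Sum>x\<in>A - ?T. \<bar>ap f x\<bar>)"
    using sum_abs[of "ap f" "?T - A"] sum_abs[of "ap f" "A - ?T"] by linarith
  also have "\<dots> = (\<Sum>x\<in>(?T - A) \<union> (A - ?T). \<bar>ap f x\<bar>)"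
    using assms \<open>finite ?T\<close> by (subst sum.union_disjoint) auto
  also have "\<dots> \<le> real (card ((?T - A) \<union> (A - ?T))) * B"
    using assms(3) by (intro sum_bounded_above) auto
  finally have "\<bar>(\<Sum>x\<in>A. ap (tr t f) x) - (\<Sum>x\<in>A. ap f x)\<bar> \<le> B * real (card ((?T - A) \<union> (A - ?T)))"
    by (simp add: mult.commute)
  then show ?thesis
    unfolding set_average_def
    by (simp add: diff_divide_distrib[symmetric] divide_right_mono)
qed

text \<open>The averages over \<open>F N\<close> lie in a compact box and so have a cluster point
  \<open>M\<close>, although they need not converge. Every closed condition that they satisfy
  eventually passes to \<open>M\<close>; the second conjunct records the upper bounds among
  these.\<close>

lemma folner_cluster_mean:
  fixes F :: "nat \<Rightarrow> 'g::ab_group_add set"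
  assumes "folner F"
  shows "\<exists>M. inv_mean M \<and> (\<forall>f a. eventually (\<lambda>N. set_average (F N) f \<le> a) sequentially \<longrightarrow> M f \<le> a)"
proof -
  have F: "finite (F N)" "F N \<noteq> {}" "card (F N) > 0" for N
    using assms by (auto simp: folner_def card_gt_0_iff)
  define B where "B f = (SUP x. \<bar>ap f x\<bar>)" for f :: "'g bfun"
  have B: "\<bar>ap f x\<bar> \<le> B f" for f x
    unfolding B_def by (rule ap_le_SUP)
  define P where "P = (\<Pi>\<^sub>E f\<in>(UNIV :: 'g bfun set). {- B f..B f})"
  have "compact P" unfolding P_def by (rule compact_box)
  have ge: "set_average (F N) f \<ge> b" if "\<And>x. ap f x \<ge> b" for N f b
    using sum_bounded_below[of "F N" b "ap f"] that F(3)[of N]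
    by (simp add: set_average_def field_simps)
  have le: "set_average (F N) f \<le> b" if "\<And>x. ap f x \<le> b" for N f b
    using sum_bounded_above[of "F N" "ap f" b] that F(3)[of N]
    by (simp add: set_average_def field_simps)
  have "set_average (F N) \<in> P" for N
  proof -
    have "- B f \<le> set_average (F N) f" "set_average (F N) f \<le> B f" for f
      using B[of f] by (auto intro!: ge le simp: abs_le_iff minus_le_iff)
    then show ?thesis unfolding P_def by auto
  qed
  then have "eventually (\<lambda>y. y \<in> P) (filtermap (\<lambda>N. set_average (F N)) sequentially)"
    by (simp add: eventually_filtermap)
  then obtain M where "M \<in> P" and M: "inf (nhds M) (filtermap (\<lambda>N. set_average (F N)) sequentially) \<noteq> bot"
    using \<open>compact P\<close> unfolding compact_filter by (metis filtermap_bot_iff sequentially_bot)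
  have cl: "M \<in> C" if "closed C" "eventually (\<lambda>N. set_average (F N) \<in> C) sequentially" for C
  proof (rule ccontr)
    assume "M \<notin> C"
    then have "eventually (\<lambda>y. y \<in> - C) (nhds M)"
      using that(1) by (intro eventually_nhds_in_open) auto
    moreover have "eventually (\<lambda>y. y \<in> C) (filtermap (\<lambda>N. set_average (F N)) sequentially)"
      using that(2) by (simp add: eventually_filtermap)
    ultimately have "eventually (\<lambda>_. False) (inf (nhds M) (filtermap (\<lambda>N. set_average (F N)) sequentially))"
      unfolding eventually_inf by (intro exI[of _ "\<lambda>y. y \<in> - C"] exI[of _ "\<lambda>y. y \<in> C"]) auto
    then show False using M by (simp add: trivial_limit_def)
  qed
  note closed_intros = closed_Collect_eq closed_Collect_le continuous_intros continuous_on_product_coordinates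
  have "M \<in> {y. y (f + g) = y f + y g}" for f g
    by (rule cl, intro closed_intros) (simp add: set_average_def sum.distrib add_divide_distrib)
  moreover have "M \<in> {y. y (c *\<^sub>R f) = c * y f}" for c f
    by (rule cl, intro closed_intros) (simp add: set_average_def sum_distrib_left)
  moreover have "M \<in> {y. 0 \<le> y f}" if "\<And>x. 0 \<le> ap f x" for f
    by (rule cl, intro closed_intros) (simp add: ge that)
  moreover have "M \<in> {y. y 1 = 1}"
    by (rule cl, intro closed_intros) (use F(3) in \<open>simp add: set_average_def less_imp_neq[THEN not_sym]\<close>)
  moreover have "M (tr t f) = M f" for t f
  proof -
    have closed_abs_diff: "closed {y :: 'g bfun \<Rightarrow> real. \<bar>y (tr t f) - y f\<bar> \<le> e}" for e
      by (intro closed_intros)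
    \<comment> \<open>Finite averages are invariant only up to an error tending to 0, so a closed
      condition is used for each \<open>e > 0\<close>.\<close>
    have "\<bar>M (tr t f) - M f\<bar> \<le> e" if "e > 0" for e
    proof -
      have "(\<lambda>N. B f * (real (card ((translate (F N) t - F N) \<union> (F N - translate (F N) t)))
                / real (card (F N)))) \<longlonglongrightarrow> B f * 0"
        using assms unfolding folner_def by (intro tendsto_mult tendsto_const) auto
      then have "eventually (\<lambda>N. B f * (real (card ((translate (F N) t - F N) \<union> (F N - translate (F N) t)))
                / real (card (F N))) < e) sequentially"
        using \<open>e > 0\<close> by (intro order_tendstoD) auto
      then have "eventually (\<lambda>N. \<bar>set_average (F N) (tr t f) - set_average (F N) f\<bar> \<le> e) sequentially"
        by (rule eventually_mono)
           (use set_average_tr_le[OF F(1,2) B] in \<open>blast intro: order_trans less_imp_le\<close>)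
      then show ?thesis
        using cl[of "{y. \<bar>y (tr t f) - y f\<bar> \<le> e}"] closed_abs_diff by simp
    qed
    then have "\<bar>M (tr t f) - M f\<bar> \<le> 0" by (rule field_le_epsilon[of _ 0, simplified])
    then show ?thesis by simp
  qed
  ultimately have "inv_mean M" by unfold_locales simp_all
  moreover have "M \<in> {y. y f \<le> a}" if "eventually (\<lambda>N. set_average (F N) f \<le> a) sequentially" for f a
    by (rule cl, intro closed_intros) (use that in simp)
  ultimately show ?thesis by auto
qed

definition ind :: "'g set \<Rightarrow> 'g bfun" where
  "ind A = Bfun (indicator A)"

lemma ap_ind [simp]: "ap (ind A) x = indicator A x"
proof -
  have "bnd (indicator A :: 'a \<Rightarrow> real)"
    by (rule bndI[of _ 1]) (simp add: indicator_def)
  then show ?thesis by (simp add: ind_def)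
qed

lemma set_average_ind: "finite F \<Longrightarrow> set_average F (ind A) = real (card (A \<inter> F)) / real (card F)"
  by (simp add: set_average_def Int_commute indicator_def sum.If_cases)

lemma card_translate [simp]: "card (translate A g) = card A"
  unfolding translate_def by (rule card_image) (simp add: inj_on_def)

text \<open>The shift may depend on \<open>N\<close>, because the symmetric difference formed from a
  shifted set is a shift of the original one. Densities can therefore be tested on windows that are
  moved freely.\<close>

lemma folner_translate:
  assumes "folner F"
  shows "folner (\<lambda>N. translate (F N) (x N))"
proof -
  have eq: "(translate (translate A x) g - translate A x) \<union> (translate A x - translate (translate A x) g)
      = translate ((translate A g - A) \<union> (A - translate A g)) x" for A :: "'a set" and x g
  proof -
    have "inj (\<lambda>a. a + x)" by (simp add: inj_on_def)
    moreover have "translate (translate A x) g = translate (translate A g) x"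
      by (auto simp: translate_def image_image add.assoc add.commute)
    ultimately show ?thesis
      unfolding translate_def by (simp add: image_Un image_set_diff)
  qed
  show ?thesis
    using assms unfolding folner_def eq card_translate by (auto simp: translate_def)
qed

lemma folner_subseq: "folner F \<Longrightarrow> strict_mono r \<Longrightarrow> folner (F \<circ> r)"
  unfolding folner_def by (auto dest!: spec intro: LIMSEQ_subseq_LIMSEQ[unfolded o_def])

text \<open>Averaging the translates of \<open>ind A\<close> over \<open>F N\<close> does not change
  its mean, so some window \<open>F N + x\<close> has density nearly at least
  \<open>m (ind A)\<close>. The loss \<open>1 / Suc N\<close> covers a supremum that is not
  attained.\<close>

lemma upper_banach_density_ge_mean:
  fixes F :: "nat \<Rightarrow> 'g::ab_group_add set" and A :: "'g set"
  assumes "inv_mean m" "folner F"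
  shows "ereal (m (ind A)) \<le> upper_banach_density A"
proof -
  interpret inv_mean m by fact
  have F: "finite (F N)" "F N \<noteq> {}" "card (F N) > 0" for N
    using assms by (auto simp: folner_def card_gt_0_iff)
  have "\<exists>x. m (ind A) - 1 / real (Suc N) \<le> set_average (translate (F N) x) (ind A)" for N
  proof (rule ccontr)
    assume neg: "\<nexists>x. m (ind A) - 1 / real (Suc N) \<le> set_average (translate (F N) x) (ind A)"
    define f where "f = (1 / real (card (F N))) *\<^sub>R (\<Sum>t\<in>F N. tr t (ind A))"
    have "ap f x = set_average (translate (F N) x) (ind A)" for x
    proof -
      have "(\<Sum>y\<in>translate (F N) x. ap (ind A) y) = (\<Sum>t\<in>F N. ap (ind A) (t + x))"
        unfolding translate_def by (subst sum.reindex) (auto simp: inj_on_def)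
      then show ?thesis by (simp add: f_def set_average_def ap_sum add.commute)
    qed
    then have "m f \<le> m (ind A) - 1 / real (Suc N)"
      using neg by (intro m_le) (auto simp: not_le intro: less_imp_le)
    moreover have "m f = m (ind A)"
      using F(3)[of N] by (simp add: f_def m_scale m_sum)
    ultimately show False by simp
  qed
  then obtain x where x: "\<And>N. m (ind A) - 1 / real (Suc N) \<le> set_average (translate (F N) (x N)) (ind A)"
    by metis
  define F' where "F' N = translate (F N) (x N)" for N
  have F': "folner F'" unfolding F'_def using assms(2) by (rule folner_translate)
  have fin: "finite (F' N)" for N using F' by (auto simp: folner_def)
  have "(\<lambda>N. m (ind A) - 1 / real (Suc N)) \<longlonglongrightarrow> m (ind A) - 0"
    by (intro tendsto_diff tendsto_const LIMSEQ_Suc lim_1_over_n)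
  then have "(\<lambda>N. ereal (m (ind A) - 1 / real (Suc N))) \<longlonglongrightarrow> ereal (m (ind A))"
    by simp
  then have "ereal (m (ind A)) = limsup (\<lambda>N. ereal (m (ind A) - 1 / real (Suc N)))"
    using lim_imp_Limsup trivial_limit_sequentially by metis
  also have "\<dots> \<le> limsup (\<lambda>N. ereal (real (card (A \<inter> F' N)) / real (card (F' N))))"
    using x by (intro Limsup_mono always_eventually) (simp add: F'_def[symmetric] set_average_ind[OF fin])
  also have "\<dots> \<le> upper_banach_density A"
    unfolding upper_banach_density_def using F' by (intro SUP_upper) auto
  finally show ?thesis .
qed

definition ergodic_mean :: "('g::ab_group_add bfun \<Rightarrow> real) \<Rightarrow> bool" where
  "ergodic_mean m \<longleftrightarrow> inv_mean m \<and> extremal_in {m. inv_mean m} {m}"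

text \<open>The maximisers of \<open>z (ind E)\<close> form a closed face of the compact set of
  invariant means, and an extreme point found in it is extreme among all invariant means. The
  maximum dominates every Folner limsup, since a subsequence realising the limsup has a cluster mean
  at least as large.\<close>

lemma ergodic_mean_attaining_density:
  fixes F0 :: "nat \<Rightarrow> 'g::ab_group_add set" and E :: "'g set"
  assumes "folner F0"
  obtains m where "ergodic_mean m" "upper_banach_density E \<le> ereal (m (ind E))"
proof -
  let ?X = "{m :: 'g bfun \<Rightarrow> real. inv_mean m}"
  obtain M0 where "inv_mean (M0 :: 'g bfun \<Rightarrow> real)" using folner_cluster_mean[OF assms] by auto
  then have "?X \<noteq> {}" by auto
  then obtain y where y: "inv_mean y" "\<And>z. inv_mean z \<Longrightarrow> z (ind E) \<le> y (ind E)"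
    using continuous_attains_sup[OF compact_inv_means, where f = "\<lambda>z. z (ind E)"]
    by (auto intro: continuous_on_product_coordinates continuous_on_subset)
  have "extremal_in ?X {z \<in> ?X. z (ind E) = y (ind E)}"
    by (rule extremal_in_max_face) (auto simp: extremal_in_def y)
  moreover have "closed {z \<in> ?X. z (ind E) = y (ind E)}"
    using closed_Int[OF closed_inv_means closed_coordinate_eq]
    by (simp add: Collect_conj_eq)
  moreover have "{z \<in> ?X. z (ind E) = y (ind E)} \<noteq> {}" using y(1) by auto
  ultimately obtain m where m: "m \<in> {z \<in> ?X. z (ind E) = y (ind E)}" "extremal_in ?X {m}"
    using extreme_point_in_face[OF compact_inv_means, of "{z \<in> ?X. z (ind E) = y (ind E)}"]
    by (metis (no_types, lifting) mem_Collect_eq subsetI)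
  have "limsup (\<lambda>N. ereal (real (card (E \<inter> F N)) / real (card (F N)))) \<le> ereal (y (ind E))"
    if F: "folner F" for F
  proof (rule ccontr)
    let ?a = "\<lambda>N. ereal (real (card (E \<inter> F N)) / real (card (F N)))"
    assume "\<not> limsup ?a \<le> ereal (y (ind E))"
    then obtain a where a: "ereal (y (ind E)) < ereal a" "ereal a < limsup ?a"
      using ereal_dense2 by (meson not_le)
    obtain r where r: "strict_mono r" "(?a \<circ> r) \<longlonglongrightarrow> limsup ?a"
      using limsup_subseq_lim by blast
    have Fr: "folner (F \<circ> r)" using F r(1) by (rule folner_subseq)
    then have fin: "finite ((F \<circ> r) N)" for N unfolding folner_def by blast
    obtain M where M: "inv_mean M"
      "\<forall>f a. eventually (\<lambda>N. set_average ((F \<circ> r) N) f \<le> a) sequentially \<longrightarrow> M f \<le> a"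
      using folner_cluster_mean[OF Fr] by auto
    interpret inv_mean M by fact
    have "eventually (\<lambda>N. ereal a < (?a \<circ> r) N) sequentially"
      using r(2) a(2) by (rule order_tendstoD)
    \<comment> \<open>Cluster means come with upper bounds, so the lower bound for
      \<open>ind E\<close> is stated as an upper bound for \<open>- ind E\<close>.\<close>
    then have "eventually (\<lambda>N. set_average ((F \<circ> r) N) (- ind E) \<le> - a) sequentially"
    proof (rule eventually_mono)
      fix N assume "ereal a < (?a \<circ> r) N"
      then have "a < set_average ((F \<circ> r) N) (ind E)"
        using set_average_ind[OF fin[of N], of E] by simp
      moreover have "set_average ((F \<circ> r) N) (- ind E) = - set_average ((F \<circ> r) N) (ind E)"
        by (simp add: set_average_def sum_negf)
      ultimately show "set_average ((F \<circ> r) N) (- ind E) \<le> - a" by simp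
    qed
    then have "M (- ind E) \<le> - a" using M(2) by blast
    then have "a \<le> M (ind E)" using m_diff[of 0 "ind E"] by simp
    moreover have "M (ind E) \<le> y (ind E)" by (rule y(2)[OF M(1)])
    ultimately show False using a(1) by simp
  qed
  then have "upper_banach_density E \<le> ereal (y (ind E))"
    unfolding upper_banach_density_def by (intro SUP_least) simp
  then show ?thesis using that[of m] m by (simp add: ergodic_mean_def)
qed

text \<open>If finitely many translates never cover, every finite set has a translate disjoint from
  \<open>S\<close>. Folner sets moved off \<open>S\<close> see none of it, and neither does their
  cluster mean.\<close>

lemma not_syndetic_null_mean:
  fixes F :: "nat \<Rightarrow> 'g::ab_group_add set" and S :: "'g set"
  assumes "folner F" "\<not> syndetic S"
  obtains M where "inv_mean M" "M (ind S) = 0"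
proof -
  have F: "finite (F N)" for N using assms by (auto simp: folner_def)
  have "\<exists>t. translate (F N) t \<inter> S = {}" for N
  proof -
    \<comment> \<open>A point \<open>t\<close> outside all \<open>S - x\<close> with
      \<open>x \<in> F N\<close> satisfies \<open>x + t \<notin> S\<close>; hence the negated
      shifts.\<close>
    have "(\<Union>t\<in>uminus ` F N. translate S t) \<noteq> UNIV"
      using assms(2) F[of N] unfolding syndetic_def by blast
    then obtain t where t: "\<And>x. x \<in> F N \<Longrightarrow> t \<notin> translate S (- x)" by blast
    have "x + t \<notin> S" if "x \<in> F N" for x
    proof
      assume "x + t \<in> S"
      then have "(x + t) + - x \<in> translate S (- x)" unfolding translate_def by blast
      then show False using t[OF that] by (simp add: algebra_simps)
    qed
    then show ?thesis unfolding translate_def by blast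
  qed
  then obtain t where t: "\<And>N. translate (F N) (t N) \<inter> S = {}" by metis
  obtain M where M: "inv_mean M"
    "\<forall>f a. eventually (\<lambda>N. set_average (translate (F N) (t N)) f \<le> a) sequentially \<longrightarrow> M f \<le> a"
    using folner_cluster_mean[OF folner_translate[OF assms(1)], of t] by auto
  interpret inv_mean M by fact
  have "set_average (translate (F N) (t N)) (ind S) \<le> 0" for N
    using t[of N] F[of N] by (subst set_average_ind) (auto simp: Int_commute translate_def)
  then have "M (ind S) \<le> 0" using M(2) by simp
  moreover have "M (ind S) \<ge> 0" by (rule m_nonneg) simp
  ultimately show ?thesis using that M(1) by simp
qed

section \<open>Ergodicity and box norms\<close>

lemma additive_hom_simps:
  assumes "additive_hom f"
  shows "f (x + y) = f x + f y" "f 0 = 0" "f (- x) = - f x" "f (x - y) = f x - f y"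
proof -
  have add: "f (x + y) = f x + f y" for x y using assms by (simp add: additive_hom_def)
  show "f (x + y) = f x + f y" by (rule add)
  show "f 0 = 0" using add[of 0 0] by simp
  have neg: "f (- x) = - f x" for x
    using add[of x "- x"] \<open>f 0 = 0\<close> by (simp add: eq_neg_iff_add_eq_0 add.commute)
  then show "f (- x) = - f x" .
  show "f (x - y) = f x - f y" using add[of x "- y"] neg[of y] by simp
qed

text \<open>For an extreme mean and \<open>b \<ge> 0\<close>, \<open>v \<mapsto> M\<^sub>t m (v * tr t b)\<close> must be proportional to \<open>m\<close>, since it
  is an invariant functional dominated by a multiple of \<open>m\<close>.\<close>

lemma ergodic_mean_product:
  assumes m: "ergodic_mean m" and M: "inv_mean M"
  shows "M (Bfun (\<lambda>t. m (v * tr t b))) = m v * m b"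
proof -
  interpret m: inv_mean m using m by (simp add: ergodic_mean_def)
  interpret M: inv_mean M by fact
  have bm: "bnd (\<lambda>t. m (v * tr t b))" for v b
    by (intro m.bnd_m bnd_intros)
  have zero: "M (Bfun (\<lambda>t. m (v * tr t c))) = 0" if c: "m c = 0" "\<And>x. \<bar>ap c x\<bar> \<le> 1" for v c
  proof -
    \<comment> \<open>\<open>\<mu> 1\<close> and \<open>\<mu> (- 1)\<close> are invariant means with
      midpoint \<open>m\<close>: normalisation uses \<open>m c = 0\<close>, and positivity holds
      because the bound on \<open>c\<close> keeps the perturbation below \<open>m v\<close> for
      \<open>v \<ge> 0\<close>. Extremality then forces the perturbation to vanish.\<close>
    define \<mu> where "\<mu> s v = m v + s * M (Bfun (\<lambda>t. m (v * tr t c)))" for s v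
    have inv: "inv_mean (\<mu> s)" if s: "\<bar>s\<bar> = 1" for s
    proof
      fix f g :: "'a bfun" and a :: real and r :: 'a
      have "M (Bfun (\<lambda>t. m ((f + g) * tr t c))) = M (Bfun (\<lambda>t. m (f * tr t c))) + M (Bfun (\<lambda>t. m (g * tr t c)))"
        by (subst M.mean_add[symmetric]) (simp_all add: bm m.m_add distrib_right)
      then show "\<mu> s (f + g) = \<mu> s f + \<mu> s g"
        by (simp add: \<mu>_def m.m_add distrib_left)
      have "M (Bfun (\<lambda>t. m ((a *\<^sub>R f) * tr t c))) = a * M (Bfun (\<lambda>t. m (f * tr t c)))"
        by (subst M.mean_cmult[symmetric]) (simp_all add: bm m.m_scale bfun_scaleR_mult)
      then show "\<mu> s (a *\<^sub>R f) = a * \<mu> s f"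
        by (simp add: \<mu>_def m.m_scale distrib_left)
      have "M (Bfun (\<lambda>t. m (1 * tr t c))) = 0"
        using M.mean_const[of 0] c(1) by simp
      then show "\<mu> s 1 = 1" by (simp add: \<mu>_def)
      \<comment> \<open>By invariance of \<open>m\<close>, shifting the first factor by
        \<open>r\<close> amounts to shifting the variable \<open>t\<close> by \<open>- r\<close>,
        which \<open>M\<close> ignores.\<close>
      have "m (tr r f * tr t c) = m (f * tr (t + - r) c)" for t
        using m.m_tr[of "- r" "tr r f * tr t c"] by (simp add: tr_simps add.commute)
      then have "M (Bfun (\<lambda>t. m (tr r f * tr t c))) = M (Bfun (\<lambda>t. m (f * tr t c)))"
        using M.mean_shift[OF bm[of f c], of "- r"] by presburger
      then show "\<mu> s (tr r f) = \<mu> s f" by (simp add: \<mu>_def)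
    next
      fix f :: "'a bfun"
      assume f: "\<And>x. 0 \<le> ap f x"
      have "\<bar>m (f * tr t c)\<bar> \<le> m f" for t
      proof -
        have "\<bar>ap f x * ap c (x + t)\<bar> \<le> ap f x" for x
          using mult_left_mono[OF c(2)[of "x + t"] f[of x]] f[of x] by (simp add: abs_mult)
        then have "- ap f x \<le> ap f x * ap c (x + t)" "ap f x * ap c (x + t) \<le> ap f x" for x
          by (simp_all add: abs_le_iff minus_le_iff)
        then have "m (f * tr t c) \<le> m f" "m ((-1) *\<^sub>R f) \<le> m (f * tr t c)"
          by (intro m.m_mono; simp)+
        then show ?thesis unfolding m.m_scale by linarith
      qed
      then have "\<bar>M (Bfun (\<lambda>t. m (f * tr t c)))\<bar> \<le> m f"
        using bm by (intro M.m_abs_le) auto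
      then show "0 \<le> \<mu> s f"
        using s by (auto simp: \<mu>_def abs_le_iff abs_if split: if_splits)
    qed
    have "(\<lambda>v. (\<mu> 1 v + \<mu> (- 1) v) / 2) = m"
      by (rule ext) (simp add: \<mu>_def)
    then have "\<mu> 1 = m"
      using m inv[of 1] inv[of "-1"] unfolding ergodic_mean_def extremal_in_def by auto
    then have "\<mu> 1 v = m v" by simp
    then show ?thesis unfolding \<mu>_def by simp
  qed
  obtain B where B: "B \<ge> 0" "\<And>x. \<bar>ap b x\<bar> \<le> B" using bnd_ap[of b] by (elim bndE) blast
  have mb: "\<bar>m b\<bar> \<le> B" by (rule m.m_abs_le[OF B(2)])
  \<comment> \<open>\<open>b\<close> is centred and rescaled to meet the two conditions of
    \<open>zero\<close>; the \<open>+ 1\<close> keeps \<open>K\<close> positive when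
    \<open>B = 0\<close>.\<close>
  define K where "K = 2 * B + 1"
  define c where "c = (1 / K) *\<^sub>R (b - m b *\<^sub>R 1)"
  have K: "K > 0" using B by (simp add: K_def)
  have "m c = 0" by (simp add: c_def m.m_scale m.m_diff)
  moreover have "\<bar>ap c x\<bar> \<le> 1" for x
  proof -
    have "\<bar>ap b x - m b\<bar> \<le> K" using B(2)[of x] mb by (simp add: K_def)
    then show ?thesis using K by (simp add: c_def abs_mult divide_le_eq)
  qed
  ultimately have z: "M (Bfun (\<lambda>t. m (v * tr t c))) = 0" by (rule zero)
  have "b = K *\<^sub>R c + m b *\<^sub>R 1" using K by (simp add: c_def)
  then have "tr t b = K *\<^sub>R tr t c + m b *\<^sub>R 1" for t by (metis tr_simps(1,4,5))
  then have "m (v * tr t b) = K * m (v * tr t c) + m v * m b" for t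
    by (simp add: distrib_left m.m_add m.m_scale bfun_scaleR_mult)
  then have "M (Bfun (\<lambda>t. m (v * tr t b))) = K * M (Bfun (\<lambda>t. m (v * tr t c))) + m v * m b"
    by (simp add: M.mean_add M.mean_cmult M.mean_const bm bnd_intros)
  then show ?thesis using z by simp
qed

text \<open>Unnormalised fourth power of a box norm of \<open>u\<close> along two finite families of
  directions: expanded, each summand is the mean of the product of \<open>u\<close> over the four
  corners \<open>p i + q j\<close>, \<open>p i' + q j\<close>, \<open>p i + q j'\<close>,
  \<open>p i' + q j'\<close>. Grouping them as squares makes the term of each pair \<open>i\<close>,
  \<open>i'\<close> visibly nonnegative.\<close>

definition gbox :: "('g::ab_group_add bfun \<Rightarrow> real) \<Rightarrow> 'g bfun \<Rightarrow> 'i set \<Rightarrow> ('i \<Rightarrow> 'g) \<Rightarrow> 'j set \<Rightarrow> ('j \<Rightarrow> 'g) \<Rightarrow> real" where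
  "gbox m u I p J q = (\<Sum>i\<in>I. \<Sum>i'\<in>I. m ((\<Sum>j\<in>J. tr (q j) (tr (p i) u * tr (p i') u)) *
     (\<Sum>j\<in>J. tr (q j) (tr (p i) u * tr (p i') u))))"

context inv_mean
begin

lemma gbox_expand:
  "gbox m u I p J q = (\<Sum>i\<in>I. \<Sum>i'\<in>I. \<Sum>j\<in>J. \<Sum>j'\<in>J.
     m (tr (q j) (tr (p i) u * tr (p i') u) * tr (q j') (tr (p i) u * tr (p i') u)))"
  unfolding gbox_def sum_product m_sum ..

text \<open>The four corners of a parallelogram do not tell its two directions apart. This lets
  \<open>gbox_refine\<close>, which thickens the first direction, serve for the second as
  well.\<close>

lemma gbox_commute: "gbox m u I p J q = gbox m u J q I p"
proof -
  have "gbox m u I p J q = (\<Sum>i\<in>I. \<Sum>i'\<in>I. \<Sum>j\<in>J. \<Sum>j'\<in>J.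
     m (tr (p i) (tr (q j) u * tr (q j') u) * tr (p i') (tr (q j) u * tr (q j') u)))"
    unfolding gbox_expand tr_simps by (intro sum.cong refl arg_cong[of _ _ m]) (simp add: ac_simps)
  also have "\<dots> = (\<Sum>i\<in>I. \<Sum>j\<in>J. \<Sum>j'\<in>J. \<Sum>i'\<in>I.
     m (tr (p i) (tr (q j) u * tr (q j') u) * tr (p i') (tr (q j) u * tr (q j') u)))"
    by (subst sum.swap[of _ J I]) (subst sum.swap[of _ J I], rule refl)
  also have "\<dots> = (\<Sum>j\<in>J. \<Sum>j'\<in>J. \<Sum>i\<in>I. \<Sum>i'\<in>I.
     m (tr (p i) (tr (q j) u * tr (q j') u) * tr (p i') (tr (q j) u * tr (q j') u)))"
    by (subst sum.swap[of _ J I]) (subst sum.swap[of _ J I], rule refl)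
  finally show ?thesis unfolding gbox_expand .
qed

text \<open>All terms of \<^const>\<open>gbox\<close> are nonnegative; those on the diagonal of \<open>R \<times> R\<close> are translates of
  the terms of the original gbox.\<close>

lemma gbox_refine:
  assumes "finite I" "finite R"
  shows "real (card R) * gbox m u I p J q \<le> gbox m u (I \<times> R) (\<lambda>(i, r). p i + r) J q"
proof -
  define G where "G x y = m ((\<Sum>j\<in>J. tr (q j) (tr x u * tr y u)) * (\<Sum>j\<in>J. tr (q j) (tr x u * tr y u)))" for x y
  have G0: "G x y \<ge> 0" for x y unfolding G_def by (rule m_self_nonneg)
  have G1: "G (x + r) (y + r) = G x y" for x y r
  proof -
    have "(\<Sum>j\<in>J. tr (q j) (tr (x + r) u * tr (y + r) u)) = tr r (\<Sum>j\<in>J. tr (q j) (tr x u * tr y u))"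
      by (simp add: tr_sum tr_simps ac_simps)
    then show ?thesis unfolding G_def by (simp only: tr_simps(3)[symmetric] m_tr)
  qed
  have boxG: "gbox m u I p J q = (\<Sum>i\<in>I. \<Sum>i'\<in>I. G (p i) (p i'))"
    unfolding gbox_def G_def ..
  have "gbox m u (I \<times> R) (\<lambda>(i, r). p i + r) J q = (\<Sum>(i, r)\<in>I \<times> R. \<Sum>(i', r')\<in>I \<times> R. G (p i + r) (p i' + r'))"
    unfolding gbox_def G_def by (simp add: case_prod_unfold)
  also have "\<dots> = (\<Sum>i\<in>I. \<Sum>r\<in>R. \<Sum>i'\<in>I. \<Sum>r'\<in>R. G (p i + r) (p i' + r'))"
    by (simp add: sum.cartesian_product[symmetric])
  also have "\<dots> \<ge> (\<Sum>i\<in>I. \<Sum>r\<in>R. \<Sum>i'\<in>I. G (p i + r) (p i' + r))"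
    using G0 assms by (intro sum_mono member_le_sum) auto
  also have "(\<Sum>i\<in>I. \<Sum>r\<in>R. \<Sum>i'\<in>I. G (p i + r) (p i' + r)) = real (card R) * gbox m u I p J q"
    unfolding G1 by (simp add: sum_distrib_left[symmetric] boxG)
  finally show ?thesis .
qed

end

text \<open>First round: average over the shifts \<open>h i\<close>, freeze the weight to a member
  of the finite net \<open>W\<close>, and remove \<open>u0\<close> by Cauchy-Schwarz. Factoring
  \<open>tr (\<phi> g)\<close> out of the resulting correlations leaves the single direction
  \<open>\<psi> - \<phi>\<close>. Second round: average over the shifts \<open>k j\<close> and
  remove \<open>u1\<close>. Each round takes a square root, hence \<open>\<beta> ^ 4\<close>; the
  factor \<open>card W\<close> is the price of freezing the weight.\<close>

lemma weighted_van_der_corput: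
  fixes m M :: "'g::ab_group_add bfun \<Rightarrow> real" and \<phi> \<psi> :: "'g \<Rightarrow> 'g" and w :: "'g \<Rightarrow> real"
    and h k :: "nat \<Rightarrow> 'g" and W :: "('g \<Rightarrow> real) set"
  assumes mM: "inv_mean m" "inv_mean M" and hom: "additive_hom \<phi>" "additive_hom \<psi>"
    and u: "\<And>x. \<bar>ap u0 x\<bar> \<le> 1" "\<And>x. \<bar>ap u1 x\<bar> \<le> 1" "\<And>x. \<bar>ap u2 x\<bar> \<le> 1"
    and w: "bnd w"
    and W: "finite W" "\<And>\<omega> x. \<omega> \<in> W \<Longrightarrow> \<bar>\<omega> x\<bar> \<le> 1"
      "\<And>g. \<exists>\<omega>\<in>W. \<forall>x. \<bar>w (g + x) - \<omega> x\<bar> \<le> \<epsilon>"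
    and n: "n > 0" "n' > 0" and \<beta>: "\<beta> \<ge> 0"
    and bx: "gbox m u2 {..<n} (\<psi> \<circ> h) {..<n'} (\<lambda>j. \<psi> (k j) - \<phi> (k j)) \<le> (real n)\<^sup>2 * (real n')\<^sup>2 * \<beta> ^ 4"
  shows "\<bar>M (Bfun (\<lambda>g. w g * m (u0 * (tr (\<phi> g) u1 * tr (\<psi> g) u2))))\<bar> \<le> \<epsilon> + real (card W) * \<beta>"
proof -
  interpret m: inv_mean m by fact
  interpret M: inv_mean M by fact
  note h\<phi> = additive_hom_simps[OF hom(1)] and h\<psi> = additive_hom_simps[OF hom(2)]
  define U where "U g = tr (\<phi> g) u1 * tr (\<psi> g) u2" for g
  define \<theta> where "\<theta> g = \<psi> g - \<phi> g" for g
  have ubU: "ubnd (\<lambda>g. U (g + a))" for a unfolding U_def by (intro bnd_intros)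
  have U1: "\<bar>ap (U g) x\<bar> \<le> 1" for g x
    unfolding U_def by (simp add: abs_mult_le_1 u)
  define a where "a i i' = tr (\<phi> (h i)) u1 * tr (\<phi> (h i')) u1" for i i'
  define b where "b i i' = tr (\<psi> (h i)) u2 * tr (\<psi> (h i')) u2" for i i'
  define X where "X i i' = (\<Sum>j<n'. tr (\<theta> (k j)) (b i i'))" for i i'
  define D where "D i i' = M (Bfun (\<lambda>g. m (U (g + h i) * U (g + h i'))))" for i i'
  have D_le: "(D i i')\<^sup>2 \<le> m (X i i' * X i i') / (real n')\<^sup>2" for i i'
  proof -
    have "m (U (g + h i) * U (g + h i')) = m (a i i' * tr (\<theta> g) (b i i'))" for g
    proof -
      have "U (g + h i) * U (g + h i') = tr (\<phi> g) (a i i' * tr (\<theta> g) (b i i'))"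
        by (rule bfun_eqI) (simp add: U_def a_def b_def \<theta>_def h\<phi> h\<psi> algebra_simps)
      then show ?thesis by simp
    qed
    then have D1: "D i i' = M (Bfun (\<lambda>g. m (a i i' * tr (\<theta> g) (b i i'))))"
      unfolding D_def by simp
    have bb: "bnd (\<lambda>g. m (a i i' * tr (\<theta> g) (b i i')))"
      by (intro m.bnd_m bnd_intros)
    have "m (a i i' * tr (\<theta> g) (X i i')) = (\<Sum>j<n'. m (a i i' * tr (\<theta> (g + k j)) (b i i')))" for g
      unfolding m.m_sum[symmetric] X_def tr_sum sum_distrib_left
      by (simp add: tr_simps \<theta>_def h\<phi> h\<psi> algebra_simps)
    then have "M (Bfun (\<lambda>g. m (a i i' * tr (\<theta> g) (X i i')))) = real n' * D i i'"
      using M.mean_sum_shift[OF finite_lessThan[of n'] bb, of k] D1 by simp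
    then have "real n' * D i i' = M (Bfun (\<lambda>g. m (a i i' * tr (\<theta> g) (X i i'))))"
      by simp
    then have "(real n')\<^sup>2 * (D i i')\<^sup>2 = (M (Bfun (\<lambda>g. m (a i i' * tr (\<theta> g) (X i i')))))\<^sup>2"
      by (metis power_mult_distrib)
    also have "\<dots> \<le> M (Bfun (\<lambda>g. (m (a i i' * tr (\<theta> g) (X i i')))\<^sup>2))"
      by (intro M.mean_square m.bnd_m bnd_intros)
    also have "\<dots> \<le> m (X i i' * X i i')"
    proof (intro M.mean_le bnd_intros m.bnd_m)
      fix g
      have "\<bar>ap (a i i') x\<bar> \<le> 1" for x
        unfolding a_def by (simp add: abs_mult_le_1 u)
      then have "(m (a i i' * tr (\<theta> g) (X i i')))\<^sup>2 \<le> m (tr (\<theta> g) (X i i') * tr (\<theta> g) (X i i'))"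
        by (rule m.m_CS_1)
      also have "\<dots> = m (X i i' * X i i')"
        by (simp add: tr_simps(3)[symmetric])
      finally show "(m (a i i' * tr (\<theta> g) (X i i')))\<^sup>2 \<le> m (X i i' * X i i')" .
    qed
    finally show ?thesis using n by (simp add: field_simps)
  qed
  have sumD: "(\<Sum>i<n. \<Sum>i'<n. \<bar>D i i'\<bar>) \<le> (real n)\<^sup>2 * \<beta>\<^sup>2"
  proof -
    have "(\<Sum>i<n. \<Sum>i'<n. \<bar>D i i'\<bar>)\<^sup>2 = (\<Sum>(i, i')\<in>{..<n} \<times> {..<n}. \<bar>D i i'\<bar>)\<^sup>2"
      by (simp add: sum.cartesian_product)
    also have "\<dots> \<le> (\<Sum>(i, i')\<in>{..<n} \<times> {..<n}. (D i i')\<^sup>2) * (real n)\<^sup>2"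
      using sum_squared_le_sum_of_squares[of "\<lambda>(i, i'). \<bar>D i i'\<bar>" "{..<n} \<times> {..<n}"]
      by (simp add: case_prod_unfold power2_eq_square)
    also have "\<dots> \<le> (\<Sum>(i, i')\<in>{..<n} \<times> {..<n}. m (X i i' * X i i') / (real n')\<^sup>2) * (real n)\<^sup>2"
      using D_le by (intro mult_right_mono sum_mono) auto
    also have "(\<Sum>(i, i')\<in>{..<n} \<times> {..<n}. m (X i i' * X i i') / (real n')\<^sup>2)
        = gbox m u2 {..<n} (\<psi> \<circ> h) {..<n'} (\<lambda>j. \<psi> (k j) - \<phi> (k j)) / (real n')\<^sup>2"
      unfolding gbox_def X_def b_def \<theta>_def
      by (simp add: sum.cartesian_product[symmetric] sum_divide_distrib)
    also have "\<dots> \<le> (real n)\<^sup>2 * \<beta> ^ 4"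
      using bx n by (simp add: field_simps)
    also have "(real n)\<^sup>2 * \<beta> ^ 4 * (real n)\<^sup>2 = ((real n)\<^sup>2 * \<beta>\<^sup>2)\<^sup>2"
      by (simp add: power_mult_distrib power_mult[symmetric] mult.assoc mult.commute)
    finally show ?thesis
      by (rule power2_le_imp_le) (auto simp: mult_right_mono)
  qed
  define Z where "Z \<omega> g = (1 / real n) *\<^sub>R (\<Sum>i<n. \<omega> (h i) *\<^sub>R U (g + h i))" for \<omega> :: "'g \<Rightarrow> real" and g
  have ubZ: "ubnd (Z \<omega>)" for \<omega> unfolding Z_def by (intro bnd_intros ubU)
  have Z_le: "M (Bfun (\<lambda>g. \<bar>m (u0 * Z \<omega> g)\<bar>)) \<le> \<beta>" if \<omega>: "\<omega> \<in> W" for \<omega>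
  proof -
    have bUU: "bnd (\<lambda>g. m (U (g + h i) * U (g + h i')))" for i i'
      by (intro m.bnd_m ubnd_mult ubU)
    have "(M (Bfun (\<lambda>g. \<bar>m (u0 * Z \<omega> g)\<bar>)))\<^sup>2 \<le> M (Bfun (\<lambda>g. \<bar>m (u0 * Z \<omega> g)\<bar>\<^sup>2))"
      by (intro M.mean_square bnd_intros m.bnd_m ubZ)
    also have "\<dots> \<le> M (Bfun (\<lambda>g. m (Z \<omega> g * Z \<omega> g)))"
    proof (intro M.mean_mono bnd_intros m.bnd_m ubZ)
      fix g
      show "\<bar>m (u0 * Z \<omega> g)\<bar>\<^sup>2 \<le> m (Z \<omega> g * Z \<omega> g)"
        using m.m_CS_1[of u0 "Z \<omega> g"] u(1) by simp
    qed
    also have "\<dots> = (\<Sum>i<n. \<Sum>i'<n. \<omega> (h i) * \<omega> (h i') * D i i') / (real n)\<^sup>2"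
    proof -
      have "m (Z \<omega> g * Z \<omega> g) = (1 / (real n)\<^sup>2) * (\<Sum>i<n. \<Sum>i'<n. (\<omega> (h i) * \<omega> (h i')) * m (U (g + h i) * U (g + h i')))" for g
        unfolding Z_def
        by (simp add: bfun_scaleR_mult m.m_scale sum_product m.m_sum power2_eq_square ac_simps)
      then have "M (Bfun (\<lambda>g. m (Z \<omega> g * Z \<omega> g))) = M (Bfun (\<lambda>g. (1 / (real n)\<^sup>2) *
          (\<Sum>i<n. \<Sum>i'<n. (\<omega> (h i) * \<omega> (h i')) * m (U (g + h i) * U (g + h i')))))"
        by simp
      also have "\<dots> = (1 / (real n)\<^sup>2) * M (Bfun (\<lambda>g. \<Sum>i<n. \<Sum>i'<n. (\<omega> (h i) * \<omega> (h i')) * m (U (g + h i) * U (g + h i'))))"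
        by (intro M.mean_cmult bnd_intros bUU)
      also have "M (Bfun (\<lambda>g. \<Sum>i<n. \<Sum>i'<n. (\<omega> (h i) * \<omega> (h i')) * m (U (g + h i) * U (g + h i'))))
          = (\<Sum>i<n. M (Bfun (\<lambda>g. \<Sum>i'<n. (\<omega> (h i) * \<omega> (h i')) * m (U (g + h i) * U (g + h i')))))"
        by (intro M.mean_sum bnd_intros bUU finite_lessThan)
      also have "\<dots> = (\<Sum>i<n. \<Sum>i'<n. M (Bfun (\<lambda>g. (\<omega> (h i) * \<omega> (h i')) * m (U (g + h i) * U (g + h i')))))"
        by (intro sum.cong refl M.mean_sum bnd_intros bUU finite_lessThan)
      also have "\<dots> = (\<Sum>i<n. \<Sum>i'<n. (\<omega> (h i) * \<omega> (h i')) * D i i')"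
        unfolding D_def by (intro sum.cong refl M.mean_cmult bUU)
      finally show ?thesis by simp
    qed
    also have "\<dots> \<le> (\<Sum>i<n. \<Sum>i'<n. \<bar>D i i'\<bar>) / (real n)\<^sup>2"
    proof (intro divide_right_mono sum_mono)
      fix i i'
      have "\<bar>\<omega> (h i) * \<omega> (h i')\<bar> \<le> 1"
        by (intro abs_mult_le_1 W(2)[OF \<omega>])
      then have "\<bar>\<omega> (h i) * \<omega> (h i')\<bar> * \<bar>D i i'\<bar> \<le> \<bar>D i i'\<bar>"
        by (simp add: mult_left_le_one_le)
      then show "\<omega> (h i) * \<omega> (h i') * D i i' \<le> \<bar>D i i'\<bar>"
        by (metis abs_le_D1 abs_mult)
    qed auto
    also have "\<dots> \<le> \<beta>\<^sup>2" using sumD n by (simp add: field_simps)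
    finally show ?thesis using \<beta> by (rule power2_le_imp_le)
  qed
  define f where "f g = w g * m (u0 * U g)" for g
  have bf: "bnd f" unfolding f_def using ubU[of 0] by (intro bnd_intros w m.bnd_m) simp
  have mU: "\<bar>m (u0 * U g)\<bar> \<le> 1" for g
    by (intro m.m_abs_le) (simp add: abs_mult_le_1 u U1)
  have point: "\<bar>(\<Sum>i<n. f (g + h i)) / real n\<bar> \<le> \<epsilon> + (\<Sum>\<omega>\<in>W. \<bar>m (u0 * Z \<omega> g)\<bar>)" for g
  proof -
    obtain \<omega> where \<omega>: "\<omega> \<in> W" "\<And>x. \<bar>w (g + x) - \<omega> x\<bar> \<le> \<epsilon>" using W(3) by blast
    have mZ: "m (u0 * Z \<omega> g) = (\<Sum>i<n. \<omega> (h i) * m (u0 * U (g + h i))) / real n"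
      unfolding Z_def by (simp add: bfun_scaleR_mult m.m_scale sum_distrib_left m.m_sum sum_divide_distrib)
    have "(\<Sum>i<n. f (g + h i)) / real n - m (u0 * Z \<omega> g)
        = (\<Sum>i<n. (w (g + h i) - \<omega> (h i)) * m (u0 * U (g + h i))) / real n"
      unfolding mZ f_def left_diff_distrib sum_subtractf diff_divide_distrib ..
    moreover have "\<bar>\<Sum>i<n. (w (g + h i) - \<omega> (h i)) * m (u0 * U (g + h i))\<bar> \<le> (\<Sum>i<n. \<epsilon>)"
    proof (rule order_trans[OF sum_abs sum_mono])
      fix i
      show "\<bar>(w (g + h i) - \<omega> (h i)) * m (u0 * U (g + h i))\<bar> \<le> \<epsilon>"
        using mult_mono[OF \<omega>(2)[of "h i"] mU[of "g + h i"]] order_trans[OF abs_ge_zero \<omega>(2)[of "h i"]]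
        by (simp add: abs_mult)
    qed
    ultimately have "\<bar>(\<Sum>i<n. f (g + h i)) / real n - m (u0 * Z \<omega> g)\<bar> \<le> \<epsilon>"
      using n by (simp add: field_simps)
    \<comment> \<open>The fitting \<open>\<omega>\<close> depends on \<open>g\<close>; the sum over
      all of \<open>W\<close> dominates its term by an expression that can be averaged over
      \<open>g\<close> summand by summand.\<close>
    moreover have "\<bar>m (u0 * Z \<omega> g)\<bar> \<le> (\<Sum>\<omega>\<in>W. \<bar>m (u0 * Z \<omega> g)\<bar>)"
      using \<omega>(1) W(1) by (intro member_le_sum) auto
    ultimately show ?thesis by linarith
  qed
  have "bnd (\<lambda>g. \<Sum>i<n. f (g + h i))" by (intro bnd_sum bnd_comp[OF bf])
  then have "M (Bfun f) = M (Bfun (\<lambda>g. (\<Sum>i<n. f (g + h i)) / real n))"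
    using M.mean_cmult[of "\<lambda>g. \<Sum>i<n. f (g + h i)" "1 / real n"] n
      M.mean_sum_shift[OF finite_lessThan[of n] bf, of h]
    by simp
  also have "\<bar>\<dots>\<bar> \<le> M (Bfun (\<lambda>g. \<bar>(\<Sum>i<n. f (g + h i)) / real n\<bar>))"
    by (intro M.mean_abs bnd_intros bnd_comp[OF bf])
  also have "\<dots> \<le> M (Bfun (\<lambda>g. \<epsilon> + (\<Sum>\<omega>\<in>W. \<bar>m (u0 * Z \<omega> g)\<bar>)))"
    by (intro M.mean_mono bnd_intros bnd_comp[OF bf] m.bnd_m ubZ point)
  also have "\<dots> = \<epsilon> + (\<Sum>\<omega>\<in>W. M (Bfun (\<lambda>g. \<bar>m (u0 * Z \<omega> g)\<bar>)))"
  proof -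
    have b: "bnd (\<lambda>g. \<bar>m (u0 * Z \<omega> g)\<bar>)" for \<omega> by (intro bnd_intros m.bnd_m ubZ)
    show ?thesis using M.mean_sum[OF W(1) b] by (simp add: M.mean_add M.mean_const bnd_sum b bnd_const)
  qed
  also have "\<dots> \<le> \<epsilon> + real (card W) * \<beta>"
    using sum_bounded_above[OF Z_le] by simp
  finally show ?thesis unfolding f_def U_def .
qed

section \<open>Averaging over a subgroup of finite index\<close>

definition transversal :: "('g::ab_group_add \<Rightarrow> 'g) \<Rightarrow> 'g set \<Rightarrow> bool" where
  "transversal \<psi> R \<longleftrightarrow> finite R \<and> R \<noteq> {} \<and> (\<forall>g. \<exists>!r. r \<in> R \<and> g - r \<in> range \<psi>)"

lemma transversal_exists:
  assumes hom: "additive_hom \<psi>" and fin: "finite_index (range \<psi>)"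
  obtains R where "transversal \<psi> R"
proof -
  note h = additive_hom_simps[OF hom]
  define H where "H = range \<psi>"
  have Hadd: "x + y \<in> H" and Hdiff: "x - y \<in> H" if "x \<in> H" "y \<in> H" for x y
    using that h unfolding H_def by (auto simp: image_iff) metis+
  have H0: "0 \<in> H" unfolding H_def by (metis h(2) rangeI)
  have coset: "translate H g = translate H r \<longleftrightarrow> g - r \<in> H" for g r
  proof
    assume "translate H g = translate H r"
    moreover have "g \<in> translate H g" unfolding translate_def using H0 by force
    ultimately obtain a where "a \<in> H" "g = a + r" unfolding translate_def by auto
    then show "g - r \<in> H" by simp
  next
    assume gr: "g - r \<in> H"
    have "a + g \<in> translate H r" if "a \<in> H" for a
      unfolding translate_def by (rule image_eqI[of _ _ "a + (g - r)"]) (simp_all add: Hadd that gr)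
    moreover have "a + r \<in> translate H g" if "a \<in> H" for a
      unfolding translate_def by (rule image_eqI[of _ _ "a - (g - r)"]) (simp_all add: Hdiff that gr)
    ultimately show "translate H g = translate H r" unfolding translate_def by blast
  qed
  define rep where "rep C = (SOME g. translate H g = C)" for C
  have rep: "translate H (rep (translate H g)) = translate H g" for g
    unfolding rep_def by (rule someI[of _ g]) simp
  define R where "R = rep ` range (translate H)"
  have "\<exists>!r. r \<in> R \<and> g - r \<in> H" for g
  proof (rule ex1I[of _ "rep (translate H g)"])
    show "rep (translate H g) \<in> R \<and> g - rep (translate H g) \<in> H"
      using rep[of g] coset[of g "rep (translate H g)"] by (simp add: R_def)
    fix r assume r: "r \<in> R \<and> g - r \<in> H"
    then obtain g' where "r = rep (translate H g')" by (auto simp: R_def)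
    moreover from this r have "translate H g' = translate H g" using coset[of g r] rep[of g'] by simp
    ultimately show "r = rep (translate H g)" by simp
  qed
  moreover have "finite R" "R \<noteq> {}" using fin unfolding R_def H_def finite_index_def by auto
  ultimately show ?thesis using that[of R] unfolding transversal_def H_def by blast
qed

text \<open>\<open>M\<close> pushed forward along \<open>\<psi>\<close> is guaranteed to be
  invariant only under \<open>range \<psi>\<close>; averaging its shifts over coset representatives
  makes it invariant under the whole group.\<close>

definition coset_mean :: "('g::ab_group_add bfun \<Rightarrow> real) \<Rightarrow> ('g \<Rightarrow> 'g) \<Rightarrow> 'g set \<Rightarrow> 'g bfun \<Rightarrow> real" where
  "coset_mean M \<psi> R F = (\<Sum>r\<in>R. M (Bfun (\<lambda>k. ap F (\<psi> k + r)))) / real (card R)"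

text \<open>Translation by \<open>t\<close> permutes the cosets through \<open>\<sigma>\<close>; the
  remaining displacement is some \<open>\<psi> a\<close>, which becomes a shift of the variable of
  \<open>M\<close>.\<close>

lemma inv_mean_coset_mean:
  assumes M: "inv_mean M" and hom: "additive_hom \<psi>" and R: "transversal \<psi> R"
  shows "inv_mean (coset_mean M \<psi> R)"
proof
  interpret M: inv_mean M by fact
  have R': "finite R" "R \<noteq> {}" "card R > 0" using R by (auto simp: transversal_def card_gt_0_iff)
  fix f g :: "'a bfun" and c :: real and t :: 'a
  show "coset_mean M \<psi> R (f + g) = coset_mean M \<psi> R f + coset_mean M \<psi> R g"
    by (simp add: coset_mean_def M.mean_add bnd_intros sum.distrib add_divide_distrib)
  show "coset_mean M \<psi> R (c *\<^sub>R f) = c * coset_mean M \<psi> R f"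
    by (simp add: coset_mean_def M.mean_cmult bnd_intros sum_distrib_left)
  show "0 \<le> coset_mean M \<psi> R f" if "\<And>x. 0 \<le> ap f x"
    unfolding coset_mean_def by (intro divide_nonneg_nonneg sum_nonneg M.mean_ge bnd_intros that) simp
  show "coset_mean M \<psi> R 1 = 1"
    using R' by (simp add: coset_mean_def M.mean_const)
  have ex1: "\<exists>!r. r \<in> R \<and> g - r \<in> range \<psi>" for g
    using R by (simp only: transversal_def)
  define \<sigma> where "\<sigma> r = (THE r'. r' \<in> R \<and> (r + t) - r' \<in> range \<psi>)" for r
  have \<sigma>: "\<sigma> r \<in> R \<and> (r + t) - \<sigma> r \<in> range \<psi>" for r
    unfolding \<sigma>_def by (rule theI'[OF ex1])
  have inj: "inj_on \<sigma> R"
  proof (rule inj_onI)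
    fix r r' assume r: "r \<in> R" "r' \<in> R" "\<sigma> r = \<sigma> r'"
    obtain a b where ab: "(r + t) - \<sigma> r = \<psi> a" "(r' + t) - \<sigma> r' = \<psi> b" using \<sigma> by (metis imageE)
    have "r - r' = ((r + t) - \<sigma> r) - ((r' + t) - \<sigma> r')" using r(3) by simp
    then have "r - r' = \<psi> (a - b)" by (simp only: ab additive_hom_simps[OF hom])
    moreover have "r - r = \<psi> 0" by (simp add: additive_hom_simps[OF hom])
    ultimately have "r - r' \<in> range \<psi>" "r - r \<in> range \<psi>" by blast+
    then show "r = r'" using r(1,2) ex1[of r] by (metis (no_types, lifting))
  qed
  have bij: "bij_betw \<sigma> R R"
    using endo_inj_surj[OF R'(1) _ inj] \<sigma> inj unfolding bij_betw_def by blast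
  have "M (Bfun (\<lambda>k. ap (tr t f) (\<psi> k + r))) = M (Bfun (\<lambda>k. ap f (\<psi> k + \<sigma> r)))" for r
  proof -
    obtain a where a: "(r + t) - \<sigma> r = \<psi> a" using \<sigma> by (metis imageE)
    have "\<psi> k + r + t = \<psi> (k + a) + \<sigma> r" for k
      by (simp add: additive_hom_simps[OF hom] a[symmetric] algebra_simps)
    then have "(\<lambda>k. ap (tr t f) (\<psi> k + r)) = (\<lambda>k. ap f (\<psi> (k + a) + \<sigma> r))" by simp
    then show ?thesis using M.mean_shift[of "\<lambda>k. ap f (\<psi> k + \<sigma> r)" a] by (simp add: bnd_intros)
  qed
  then have "(\<Sum>r\<in>R. M (Bfun (\<lambda>k. ap (tr t f) (\<psi> k + r)))) = (\<Sum>r\<in>R. M (Bfun (\<lambda>k. ap f (\<psi> k + r))))"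
    using sum.reindex_bij_betw[OF bij, of "\<lambda>r. M (Bfun (\<lambda>k. ap f (\<psi> k + r)))"] by simp
  then show "coset_mean M \<psi> R (tr t f) = coset_mean M \<psi> R f"
    by (simp add: coset_mean_def)
qed

text \<open>The positive definite function attached to \<open>u\<close>. As in Wiener's lemma, its
  mean square measures the almost periodic part of \<open>u\<close>; see
  \<open>uniformity_inverse\<close>.\<close>

definition autocorr :: "('g::ab_group_add bfun \<Rightarrow> real) \<Rightarrow> 'g bfun \<Rightarrow> 'g bfun" where
  "autocorr m u = Bfun (\<lambda>t. m (u * tr t u))"

lemma (in inv_mean) ap_autocorr: "ap (autocorr m u) t = m (u * tr t u)"
  unfolding autocorr_def by (subst ap_Bfun) (auto intro!: bnd_m bnd_intros)

lemma (in inv_mean) m_tr_tr: "m (tr x u * tr y u) = ap (autocorr m u) (y - x)"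
proof -
  have "tr x u * tr y u = tr x (u * tr (y - x) u)" by (simp add: tr_simps)
  then show ?thesis by (simp add: ap_autocorr)
qed

lemma (in inv_mean) autocorr_minus: "ap (autocorr m u) (- t) = ap (autocorr m u) t"
  using m_tr_tr[of 0 u t] m_tr_tr[of t u 0] by (simp add: mult.commute)

text \<open>Adding representatives from \<open>R\<close> and \<open>R'\<close> spreads both families
  of directions over the whole group. There ergodicity replaces the average over the second
  direction by \<open>(m (b i i'))\<^sup>2\<close>, the square of a value of \<open>c\<close>, and
  averaging in the first direction gives the mean square of \<open>c\<close>. The enlarged sum gains
  the squares of both cardinalities while \<open>gbox_refine\<close> recovers only one factor of
  each, which leaves \<open>card R * card R'\<close>. The shifts \<open>h\<close> are chosen first
  and \<open>k\<close> is adapted to them.\<close>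

lemma small_gbox:
  fixes m M :: "'g::ab_group_add bfun \<Rightarrow> real" and u
  assumes m: "ergodic_mean m" and M: "inv_mean M"
    and hom: "additive_hom \<psi>" "additive_hom \<theta>" and R: "transversal \<psi> R" and R': "transversal \<theta> R'"
    and "\<eta> > 0"
  defines "c \<equiv> autocorr m u"
  obtains n n' :: nat and h k where "n > 0" "n' > 0"
    "gbox m u {..<n} (\<psi> \<circ> h) {..<n'} (\<theta> \<circ> k)
      \<le> (real n)\<^sup>2 * (real n')\<^sup>2 * (real (card R) * real (card R') * (coset_mean M \<psi> R (c * c) + \<eta>))"
proof -
  interpret m: inv_mean m using m by (simp add: ergodic_mean_def)
  interpret M: inv_mean M by fact
  interpret C: inv_mean "coset_mean M \<psi> R" by (rule inv_mean_coset_mean[OF M hom(1) R])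
  have C': "inv_mean (coset_mean M \<theta> R')" by (rule inv_mean_coset_mean[OF M hom(2) R'])
  note h\<psi> = additive_hom_simps[OF hom(1)] and h\<theta> = additive_hom_simps[OF hom(2)]
  have finR: "finite R" "card R > 0" "finite R'" "card R' > 0"
    using R R' by (auto simp: transversal_def card_gt_0_iff)
  have coset: "(\<Sum>r\<in>R. M (Bfun (\<lambda>k. ap F (\<psi> k + r)))) = real (card R) * coset_mean M \<psi> R F" for F
    using finR by (simp add: coset_mean_def)
  have coset': "(\<Sum>r\<in>R'. M (Bfun (\<lambda>k. ap F (\<theta> k + r)))) = real (card R') * coset_mean M \<theta> R' F" for F
    using finR by (simp add: coset_mean_def)
  define \<mu> where "\<mu> = coset_mean M \<psi> R (c * c)"
  \<comment> \<open>Both \<open>r\<close> and \<open>r'\<close> run over \<open>R\<close> because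
    both indices of the box sum are enlarged. For fixed \<open>r'\<close> the mean of the sum over
    \<open>r\<close> is \<open>card R\<close> times a coset mean, so \<open>D2\<close> has mean
    \<open>(card R)\<^sup>2 * \<mu>\<close>.\<close>
  define D2 where "D2 x = (\<Sum>r'\<in>R. \<Sum>r\<in>R. (ap c (\<psi> x + r - r'))\<^sup>2)" for x
  have "bnd D2" unfolding D2_def by (intro bnd_intros)
  have "D2 (- x) = D2 x" for x
  proof -
    have "ap c (\<psi> (- x) + r - r') = ap c (\<psi> x + r' - r)" for r r'
      using m.autocorr_minus[of u "\<psi> x + r' - r"] by (simp add: c_def h\<psi> algebra_simps)
    then show ?thesis unfolding D2_def by (subst sum.swap) simp
  qed
  have "M (Bfun D2) = (\<Sum>r'\<in>R. \<Sum>r\<in>R. M (Bfun (\<lambda>x. ap (tr (- r') (c * c)) (\<psi> x + r))))"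
    unfolding D2_def using finR(1)
    by (simp add: M.mean_sum bnd_intros power2_eq_square)
  also have "\<dots> = (real (card R))\<^sup>2 * \<mu>"
    unfolding coset by (simp add: \<mu>_def power2_eq_square)
  finally have MD2: "M (Bfun D2) = (real (card R))\<^sup>2 * \<mu>" .
  have "(real (card R))\<^sup>2 * \<eta> / 2 > 0"
    using finR \<open>\<eta> > 0\<close> by (intro divide_pos_pos mult_pos_pos zero_less_power) auto
  then obtain n h where n: "n > 0"
    and nh: "(\<Sum>i<n. \<Sum>j<n. D2 (h i - h j)) \<le> (real n)\<^sup>2 * (M (Bfun D2) + (real (card R))\<^sup>2 * \<eta> / 2)"
    using M.greedy_differences[OF \<open>bnd D2\<close> \<open>\<And>x. D2 (- x) = D2 x\<close>] by blast
  note nh = nh[unfolded MD2]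
  define I where "I = {..<n} \<times> R"
  define p where "p = (\<lambda>(i, r). (\<psi> \<circ> h) i + r)"
  define b where "b i i' = tr (p i) u * tr (p i') u" for i i'
  have finI: "finite I" using finR by (simp add: I_def)
  have sumI: "(\<Sum>i\<in>I. \<Sum>i'\<in>I. (m (b i i'))\<^sup>2) = (\<Sum>i<n. \<Sum>j<n. D2 (h i - h j))"
  proof -
    have "(\<Sum>i\<in>I. \<Sum>i'\<in>I. (m (b i i'))\<^sup>2)
      = (\<Sum>i<n. \<Sum>r\<in>R. \<Sum>j<n. \<Sum>r'\<in>R. (ap c (\<psi> (h j - h i) + r' - r))\<^sup>2)"
      unfolding b_def m.m_tr_tr c_def[symmetric] I_def p_def
      by (simp add: sum.cartesian_product' h\<psi> algebra_simps)
    also have "\<dots> = (\<Sum>i<n. \<Sum>j<n. D2 (h j - h i))"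
      unfolding D2_def by (subst (2) sum.swap) (rule refl)
    also have "\<dots> = (\<Sum>i<n. \<Sum>j<n. D2 (h i - h j))"
      by (rule sum.swap)
    finally show ?thesis .
  qed
  define D1 where "D1 x = (\<Sum>i\<in>I. \<Sum>i'\<in>I. \<Sum>r'\<in>R'. \<Sum>r\<in>R'. m (tr r' (b i i') * tr (\<theta> x + r) (b i i')))" for x
  have "bnd D1" unfolding D1_def by (intro bnd_intros m.bnd_m)
  have "D1 (- x) = D1 x" for x
  proof -
    have "m (tr r' B * tr (\<theta> (- x) + r) B) = m (tr r B * tr (\<theta> x + r') B)" for r r' B
      using m.m_tr[of "\<theta> x" "tr r' B * tr (\<theta> (- x) + r) B"] by (simp add: tr_simps h\<theta> ac_simps)
    then show ?thesis unfolding D1_def by (subst (3) sum.swap) simp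
  qed
  have MD1: "M (Bfun D1) = (real (card R'))\<^sup>2 * (\<Sum>i\<in>I. \<Sum>i'\<in>I. (m (b i i'))\<^sup>2)"
  proof -
    have bb: "bnd (\<lambda>x. m (tr r' B * tr (\<theta> x + r) B))" for r r' B
      by (intro bnd_intros m.bnd_m)
    have "(\<Sum>r\<in>R'. M (Bfun (\<lambda>x. m (tr r' B * tr (\<theta> x + r) B)))) = real (card R') * (m B)\<^sup>2" for B r'
    proof -
      have "bnd (\<lambda>t. m (tr r' B * tr t B))" by (intro bnd_intros m.bnd_m)
      then show ?thesis
        using coset'[of "Bfun (\<lambda>t. m (tr r' B * tr t B))"] ergodic_mean_product[OF m C', of "tr r' B" B]
        by (simp add: power2_eq_square)
    qed
    then show ?thesis
      unfolding D1_def using finI finR(3)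
      by (simp add: M.mean_sum bnd_sum bb power2_eq_square sum_distrib_left mult.assoc)
  qed
  \<comment> \<open>Half of the final \<open>\<eta>\<close> was spent on choosing \<open>h\<close>,
    the other half goes to \<open>k\<close>; the remaining factors are those that multiply
    \<open>\<mu>\<close> in the enlarged sum.\<close>
  define \<eta>2 where "\<eta>2 = (real n)\<^sup>2 * (real (card R))\<^sup>2 * (real (card R'))\<^sup>2 * \<eta> / 2"
  have "\<eta>2 > 0"
    unfolding \<eta>2_def using n finR \<open>\<eta> > 0\<close> by (intro divide_pos_pos mult_pos_pos zero_less_power) auto
  then obtain n' k where n': "n' > 0" and nk: "(\<Sum>i<n'. \<Sum>j<n'. D1 (k i - k j)) \<le> (real n')\<^sup>2 * (M (Bfun D1) + \<eta>2)"
    using M.greedy_differences[OF \<open>bnd D1\<close> \<open>\<And>x. D1 (- x) = D1 x\<close>] by blast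
  define J where "J = {..<n'} \<times> R'"
  define q where "q = (\<lambda>(j, r). (\<theta> \<circ> k) j + r)"
  have big: "gbox m u I p J q = (\<Sum>i<n'. \<Sum>j<n'. D1 (k i - k j))"
  proof -
    have "m (tr (\<theta> (k j) + r) B * tr (\<theta> (k j') + r') B) = m (tr r B * tr (\<theta> (k j' - k j) + r') B)" for j j' r r' B
      using m.m_tr[of "- \<theta> (k j)" "tr (\<theta> (k j) + r) B * tr (\<theta> (k j') + r') B"]
      by (simp add: tr_simps h\<theta> algebra_simps)
    then have "gbox m u I p J q = (\<Sum>i\<in>I. \<Sum>i'\<in>I. \<Sum>j<n'. \<Sum>r\<in>R'. \<Sum>j'<n'. \<Sum>r'\<in>R'. m (tr r (b i i') * tr (\<theta> (k j' - k j) + r') (b i i')))"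
      unfolding m.gbox_expand b_def[symmetric] J_def q_def
      by (simp add: sum.cartesian_product')
    also have "\<dots> = (\<Sum>i\<in>I. \<Sum>i'\<in>I. \<Sum>j<n'. \<Sum>j'<n'. \<Sum>r\<in>R'. \<Sum>r'\<in>R'. m (tr r (b i i') * tr (\<theta> (k j' - k j) + r') (b i i')))"
      by (intro sum.cong refl sum.swap)
    also have "\<dots> = (\<Sum>i\<in>I. \<Sum>j<n'. \<Sum>i'\<in>I. \<Sum>j'<n'. \<Sum>r\<in>R'. \<Sum>r'\<in>R'. m (tr r (b i i') * tr (\<theta> (k j' - k j) + r') (b i i')))"
      by (intro sum.cong refl sum.swap)
    also have "\<dots> = (\<Sum>j<n'. \<Sum>i\<in>I. \<Sum>j'<n'. \<Sum>i'\<in>I. \<Sum>r\<in>R'. \<Sum>r'\<in>R'. m (tr r (b i i') * tr (\<theta> (k j' - k j) + r') (b i i')))"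
      by (subst sum.swap) (intro sum.cong refl sum.swap)
    also have "\<dots> = (\<Sum>j<n'. \<Sum>j'<n'. D1 (k j' - k j))"
      unfolding D1_def by (intro sum.cong refl sum.swap)
    also have "\<dots> = (\<Sum>i<n'. \<Sum>j<n'. D1 (k i - k j))" by (rule sum.swap)
    finally show ?thesis .
  qed
  have "real (card R') * (real (card R) * gbox m u {..<n} (\<psi> \<circ> h) {..<n'} (\<theta> \<circ> k)) \<le> real (card R') * gbox m u I p {..<n'} (\<theta> \<circ> k)"
    unfolding I_def p_def by (intro mult_left_mono m.gbox_refine finR) auto
  also have "\<dots> = real (card R') * gbox m u {..<n'} (\<theta> \<circ> k) I p" by (subst m.gbox_commute) (rule refl)
  also have "\<dots> \<le> gbox m u J q I p" unfolding J_def q_def by (intro m.gbox_refine finR) auto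
  also have "\<dots> = (\<Sum>i<n'. \<Sum>j<n'. D1 (k i - k j))" using big by (subst m.gbox_commute) simp
  also have "\<dots> \<le> (real n')\<^sup>2 * (M (Bfun D1) + \<eta>2)" by (rule nk)
  also have "\<dots> \<le> (real n')\<^sup>2 * ((real (card R'))\<^sup>2 * ((real n)\<^sup>2 * ((real (card R))\<^sup>2 * \<mu> + (real (card R))\<^sup>2 * \<eta> / 2)) + \<eta>2)"
    unfolding MD1 sumI by (intro mult_left_mono add_right_mono nh) auto
  also have "\<dots> = real (card R') * (real (card R) * ((real n)\<^sup>2 * (real n')\<^sup>2 * (real (card R) * real (card R') * (\<mu> + \<eta>))))"
    by (simp add: \<eta>2_def algebra_simps power2_eq_square)
  finally have "gbox m u {..<n} (\<psi> \<circ> h) {..<n'} (\<theta> \<circ> k)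
      \<le> (real n)\<^sup>2 * (real n')\<^sup>2 * (real (card R) * real (card R') * (\<mu> + \<eta>))"
    using finR by simp
  then show ?thesis using that n n' unfolding \<mu>_def by blast
qed

section \<open>Almost periodic functions\<close>

text \<open>Bohr almost periodicity in Bochner's form: the translation orbit of \<open>F\<close> is
  totally bounded for the sup norm.\<close>

definition almost_periodic :: "'g::ab_group_add bfun \<Rightarrow> bool" where
  "almost_periodic F \<longleftrightarrow>
    (\<forall>\<epsilon>>0. \<exists>S. finite S \<and> (\<forall>s. \<exists>t\<in>S. \<forall>x. \<bar>ap F (x + s) - ap F (x + t)\<bar> \<le> \<epsilon>))"

lemma finite_range_representatives:
  assumes "finite (range \<kappa>)"
  shows "\<exists>T. finite T \<and> (\<forall>s. \<exists>t\<in>T. \<kappa> t = \<kappa> s)"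
  using assms by (intro exI[of _ "inv \<kappa> ` range \<kappa>"]) (auto simp: f_inv_into_f)

text \<open>Finite nets for two functions need not share points, whereas two finite colourings of
  the group combine by pairing. A net at scale \<open>\<epsilon> / 2\<close> gives a colouring at
  scale \<open>\<epsilon>\<close>.\<close>

lemma almost_periodic_classes:
  fixes F :: "'g::ab_group_add bfun"
  assumes "almost_periodic F" "\<epsilon> > 0"
  shows "\<exists>\<kappa> :: 'g \<Rightarrow> 'g. finite (range \<kappa>) \<and>
    (\<forall>s t x. \<kappa> s = \<kappa> t \<longrightarrow> \<bar>ap F (x + s) - ap F (x + t)\<bar> \<le> \<epsilon>)"
proof -
  obtain S where S: "finite S" "\<And>s. \<exists>t\<in>S. \<forall>x. \<bar>ap F (x + s) - ap F (x + t)\<bar> \<le> \<epsilon> / 2"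
    using assms unfolding almost_periodic_def by (meson half_gt_zero)
  then obtain \<kappa> where \<kappa>: "\<And>s. \<kappa> s \<in> S" "\<And>s x. \<bar>ap F (x + s) - ap F (x + \<kappa> s)\<bar> \<le> \<epsilon> / 2"
    by metis
  have "finite (range \<kappa>)" using S(1) \<kappa>(1) by (meson finite_subset image_subsetI)
  moreover have "\<bar>ap F (x + s) - ap F (x + t)\<bar> \<le> \<epsilon>" if "\<kappa> s = \<kappa> t" for s t x
    using \<kappa>(2)[of x s] \<kappa>(2)[of x t] unfolding that by linarith
  ultimately show ?thesis by blast
qed

lemma almost_periodicI:
  assumes "\<And>\<epsilon>. \<epsilon> > 0 \<Longrightarrow> \<exists>\<kappa> :: 'g::ab_group_add \<Rightarrow> 'k. finite (range \<kappa>) \<and>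
    (\<forall>s t x. \<kappa> s = \<kappa> t \<longrightarrow> \<bar>ap F (x + s) - ap F (x + t)\<bar> \<le> \<epsilon>)"
  shows "almost_periodic F"
  unfolding almost_periodic_def
proof (intro allI impI)
  fix \<epsilon> :: real assume "\<epsilon> > 0"
  then obtain \<kappa> :: "'g \<Rightarrow> 'k" where \<kappa>: "finite (range \<kappa>)"
    "\<And>s t x. \<kappa> s = \<kappa> t \<Longrightarrow> \<bar>ap F (x + s) - ap F (x + t)\<bar> \<le> \<epsilon>"
    using assms by blast
  obtain T where "finite T" "\<And>s. \<exists>t\<in>T. \<kappa> t = \<kappa> s"
    using finite_range_representatives[OF \<kappa>(1)] by blast
  then show "\<exists>S. finite S \<and> (\<forall>s. \<exists>t\<in>S. \<forall>x. \<bar>ap F (x + s) - ap F (x + t)\<bar> \<le> \<epsilon>)"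
    using \<kappa>(2) by metis
qed

text \<open>One estimate for sums, multiples, products and truncation to \<open>[0, 1]\<close>:
  colour by the pair of classes of \<open>F\<close> and \<open>G\<close>.\<close>

lemma almost_periodic_lipschitz:
  fixes F G H :: "'g::ab_group_add bfun"
  assumes F: "almost_periodic F" "almost_periodic G" and K: "K \<ge> 0"
    and H: "\<And>x y. \<bar>ap H x - ap H y\<bar> \<le> K * (\<bar>ap F x - ap F y\<bar> + \<bar>ap G x - ap G y\<bar>)"
  shows "almost_periodic H"
proof (rule almost_periodicI)
  fix \<epsilon> :: real assume \<epsilon>: "\<epsilon> > 0"
  define \<delta> where "\<delta> = \<epsilon> / (2 * K + 1)"
  have \<delta>: "\<delta> > 0" using \<epsilon> K by (simp add: \<delta>_def)
  obtain \<kappa> :: "'g \<Rightarrow> 'g" where \<kappa>: "finite (range \<kappa>)" "\<And>s t x. \<kappa> s = \<kappa> t \<Longrightarrow> \<bar>ap F (x + s) - ap F (x + t)\<bar> \<le> \<delta>"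
    using almost_periodic_classes[OF F(1) \<delta>] by blast
  obtain \<nu> :: "'g \<Rightarrow> 'g" where \<nu>: "finite (range \<nu>)" "\<And>s t x. \<nu> s = \<nu> t \<Longrightarrow> \<bar>ap G (x + s) - ap G (x + t)\<bar> \<le> \<delta>"
    using almost_periodic_classes[OF F(2) \<delta>] by blast
  have "range (\<lambda>s. (\<kappa> s, \<nu> s)) \<subseteq> range \<kappa> \<times> range \<nu>" by auto
  then have "finite (range (\<lambda>s. (\<kappa> s, \<nu> s)))"
    using \<kappa>(1) \<nu>(1) by (meson finite_SigmaI finite_subset)
  moreover have "\<bar>ap H (x + s) - ap H (x + t)\<bar> \<le> \<epsilon>" if "(\<kappa> s, \<nu> s) = (\<kappa> t, \<nu> t)" for s t x
  proof -
    have "\<bar>ap H (x + s) - ap H (x + t)\<bar> \<le> K * (\<delta> + \<delta>)"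
      using H[of "x + s" "x + t"] mult_left_mono[OF add_mono[OF \<kappa>(2)[of s t x] \<nu>(2)[of s t x]] K] that
      by auto
    also have "\<dots> \<le> (2 * K + 1) * \<delta>" using \<delta> by (simp add: algebra_simps)
    also have "\<dots> = \<epsilon>" using K by (simp add: \<delta>_def)
    finally show ?thesis .
  qed
  ultimately show "\<exists>\<kappa> :: 'g \<Rightarrow> 'g \<times> 'g. finite (range \<kappa>) \<and>
    (\<forall>s t x. \<kappa> s = \<kappa> t \<longrightarrow> \<bar>ap H (x + s) - ap H (x + t)\<bar> \<le> \<epsilon>)"
    by (intro exI[of _ "\<lambda>s. (\<kappa> s, \<nu> s)"]) blast
qed

lemma almost_periodic_add: "almost_periodic F \<Longrightarrow> almost_periodic G \<Longrightarrow> almost_periodic (F + G)"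
  by (rule almost_periodic_lipschitz[of F G 1]) auto

lemma almost_periodic_scaleR: "almost_periodic F \<Longrightarrow> almost_periodic (c *\<^sub>R F)"
  by (rule almost_periodic_lipschitz[of F F "\<bar>c\<bar>"])
     (auto simp: right_diff_distrib[symmetric] abs_mult intro!: mult_left_mono)

lemma almost_periodic_diff:
  assumes "almost_periodic F" "almost_periodic G" shows "almost_periodic (F - G)"
  using almost_periodic_add[OF assms(1) almost_periodic_scaleR[OF assms(2), of "-1"]] by simp

lemma almost_periodic_const: "almost_periodic (c *\<^sub>R 1)"
  unfolding almost_periodic_def by (auto intro!: exI[of _ "{0}"])

lemma almost_periodic_mult:
  assumes "almost_periodic F" "almost_periodic G"
  shows "almost_periodic (F * G)"
proof -
  obtain B where B: "B \<ge> 0" "\<And>x. \<bar>ap F x\<bar> \<le> B" using bnd_ap[of F] by (elim bndE) blast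
  obtain C where C: "C \<ge> 0" "\<And>x. \<bar>ap G x\<bar> \<le> C" using bnd_ap[of G] by (elim bndE) blast
  show ?thesis
  proof (rule almost_periodic_lipschitz[OF assms, of "B + C"])
    fix x y
    have "ap F x * ap G x - ap F y * ap G y = ap G x * (ap F x - ap F y) + ap F y * (ap G x - ap G y)"
      by (simp add: algebra_simps)
    then have "\<bar>ap (F * G) x - ap (F * G) y\<bar> \<le> \<bar>ap G x\<bar> * \<bar>ap F x - ap F y\<bar> + \<bar>ap F y\<bar> * \<bar>ap G x - ap G y\<bar>"
      by (metis abs_mult abs_triangle_ineq ap_simps(6))
    also have "\<dots> \<le> C * \<bar>ap F x - ap F y\<bar> + B * \<bar>ap G x - ap G y\<bar>"
      using B C by (intro add_mono mult_right_mono) auto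
    also have "\<dots> \<le> (B + C) * (\<bar>ap F x - ap F y\<bar> + \<bar>ap G x - ap G y\<bar>)"
      using B(1) C(1) by (simp add: algebra_simps)
    finally show "\<bar>ap (F * G) x - ap (F * G) y\<bar> \<le> (B + C) * (\<bar>ap F x - ap F y\<bar> + \<bar>ap G x - ap G y\<bar>)" .
  qed (use B C in simp)
qed

lemma almost_periodic_comp_hom:
  fixes F :: "'g::ab_group_add bfun"
  assumes "almost_periodic F" "additive_hom \<phi>"
  shows "almost_periodic (Bfun (\<lambda>g. ap F (\<phi> g)))"
proof (rule almost_periodicI)
  fix \<epsilon> :: real assume "\<epsilon> > 0"
  then obtain \<kappa> :: "'g \<Rightarrow> 'g" where \<kappa>: "finite (range \<kappa>)" "\<And>s t x. \<kappa> s = \<kappa> t \<Longrightarrow> \<bar>ap F (x + s) - ap F (x + t)\<bar> \<le> \<epsilon>"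
    using almost_periodic_classes[OF assms(1)] by blast
  have "finite (range (\<lambda>s. \<kappa> (\<phi> s)))" using \<kappa>(1) by (rule finite_subset[rotated]) auto
  moreover have "\<bar>ap F (\<phi> (x + s)) - ap F (\<phi> (x + t))\<bar> \<le> \<epsilon>" if "\<kappa> (\<phi> s) = \<kappa> (\<phi> t)" for s t x
    using \<kappa>(2)[OF that] by (simp add: additive_hom_simps[OF assms(2)])
  ultimately show "\<exists>\<kappa> :: 'g \<Rightarrow> 'g. finite (range \<kappa>) \<and> (\<forall>s t x. \<kappa> s = \<kappa> t \<longrightarrow>
      \<bar>ap (Bfun (\<lambda>g. ap F (\<phi> g))) (x + s) - ap (Bfun (\<lambda>g. ap F (\<phi> g))) (x + t)\<bar> \<le> \<epsilon>)"
    by (intro exI[of _ "\<lambda>s. \<kappa> (\<phi> s)"]) (simp add: bnd_intros)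
qed

text \<open>The form \<open>w \<mapsto> M\<^sub>h m (w * tr h u)\<^sup>2\<close> has trace at most \<open>m (u * u)\<close> by Bessel's inequality, so
  an orthonormal system of nearly maximal trace leaves almost nothing on its complement.\<close>

lemma correlation_orbit_totally_bounded:
  assumes m: "inv_mean m" and M: "inv_mean M" and u: "\<And>x. \<bar>ap u x\<bar> \<le> 1" and "\<epsilon> > 0"
  shows "\<exists>T. finite T \<and>
    (\<forall>s. \<exists>t\<in>T. M (Bfun (\<lambda>h. (m (tr s u * tr h u) - m (tr t u * tr h u))\<^sup>2)) \<le> \<epsilon>)"
proof -
  interpret m: inv_mean m by fact
  interpret M: inv_mean M by fact
  define J where "J w = M (Bfun (\<lambda>h. (m (w * tr h u))\<^sup>2))" for w
  have bJ: "bnd (\<lambda>h. (m (w * tr h u))\<^sup>2)" for w by (intro bnd_intros m.bnd_m)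
  have J_le: "J w \<le> m (w * w)" for w
    unfolding J_def
  proof (rule M.mean_le[OF bJ])
    fix h
    have "(m (tr h u * w))\<^sup>2 \<le> m (w * w)" by (rule m.m_CS_1) (simp add: u)
    then show "(m (w * tr h u))\<^sup>2 \<le> m (w * w)" by (simp add: mult.commute)
  qed
  have J_scale: "J (a *\<^sub>R w) = a\<^sup>2 * J w" for a w
    unfolding J_def by (simp add: bfun_scaleR_mult m.m_scale power_mult_distrib M.mean_cmult bJ)
  have J_add: "J (v + w) \<le> 2 * J v + 2 * J w" for v w
  proof -
    have "J (v + w) \<le> M (Bfun (\<lambda>h. 2 * (m (v * tr h u))\<^sup>2 + 2 * (m (w * tr h u))\<^sup>2))"
      unfolding J_def
    proof (intro M.mean_mono bnd_intros m.bnd_m)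
      fix h
      have "(m (v * tr h u) + m (w * tr h u))\<^sup>2 \<le> 2 * (m (v * tr h u))\<^sup>2 + 2 * (m (w * tr h u))\<^sup>2"
        using sum_squares_bound[of "m (v * tr h u)" "m (w * tr h u)"] by (simp add: power2_sum)
      then show "(m ((v + w) * tr h u))\<^sup>2 \<le> 2 * (m (v * tr h u))\<^sup>2 + 2 * (m (w * tr h u))\<^sup>2"
        by (simp add: distrib_right m.m_add)
    qed
    also have "\<dots> = 2 * J v + 2 * J w"
      unfolding J_def by (simp add: M.mean_add M.mean_cmult bJ bnd_intros)
    finally show ?thesis .
  qed
  define orth where "orth n w \<longleftrightarrow> (\<forall>i<n. \<forall>j<n. m (w i * w j) = (if i = j then 1 else 0))"
    for n :: nat and w :: "nat \<Rightarrow> 'a bfun"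
  \<comment> \<open>The conclusions share the premise \<open>j < n\<close>, which makes the system
    nonempty; the case \<open>n = 0\<close> is treated apart where the second and third are
    used.\<close>
  have proj: "m ((v - y) * w j) = 0" "m (y * y) = (\<Sum>i<n. (\<alpha> i)\<^sup>2)" "m ((v - y) * (v - y)) = m (v * v) - m (y * y)"
    if w: "orth n w" and \<alpha>: "\<And>i. i < n \<Longrightarrow> m (v * w i) = \<alpha> i" and y: "y = (\<Sum>i<n. \<alpha> i *\<^sub>R w i)" and j: "j < n" for n w v \<alpha> y j
  proof -
    have yw: "m (y * w i) = \<alpha> i" if "i < n" for i
    proof -
      have "m (y * w i) = (\<Sum>k<n. \<alpha> k * m (w k * w i))"
        by (simp add: y sum_distrib_right m.m_sum bfun_scaleR_mult m.m_scale)
      also have "\<dots> = (\<Sum>k<n. if k = i then \<alpha> i else 0)"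
        using w that by (intro sum.cong) (auto simp: orth_def)
      finally show ?thesis using that by simp
    qed
    then show "m ((v - y) * w j) = 0"
      using \<alpha> j by (simp add: left_diff_distrib m.m_diff)
    have yz: "m (z * y) = (\<Sum>i<n. \<alpha> i * m (z * w i))" for z
      by (simp add: y sum_distrib_left m.m_sum bfun_scaleR_mult m.m_scale)
    show yy: "m (y * y) = (\<Sum>i<n. (\<alpha> i)\<^sup>2)"
      using yw by (simp add: yz power2_eq_square)
    have "m (v * y) = (\<Sum>i<n. (\<alpha> i)\<^sup>2)"
      using \<alpha> by (simp add: yz power2_eq_square)
    then show "m ((v - y) * (v - y)) = m (v * v) - m (y * y)"
      using yy m.m_expand[of v "-1" y] by simp
  qed
  have trace: "(\<Sum>i<n. J (w i)) \<le> 1" if w: "orth n w" for n w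
  proof (cases "n = 0")
    case False
    have "(\<Sum>i<n. J (w i)) = M (Bfun (\<lambda>h. \<Sum>i<n. (m (w i * tr h u))\<^sup>2))"
      unfolding J_def by (rule M.mean_sum[symmetric]) (auto intro: bJ)
    also have "\<dots> \<le> 1"
    proof (rule M.mean_le[OF bnd_sum[OF bJ]])
      fix h
      define y where "y = (\<Sum>i<n. m (tr h u * w i) *\<^sub>R w i)"
      have "m (tr h u * tr h u) - m (y * y) \<ge> 0" "m (y * y) = (\<Sum>i<n. (m (tr h u * w i))\<^sup>2)"
        using proj(2,3)[OF w refl y_def, of 0] False m.m_self_nonneg[of "tr h u - y"] by auto
      moreover have "m (tr h u * tr h u) \<le> 1" by (rule m.m_self_le_1) (simp add: u)
      ultimately show "(\<Sum>i<n. (m (w i * tr h u))\<^sup>2) \<le> 1" by (simp add: mult.commute)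
    qed
    finally show ?thesis .
  qed simp
  \<comment> \<open>The final estimate is \<open>2 * (4 * \<delta>) + 2 * \<delta>\<close>.\<close>
  define \<delta> where "\<delta> = \<epsilon> / 10"
  have \<delta>: "\<delta> > 0" using \<open>\<epsilon> > 0\<close> by (simp add: \<delta>_def)
  define A where "A = {\<Sum>i<n. J (w i) | n w. orth n w}"
  have "bdd_above A" unfolding A_def bdd_above_def using trace by blast
  moreover have "A \<noteq> {}" unfolding A_def by (auto simp: orth_def intro!: exI[of _ 0])
  ultimately obtain n w where w: "orth n w" and near: "Sup A - \<delta> < (\<Sum>i<n. J (w i))"
    using \<delta> less_cSup_iff[of A "Sup A - \<delta>"] by (auto simp: A_def)
  \<comment> \<open>Normalised, \<open>v\<close> would extend the orthonormal system and raise the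
    trace by \<open>J v / m (v * v)\<close>, but the trace is already within \<open>\<delta>\<close>
    of its supremum.\<close>
  have comp: "J v \<le> \<delta> * m (v * v)" if v: "\<And>i. i < n \<Longrightarrow> m (v * w i) = 0" for v
  proof (cases "m (v * v) = 0")
    case True
    then show ?thesis using J_le[of v] by simp
  next
    case False
    then have pos: "m (v * v) > 0" using m.m_self_nonneg[of v] by simp
    define a where "a = 1 / sqrt (m (v * v))"
    have a2: "a\<^sup>2 * m (v * v) = 1" using pos by (simp add: a_def power_divide)
    define w' where "w' = w(n := a *\<^sub>R v)"
    have w'1: "w' i = w i" if "i < n" for i using that by (simp add: w'_def)
    have w'2: "w' n = a *\<^sub>R v" by (simp add: w'_def)
    have "m (w' n * w' n) = 1"
      unfolding w'2 using a2 by (simp add: bfun_scaleR_mult m.m_scale power2_eq_square)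
    moreover have "m (w' n * w' i) = 0" "m (w' i * w' n) = 0" if "i < n" for i
      unfolding w'2 w'1[OF that] using v[OF that] by (simp_all add: bfun_scaleR_mult m.m_scale mult.commute)
    ultimately have "orth (Suc n) w'"
      using w w'1 unfolding orth_def by (auto simp: less_Suc_eq)
    then have "(\<Sum>i<Suc n. J (w' i)) \<le> Sup A"
      by (intro cSup_upper[OF _ \<open>bdd_above A\<close>]) (unfold A_def, blast)
    then have "(\<Sum>i<n. J (w i)) + a\<^sup>2 * J v \<le> Sup A"
      using w'1 w'2 by (simp add: J_scale)
    then have "a\<^sup>2 * J v \<le> \<delta>" using near by linarith
    then have "m (v * v) * (a\<^sup>2 * J v) \<le> m (v * v) * \<delta>" using pos by simp
    moreover have "m (v * v) * (a\<^sup>2 * J v) = (a\<^sup>2 * m (v * v)) * J v" by (simp only: ac_simps)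
    ultimately have "J v \<le> m (v * v) * \<delta>" by (simp only: a2 mult_1)
    then show ?thesis by (simp only: mult.commute)
  qed
  \<comment> \<open>Translates are classified by their coordinates rounded to a grid of width
    \<open>1 / N\<close>. Then \<open>n / \<delta> \<le> N \<le> N^2\<close> makes the squared error
    at most \<open>\<delta> / n\<close> in each of the \<open>n\<close> coordinates.\<close>
  obtain N :: nat where N: "real N > real n / \<delta> + 1" using reals_Archimedean2 by blast
  have N1: "real N \<ge> 1" using N \<delta> by (smt (verit) divide_nonneg_pos of_nat_0_le_iff)
  define \<kappa> where "\<kappa> s = (\<lambda>i\<in>{..<n}. \<lfloor>m (tr s u * w i) * real N\<rfloor>)" for s
  have "finite (range \<kappa>)"
  proof (rule finite_subset)
    show "range \<kappa> \<subseteq> ({..<n} \<rightarrow>\<^sub>E {- int N - 1..int N + 1})"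
    proof (clarsimp simp: \<kappa>_def)
      fix s i assume i: "i < n"
      have "(m (tr s u * w i))\<^sup>2 \<le> m (w i * w i)" by (rule m.m_CS_1) (simp add: u)
      then have "\<bar>m (tr s u * w i)\<bar> \<le> 1" using w i by (simp add: orth_def abs_square_le_1)
      then have "\<bar>m (tr s u * w i) * real N\<bar> \<le> real N"
        using N1 by (simp add: abs_mult mult_left_le_one_le)
      then show "- int N - 1 \<le> \<lfloor>m (tr s u * w i) * real N\<rfloor> \<and> \<lfloor>m (tr s u * w i) * real N\<rfloor> \<le> int N + 1"
        by linarith
    qed
  qed (auto intro: finite_PiE)
  then obtain T where T: "finite T" "\<And>s. \<exists>t\<in>T. \<kappa> t = \<kappa> s"
    using finite_range_representatives by blast
  have "J (tr s u - tr t u) \<le> \<epsilon>" if \<kappa>: "\<kappa> t = \<kappa> s" for s t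
  proof -
    define v where "v = tr s u - tr t u"
    define \<alpha> where "\<alpha> i = m (v * w i)" for i
    define y where "y = (\<Sum>i<n. \<alpha> i *\<^sub>R w i)"
    have \<alpha>_le: "(\<alpha> i)\<^sup>2 \<le> \<delta> / real n" if i: "i < n" for i
    proof -
      have "\<lfloor>m (tr s u * w i) * real N\<rfloor> = \<lfloor>m (tr t u * w i) * real N\<rfloor>"
        using fun_cong[OF \<kappa>, of i] i by (simp add: \<kappa>_def)
      then have "\<bar>m (tr s u * w i) * real N - m (tr t u * w i) * real N\<bar> \<le> 1" by linarith
      moreover have "m (tr s u * w i) * real N - m (tr t u * w i) * real N = \<alpha> i * real N"
        by (simp add: \<alpha>_def v_def left_diff_distrib m.m_diff)
      ultimately have "\<bar>\<alpha> i * real N\<bar> \<le> 1" by simp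
      then have "(\<alpha> i * real N)\<^sup>2 \<le> 1" by (simp add: abs_square_le_1)
      then have 1: "(\<alpha> i)\<^sup>2 * (real N)\<^sup>2 \<le> 1" by (simp add: power_mult_distrib)
      have "real n / \<delta> \<le> real N * real N"
        using N N1 mult_mono[of 1 "real N" "real N" "real N"] by linarith
      then have "(\<alpha> i)\<^sup>2 * (real n / \<delta>) \<le> 1"
        using 1 mult_left_mono[of "real n / \<delta>" "real N * real N" "(\<alpha> i)\<^sup>2"] by (simp add: power2_eq_square)
      then show ?thesis using i \<delta> by (simp add: field_simps)
    qed
    have "J v \<le> 2 * J (v - y) + 2 * J y" using J_add[of "v - y" y] by simp
    moreover have "J y \<le> \<delta>"
    proof (cases "n = 0")
      case True
      then have "J y = 0" unfolding y_def J_def by (simp add: M.mean_const)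
      then show ?thesis using \<delta> by simp
    next
      case False
      have "J y \<le> m (y * y)" by (rule J_le)
      also have "\<dots> = (\<Sum>i<n. (\<alpha> i)\<^sup>2)"
        by (rule proj(2)[OF w, of v \<alpha> y 0]) (use False in \<open>auto simp: \<alpha>_def y_def\<close>)
      also have "\<dots> \<le> real (card {..<n}) * (\<delta> / real n)" using \<alpha>_le by (intro sum_bounded_above) auto
      finally show ?thesis using False by simp
    qed
    moreover have "J (v - y) \<le> 4 * \<delta>"
    proof -
      have "J (v - y) \<le> \<delta> * m ((v - y) * (v - y))"
        by (rule comp, rule proj(1)[OF w, of v \<alpha> y]) (auto simp: \<alpha>_def y_def)
      also have "m ((v - y) * (v - y)) \<le> m (v * v)"
      proof (cases "n = 0")
        case False
        then show ?thesis
          using proj(3)[OF w, of v \<alpha> y 0] m.m_self_nonneg[of y] by (auto simp: \<alpha>_def y_def)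
      qed (simp add: y_def)
      also have "m (v * v) \<le> 4"
      proof (rule m.m_le)
        fix x
        have "\<bar>ap v x\<bar> \<le> 2" using u[of "x + s"] u[of "x + t"] by (simp add: v_def)
        then have "\<bar>ap v x\<bar> * \<bar>ap v x\<bar> \<le> 2 * 2" by (intro mult_mono) auto
        then show "ap (v * v) x \<le> 4" by simp
      qed
      finally show ?thesis using \<delta> by (simp add: mult.commute)
    qed
    ultimately show ?thesis unfolding v_def by (simp add: \<delta>_def)
  qed
  then have "\<exists>t\<in>T. J (tr s u - tr t u) \<le> \<epsilon>" for s using T(2)[of s] by blast
  then show ?thesis
    using T(1) by (intro exI[of _ T]) (simp add: J_def left_diff_distrib m.m_diff)
qed

text \<open>Compactness in mean square becomes uniform: by Cauchy-Schwarz the sup distance of two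
  translates of this convolution is at most the mean-square distance of the same translates of
  \<open>c\<close>. Since \<open>ap c (h + s) = m (tr (- s) u * tr h u)\<close>, the correlation
  orbit of \<open>u\<close> provides the net, with signs reversed.\<close>

lemma almost_periodic_autocorr_conv:
  fixes m M :: "'g::ab_group_add bfun \<Rightarrow> real"
  assumes m: "inv_mean m" and M: "inv_mean M" and u: "\<And>x. \<bar>ap u x\<bar> \<le> 1"
  defines "c \<equiv> autocorr m u"
  shows "almost_periodic (Bfun (\<lambda>t. M (c * tr t c)))"
  unfolding almost_periodic_def
proof (intro allI impI)
  fix \<epsilon> :: real assume \<epsilon>: "\<epsilon> > 0"
  interpret m: inv_mean m by fact
  interpret M: inv_mean M by fact
  have c1: "\<bar>ap c t\<bar> \<le> 1" for t
    unfolding c_def m.ap_autocorr by (rule m.m_abs_le) (simp add: abs_mult_le_1 u)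
  have bq: "bnd (\<lambda>t. M (c * tr t c))" by (intro M.bnd_m bnd_intros)
  obtain T where T: "finite T"
    "\<And>s. \<exists>t\<in>T. M (Bfun (\<lambda>h. (m (tr s u * tr h u) - m (tr t u * tr h u))\<^sup>2)) \<le> \<epsilon>\<^sup>2"
    using correlation_orbit_totally_bounded[OF m M u zero_less_power[OF \<epsilon>, of 2]] by blast
  have "\<exists>t\<in>uminus ` T. \<forall>x. \<bar>M (c * tr (x + s) c) - M (c * tr (x + t) c)\<bar> \<le> \<epsilon>" for s
  proof -
    obtain t where t: "t \<in> T" "M (Bfun (\<lambda>h. (m (tr (- s) u * tr h u) - m (tr t u * tr h u))\<^sup>2)) \<le> \<epsilon>\<^sup>2"
      using T(2)[of "- s"] by blast
    define d where "d = tr s c - tr (- t) c"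
    have d: "Bfun (\<lambda>h. (m (tr (- s) u * tr h u) - m (tr t u * tr h u))\<^sup>2) = d * d"
    proof (rule bfun_eqI)
      fix h
      have "bnd (\<lambda>h. (m (tr (- s) u * tr h u) - m (tr t u * tr h u))\<^sup>2)"
        by (intro bnd_intros m.bnd_m)
      then show "ap (Bfun (\<lambda>h. (m (tr (- s) u * tr h u) - m (tr t u * tr h u))\<^sup>2)) h = ap (d * d) h"
        by (simp add: d_def m.m_tr_tr c_def[symmetric] power2_eq_square)
    qed
    have "\<bar>M (c * tr (x + s) c) - M (c * tr (x + - t) c)\<bar> \<le> \<epsilon>" for x
    proof -
      have "M (c * tr (x + s) c) - M (c * tr (x + - t) c) = M (c * tr x d)"
        by (simp add: d_def tr_simps right_diff_distrib M.m_diff)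
      also have "\<bar>\<dots>\<bar> \<le> \<epsilon>"
      proof -
        have "(M (c * tr x d))\<^sup>2 \<le> M (tr x d * tr x d)" by (rule M.m_CS_1) (rule c1)
        also have "\<dots> = M (d * d)" by (simp add: tr_simps(3)[symmetric])
        also have "\<dots> \<le> \<epsilon>\<^sup>2" using t(2) unfolding d .
        finally show ?thesis using \<epsilon> by (simp add: abs_le_square_iff[symmetric])
      qed
      finally show ?thesis .
    qed
    then show ?thesis using t(1) by blast
  qed
  then show "\<exists>S. finite S \<and> (\<forall>s. \<exists>t\<in>S. \<forall>x.
      \<bar>ap (Bfun (\<lambda>t. M (c * tr t c))) (x + s) - ap (Bfun (\<lambda>t. M (c * tr t c))) (x + t)\<bar> \<le> \<epsilon>)"
    using T(1) bq by (intro exI[of _ "uminus ` T"]) simp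
qed

text \<open>No perturbation \<open>w + s *\<^sub>R v\<close> of a near minimiser of
  \<open>m (w * w) - 2 * \<Lambda> w\<close> lowers this functional by more than
  \<open>\<epsilon>\<close>; the discriminant turns that into the bound. Boundedness of
  \<open>\<Lambda>\<close> makes the infimum finite.\<close>

lemma (in inv_mean) approximate_riesz:
  assumes add: "\<And>v w. \<Lambda> (v + w) = \<Lambda> v + \<Lambda> w" and scale: "\<And>a v. \<Lambda> (a *\<^sub>R v) = a * \<Lambda> v"
    and bound: "\<And>v. (\<Lambda> v)\<^sup>2 \<le> m (v * v)" and "\<epsilon> > 0"
  shows "\<exists>w. \<forall>v. (m (w * v) - \<Lambda> v)\<^sup>2 \<le> \<epsilon> * m (v * v)"
proof -
  define Q where "Q w = m (w * w) - 2 * \<Lambda> w" for w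
  have Q1: "Q w \<ge> - 1" for w
  proof -
    have "0 \<le> (\<Lambda> w - 1)\<^sup>2" by simp
    then have "2 * \<Lambda> w \<le> (\<Lambda> w)\<^sup>2 + 1" by (simp add: power2_diff)
    then show ?thesis using bound[of w] by (simp add: Q_def)
  qed
  then have bdd: "bdd_below (range Q)" by (auto simp: bdd_below_def)
  have "Inf (range Q) < Inf (range Q) + \<epsilon>" using \<open>\<epsilon> > 0\<close> by simp
  then obtain w where w: "Q w < Inf (range Q) + \<epsilon>"
    using cInf_lessD[of "range Q"] by blast
  have "(m (w * v) - \<Lambda> v)\<^sup>2 \<le> m (v * v) * \<epsilon>" for v
  proof (rule quadratic_nonneg_discriminant)
    fix s :: real
    have "Inf (range Q) \<le> Q (w + s *\<^sub>R v)" using bdd by (simp add: cInf_lower)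
    then have "Q w - \<epsilon> \<le> Q (w + s *\<^sub>R v)" using w by linarith
    then show "0 \<le> m (v * v) * s\<^sup>2 + 2 * (m (w * v) - \<Lambda> v) * s + \<epsilon>"
      unfolding Q_def m_expand add scale by (simp add: algebra_simps)
  qed (rule m_self_nonneg)
  then show ?thesis unfolding mult.commute[of \<epsilon>] by blast
qed

text \<open>Formally, let \<open>w\<close> be the average of \<open>ap c h *\<^sub>R tr h u\<close>
  over \<open>h\<close>, and \<open>q\<close> the convolution on the right. Then
  \<open>m (w * tr t u) = ap q t\<close>, so \<open>M (c * c) = ap q 0 = m (w * u)\<close> is at
  most the norm of \<open>w\<close>, whose square is \<open>\<Lambda> w = M (c * q)\<close>. As
  \<open>w\<close> exists only approximately, errors of order \<open>\<epsilon>\<close> are carried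
  along.\<close>

lemma autocorr_cubic_bound:
  fixes m M :: "'g::ab_group_add bfun \<Rightarrow> real"
  assumes m: "inv_mean m" and M: "inv_mean M" and u: "\<And>x. \<bar>ap u x\<bar> \<le> 1"
  defines "c \<equiv> autocorr m u"
  shows "(M (c * c))\<^sup>2 \<le> M (c * Bfun (\<lambda>t. M (c * tr t c)))"
proof -
  interpret m: inv_mean m by fact
  interpret M: inv_mean M by fact
  define q where "q = Bfun (\<lambda>t. M (c * tr t c))"
  have bq: "bnd (\<lambda>t. M (c * tr t c))" by (intro M.bnd_m bnd_intros)
  have q: "ap q t = M (c * tr t c)" for t unfolding q_def using bq by simp
  have c1: "\<bar>ap c t\<bar> \<le> 1" for t
    unfolding c_def m.ap_autocorr by (rule m.m_abs_le) (simp add: abs_mult_le_1 u)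
  have bcm: "bnd (\<lambda>h. ap c h * m (v * tr h u))" for v by (intro bnd_intros m.bnd_m)
  define \<Lambda> where "\<Lambda> v = M (Bfun (\<lambda>h. ap c h * m (v * tr h u)))" for v
  have \<Lambda>add: "\<Lambda> (v + w) = \<Lambda> v + \<Lambda> w" for v w
    unfolding \<Lambda>_def by (subst M.mean_add[symmetric, OF bcm bcm]) (simp add: distrib_right m.m_add distrib_left)
  have \<Lambda>scale: "\<Lambda> (a *\<^sub>R v) = a * \<Lambda> v" for a v
    unfolding \<Lambda>_def by (subst M.mean_cmult[symmetric, OF bcm]) (simp add: bfun_scaleR_mult m.m_scale ac_simps)
  have \<Lambda>bound: "(\<Lambda> v)\<^sup>2 \<le> m (v * v)" for v
  proof -
    have "(\<Lambda> v)\<^sup>2 \<le> M (Bfun (\<lambda>h. (ap c h * m (v * tr h u))\<^sup>2))"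
      unfolding \<Lambda>_def by (rule M.mean_square[OF bcm])
    also have "\<dots> \<le> m (v * v)"
    proof (rule M.mean_le[OF bnd_power[OF bcm]])
      fix h
      have "(m (tr h u * v))\<^sup>2 \<le> m (v * v)" by (rule m.m_CS_1) (simp add: u)
      moreover have "(ap c h)\<^sup>2 \<le> 1" using c1[of h] by (simp add: abs_square_le_1)
      ultimately have "(ap c h)\<^sup>2 * (m (tr h u * v))\<^sup>2 \<le> 1 * m (v * v)" by (intro mult_mono) auto
      then show "(ap c h * m (v * tr h u))\<^sup>2 \<le> m (v * v)" by (simp add: power_mult_distrib mult.commute)
    qed
    finally show ?thesis .
  qed
  have \<Lambda>tr: "\<Lambda> (tr t u) = ap q t" for t
  proof -
    have 1: "Bfun (\<lambda>h. ap c h * m (tr t u * tr h u)) = c * tr (- t) c"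
      by (rule bfun_eqI) (simp add: m.m_tr_tr c_def[symmetric] bnd_intros)
    have "M (c * tr (- t) c) = M (tr t (c * tr (- t) c))" by simp
    also have "tr t (c * tr (- t) c) = c * tr t c" by (simp add: tr_simps mult.commute)
    finally show ?thesis unfolding \<Lambda>_def q 1 .
  qed
  have q0: "ap q 0 = M (c * c)" by (simp add: q tr_simps)
  have nonneg: "M (c * c) \<ge> 0" by (rule M.m_self_nonneg)
  have "(M (c * c))\<^sup>2 \<le> M (c * q) + e" if "e > 0" for e
  proof -
    \<comment> \<open>With \<open>\<omega> \<le> 2\<close>, squaring
      \<open>\<omega> + \<epsilon>\<close> loses at most \<open>5 * \<epsilon>\<close>, and
      comparing \<open>\<omega>\<^sup>2\<close> with \<open>M (c * q)\<close> loses at most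
      \<open>3 * \<epsilon>\<close>.\<close>
    define \<epsilon> where "\<epsilon> = min 1 (e / 8)"
    have \<epsilon>: "\<epsilon> > 0" "\<epsilon> \<le> 1" "8 * \<epsilon> \<le> e" using that by (auto simp: \<epsilon>_def min_def)
    obtain w where w: "\<And>v. (m (w * v) - \<Lambda> v)\<^sup>2 \<le> \<epsilon>\<^sup>2 * m (v * v)"
      using m.approximate_riesz[of \<Lambda> "\<epsilon>\<^sup>2", OF \<Lambda>add \<Lambda>scale \<Lambda>bound] \<epsilon> by auto
    define \<omega> where "\<omega> = sqrt (m (w * w))"
    have \<omega>: "\<omega> \<ge> 0" "\<omega>\<^sup>2 = m (w * w)" using m.m_self_nonneg[of w] by (auto simp: \<omega>_def)
    have wu: "\<bar>m (w * tr t u) - ap q t\<bar> \<le> \<epsilon>" for t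
    proof -
      have "m (tr t u * tr t u) \<le> 1" by (rule m.m_self_le_1) (simp add: u)
      then have "\<epsilon>\<^sup>2 * m (tr t u * tr t u) \<le> \<epsilon>\<^sup>2" by (simp add: mult_left_le)
      then have "(m (w * tr t u) - ap q t)\<^sup>2 \<le> \<epsilon>\<^sup>2" using w[of "tr t u"] \<Lambda>tr[of t] by simp
      then show ?thesis using \<epsilon> by (simp add: abs_le_square_iff[symmetric])
    qed
    have "(\<omega>\<^sup>2 - \<Lambda> w)\<^sup>2 \<le> (\<epsilon> * \<omega>)\<^sup>2" using w[of w] \<omega> by (simp add: power_mult_distrib)
    then have 1: "\<bar>\<omega>\<^sup>2 - \<Lambda> w\<bar> \<le> \<epsilon> * \<omega>" using \<epsilon> \<omega> by (simp add: abs_le_square_iff[symmetric] abs_mult)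
    have "(\<Lambda> w)\<^sup>2 \<le> \<omega>\<^sup>2" using \<Lambda>bound \<omega> by simp
    then have "\<Lambda> w \<le> \<omega>" using \<omega> by (meson power2_le_imp_le)
    then have "\<omega> * \<omega> \<le> 2 * \<omega>" using 1 \<epsilon> mult_right_mono[of \<epsilon> 1 \<omega>] \<omega>(1) by (simp add: power2_eq_square)
    then have \<omega>2: "\<omega> \<le> 2" using \<omega>(1) by (metis mult_le_cancel_right not_le order_trans zero_le_numeral)
    have "(m (u * w))\<^sup>2 \<le> \<omega>\<^sup>2" unfolding \<omega> by (rule m.m_CS_1[OF u])
    then have "m (u * w) \<le> \<omega>" using \<omega> by (meson power2_le_imp_le)
    then have \<kappa>: "M (c * c) \<le> \<omega> + \<epsilon>" using wu[of 0] q0 by (simp add: tr_simps mult.commute)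
    have "\<Lambda> w - \<epsilon> \<le> M (c * q)"
    proof -
      have "\<Lambda> w - \<epsilon> = M (Bfun (\<lambda>t. ap c t * m (w * tr t u) - \<epsilon>))"
        unfolding \<Lambda>_def by (simp add: M.mean_diff M.mean_const bcm bnd_const)
      also have "\<dots> \<le> M (c * q)"
      proof (rule M.m_mono)
        fix t
        have "\<bar>ap c t\<bar> * \<bar>m (w * tr t u) - ap q t\<bar> \<le> 1 * \<epsilon>" using c1 wu by (intro mult_mono) auto
        then have "ap c t * (m (w * tr t u) - ap q t) \<le> \<epsilon>" by (simp add: abs_mult[symmetric])
        then show "ap (Bfun (\<lambda>t. ap c t * m (w * tr t u) - \<epsilon>)) t \<le> ap (c * q) t"
          by (simp add: bnd_diff bcm bnd_const algebra_simps)
      qed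
      finally show ?thesis .
    qed
    then have "\<omega>\<^sup>2 \<le> M (c * q) + \<epsilon> + \<epsilon> * \<omega>" using 1 by linarith
    moreover have "(M (c * c))\<^sup>2 \<le> (\<omega> + \<epsilon>)\<^sup>2" using \<kappa> nonneg by (intro power_mono) auto
    moreover have "(\<omega> + \<epsilon>)\<^sup>2 = \<omega>\<^sup>2 + 2 * (\<epsilon> * \<omega>) + \<epsilon> * \<epsilon>" by (simp add: power2_eq_square algebra_simps)
    moreover have "\<epsilon> * \<omega> \<le> \<epsilon> * 2" "\<epsilon> * \<epsilon> \<le> \<epsilon> * 1" using \<epsilon> \<omega>2 by (auto intro!: mult_left_mono)
    ultimately show ?thesis using \<epsilon> by linarith
  qed
  then show ?thesis unfolding q_def[symmetric] by (rule field_le_epsilon)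
qed

text \<open>On a set of \<open>x\<close> on which \<open>tr (- x) r\<close> hardly depends on \<open>x\<close>, \<open>r t\<close> may be replaced by a translate of \<open>r\<close>
  evaluated at \<open>x + t\<close>, so that ergodicity decouples \<open>x\<close> from \<open>x + t\<close>.\<close>

lemma ergodic_autocorr_product:
  fixes m M :: "'g::ab_group_add bfun \<Rightarrow> real"
  assumes m: "ergodic_mean m" and M: "inv_mean M" and u: "\<And>x. \<bar>ap u x\<bar> \<le> 1" and r: "almost_periodic r"
  shows "M (autocorr m u * r) = m (u * Bfun (\<lambda>x. m (u * tr (- x) r)))"
proof -
  interpret m: inv_mean m using m by (simp add: ergodic_mean_def)
  interpret M: inv_mean M by fact
  define c where "c = autocorr m u"
  define v where "v = Bfun (\<lambda>x. m (u * tr (- x) r))"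
  have "bnd (\<lambda>x. m (u * tr (- x) r))" by (intro m.bnd_m bnd_intros)
  then have v: "ap v x = m (u * tr (- x) r)" for x by (simp add: v_def)
  have "\<bar>M (c * r) - m (u * v)\<bar> \<le> e" if "e > 0" for e
  proof -
    define \<epsilon> where "\<epsilon> = e / 2"
    have "\<epsilon> > 0" using that by (simp add: \<epsilon>_def)
    then obtain S where S: "finite S" "\<And>s. \<exists>t\<in>S. \<forall>x. \<bar>ap r (x + s) - ap r (x + t)\<bar> \<le> \<epsilon>"
      using r unfolding almost_periodic_def by blast
    have "\<forall>x. \<exists>t. t \<in> S \<and> (\<forall>y. \<bar>ap r (y + - x) - ap r (y + t)\<bar> \<le> \<epsilon>)" using S(2) by blast
    then obtain \<sigma> where \<sigma>: "\<And>x. \<sigma> x \<in> S" "\<And>x y. \<bar>ap r (y + - x) - ap r (y + \<sigma> x)\<bar> \<le> \<epsilon>"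
      by (metis (no_types))
    \<comment> \<open>The level sets of \<open>\<sigma>\<close> cut the group into finitely many
      pieces. Their indicators go into the first factor, where \<open>ergodic_mean_product\<close>
      accepts any bounded function.\<close>
    define \<xi> where "\<xi> s = ind {x. \<sigma> x = s}" for s
    have sum\<xi>: "(\<Sum>s\<in>S. ap (\<xi> s) x * F s) = F (\<sigma> x)" for x and F :: "'g \<Rightarrow> real"
    proof -
      have "(\<Sum>s\<in>S. ap (\<xi> s) x * F s) = (\<Sum>s\<in>S. if \<sigma> x = s then F s else 0)"
        by (intro sum.cong) (auto simp: \<xi>_def indicator_def)
      then show ?thesis using S(1) \<sigma>(1) by (simp add: sum.delta')
    qed
    have bb: "bnd (\<lambda>t. m ((\<xi> s * u) * tr t (u * tr s r)))" for s by (intro m.bnd_m bnd_intros)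
    have 1: "\<bar>ap (c * r) t - (\<Sum>s\<in>S. m ((\<xi> s * u) * tr t (u * tr s r)))\<bar> \<le> \<epsilon>" for t
    proof -
      have "ap (c * r) t - (\<Sum>s\<in>S. m ((\<xi> s * u) * tr t (u * tr s r)))
          = m (ap r t *\<^sub>R (u * tr t u) - (\<Sum>s\<in>S. (\<xi> s * u) * tr t (u * tr s r)))"
        by (simp add: m.m_diff m.m_scale m.m_sum c_def m.ap_autocorr mult.commute)
      also have "\<bar>\<dots>\<bar> \<le> \<epsilon>"
      proof (rule m.m_abs_le)
        fix x
        have "(\<Sum>s\<in>S. ap ((\<xi> s * u) * tr t (u * tr s r)) x)
            = (\<Sum>s\<in>S. ap (\<xi> s) x * (ap u x * ap u (x + t) * ap r (x + t + s)))"
          by (simp add: ac_simps)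
        also have "\<dots> = ap u x * ap u (x + t) * ap r (x + t + \<sigma> x)" by (rule sum\<xi>)
        finally have "ap (ap r t *\<^sub>R (u * tr t u) - (\<Sum>s\<in>S. (\<xi> s * u) * tr t (u * tr s r))) x
            = (ap u x * ap u (x + t)) * (ap r (x + t + - x) - ap r (x + t + \<sigma> x))"
          by (simp add: ap_sum algebra_simps)
        moreover have "\<bar>(ap u x * ap u (x + t)) * (ap r (x + t + - x) - ap r (x + t + \<sigma> x))\<bar> \<le> 1 * \<epsilon>"
          unfolding abs_mult[of "ap u x * ap u (x + t)"]
          by (intro mult_mono \<sigma>(2) abs_mult_le_1 u) auto
        ultimately show "\<bar>ap (ap r t *\<^sub>R (u * tr t u) - (\<Sum>s\<in>S. (\<xi> s * u) * tr t (u * tr s r))) x\<bar> \<le> \<epsilon>"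
          by simp
      qed
      finally show ?thesis .
    qed
    have bs: "bnd (\<lambda>t. \<Sum>s\<in>S. m ((\<xi> s * u) * tr t (u * tr s r)))" by (intro bnd_sum bb)
    have "\<bar>M (c * r - Bfun (\<lambda>t. \<Sum>s\<in>S. m ((\<xi> s * u) * tr t (u * tr s r))))\<bar> \<le> \<epsilon>"
      by (rule M.m_abs_le) (use 1 bs in simp)
    moreover have "M (Bfun (\<lambda>t. \<Sum>s\<in>S. m ((\<xi> s * u) * tr t (u * tr s r)))) = (\<Sum>s\<in>S. m (\<xi> s * u) * m (u * tr s r))"
      using M.mean_sum[OF S(1) bb] ergodic_mean_product[OF m M] by simp
    ultimately have A: "\<bar>M (c * r) - (\<Sum>s\<in>S. m (\<xi> s * u) * m (u * tr s r))\<bar> \<le> \<epsilon>"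
      by (simp add: M.m_diff)
    have "m (u * v) - (\<Sum>s\<in>S. m (\<xi> s * u) * m (u * tr s r)) = m (u * v - (\<Sum>s\<in>S. m (u * tr s r) *\<^sub>R (\<xi> s * u)))"
      by (simp add: m.m_diff m.m_sum m.m_scale mult.commute)
    also have "\<bar>\<dots>\<bar> \<le> \<epsilon>"
    proof (rule m.m_abs_le)
      fix x
      have "(\<Sum>s\<in>S. ap (m (u * tr s r) *\<^sub>R (\<xi> s * u)) x) = (\<Sum>s\<in>S. ap (\<xi> s) x * (m (u * tr s r) * ap u x))"
        by (simp add: ac_simps)
      also have "\<dots> = m (u * tr (\<sigma> x) r) * ap u x" by (rule sum\<xi>)
      finally have "ap (u * v - (\<Sum>s\<in>S. m (u * tr s r) *\<^sub>R (\<xi> s * u))) x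
          = ap u x * m (u * (tr (- x) r - tr (\<sigma> x) r))"
        by (simp add: ap_sum v right_diff_distrib m.m_diff mult.commute)
      moreover have "\<bar>m (u * (tr (- x) r - tr (\<sigma> x) r))\<bar> \<le> \<epsilon>"
      proof (rule m.m_abs_le)
        fix y
        have "\<bar>ap u y\<bar> * \<bar>ap r (y + - x) - ap r (y + \<sigma> x)\<bar> \<le> 1 * \<epsilon>"
          by (intro mult_mono \<sigma>(2) u) auto
        then show "\<bar>ap (u * (tr (- x) r - tr (\<sigma> x) r)) y\<bar> \<le> \<epsilon>" by (simp add: abs_mult)
      qed
      then have "\<bar>ap u x\<bar> * \<bar>m (u * (tr (- x) r - tr (\<sigma> x) r))\<bar> \<le> 1 * \<epsilon>"
        by (intro mult_mono u) auto
      ultimately show "\<bar>ap (u * v - (\<Sum>s\<in>S. m (u * tr s r) *\<^sub>R (\<xi> s * u))) x\<bar> \<le> \<epsilon>"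
        by (simp add: abs_mult)
    qed
    finally show ?thesis using A unfolding \<epsilon>_def by linarith
  qed
  then have "\<bar>M (c * r) - m (u * v)\<bar> \<le> 0" by (rule field_le_epsilon[of _ 0, simplified])
  then show ?thesis by (simp add: c_def v_def)
qed

text \<open>\<open>v\<close> is a convolution of \<open>u\<close> with the almost periodic
  \<open>q\<close> and inherits almost periodicity from it; the bound is the chain
  \<open>(M (c * c))\<^sup>2 \<le> M (c * q) = m (u * v)\<close>. So near orthogonality to almost
  periodic functions makes the mean-square autocorrelation small.\<close>

lemma uniformity_inverse:
  fixes m M :: "'g::ab_group_add bfun \<Rightarrow> real"
  assumes m: "ergodic_mean m" and M: "inv_mean M" and u: "\<And>x. \<bar>ap u x\<bar> \<le> 1"
  shows "\<exists>v. almost_periodic v \<and> (\<forall>x. \<bar>ap v x\<bar> \<le> 1) \<and> (M (autocorr m u * autocorr m u))\<^sup>2 \<le> m (u * v)"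
proof -
  have m': "inv_mean m" using m by (simp add: ergodic_mean_def)
  interpret m: inv_mean m by (rule m')
  interpret M: inv_mean M by fact
  define c where "c = autocorr m u"
  define q where "q = Bfun (\<lambda>t. M (c * tr t c))"
  have c1: "\<bar>ap c t\<bar> \<le> 1" for t
    unfolding c_def m.ap_autocorr by (rule m.m_abs_le) (simp add: abs_mult_le_1 u)
  have "bnd (\<lambda>t. M (c * tr t c))" by (intro M.bnd_m bnd_intros)
  then have q1: "\<bar>ap q t\<bar> \<le> 1" for t
    unfolding q_def by simp (rule M.m_abs_le, simp add: abs_mult_le_1 c1)
  have qap: "almost_periodic q"
    unfolding q_def c_def by (rule almost_periodic_autocorr_conv[OF m' M u])
  define v where "v = Bfun (\<lambda>x. m (u * tr (- x) q))"
  have "bnd (\<lambda>x. m (u * tr (- x) q))" by (intro m.bnd_m bnd_intros)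
  then have v: "ap v x = m (u * tr (- x) q)" for x by (simp add: v_def)
  have "almost_periodic v"
    unfolding almost_periodic_def
  proof (intro allI impI)
    fix \<epsilon> :: real assume "\<epsilon> > 0"
    then obtain S where S: "finite S" "\<And>s. \<exists>t\<in>S. \<forall>x. \<bar>ap q (x + s) - ap q (x + t)\<bar> \<le> \<epsilon>"
      using qap unfolding almost_periodic_def by blast
    have "\<exists>t\<in>uminus ` S. \<forall>x. \<bar>ap v (x + s) - ap v (x + t)\<bar> \<le> \<epsilon>" for s
    proof -
      obtain t where t: "t \<in> S" "\<And>x. \<bar>ap q (x + - s) - ap q (x + t)\<bar> \<le> \<epsilon>" using S(2) by blast
      have "\<bar>ap v (x + s) - ap v (x + - t)\<bar> \<le> \<epsilon>" for x
      proof -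
        have "ap v (x + s) - ap v (x + - t) = m (u * (tr (- (x + s)) q - tr (- (x + - t)) q))"
          by (simp only: v right_diff_distrib m.m_diff)
        also have "\<bar>\<dots>\<bar> \<le> \<epsilon>"
        proof (rule m.m_abs_le)
          fix y
          have "\<bar>ap u y\<bar> * \<bar>ap q (y - x + - s) - ap q (y - x + t)\<bar> \<le> 1 * \<epsilon>"
            by (intro mult_mono t u) auto
          moreover have "y - x + - s = y + - (x + s)" "y - x + t = y + - (x + - t)"
            by (simp_all add: algebra_simps)
          ultimately show "\<bar>ap (u * (tr (- (x + s)) q - tr (- (x + - t)) q)) y\<bar> \<le> \<epsilon>"
            by (simp only: ap_simps abs_mult mult_1)
        qed
        finally show ?thesis .
      qed
      then show ?thesis using t(1) by blast
    qed
    then show "\<exists>S. finite S \<and> (\<forall>s. \<exists>t\<in>S. \<forall>x. \<bar>ap v (x + s) - ap v (x + t)\<bar> \<le> \<epsilon>)"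
      using S(1) by (meson finite_imageI)
  qed
  moreover have "\<bar>ap v x\<bar> \<le> 1" for x
    unfolding v by (rule m.m_abs_le) (simp add: abs_mult_le_1 u q1)
  moreover have "(M (c * c))\<^sup>2 \<le> m (u * v)"
    using autocorr_cubic_bound[OF m' M u] ergodic_autocorr_product[OF m M u qap]
    unfolding q_def[symmetric] c_def[symmetric] v_def[symmetric] q_def[unfolded c_def, symmetric] by simp
  ultimately show ?thesis unfolding c_def by blast
qed

text \<open>The point is the order of quantifiers: \<open>\<delta>\<close> is fixed by the weight,
  the maps and \<open>e\<close>, so the finer approximation that produces \<open>u2\<close> can be
  chosen afterwards.\<close>

lemma weighted_average_small:
  fixes m M :: "'g::ab_group_add bfun \<Rightarrow> real"
  assumes m: "ergodic_mean m" and M: "inv_mean M" and hom: "additive_hom \<phi>" "additive_hom \<psi>"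
    and fin: "finite_index (range \<psi>)" "finite_index (range (\<lambda>x. \<psi> x - \<phi> x))"
    and w: "almost_periodic w" "\<And>x. \<bar>ap w x\<bar> \<le> 1" and e: "e > 0"
  shows "\<exists>\<delta>>0. \<forall>u0 u1 u2. (\<forall>x. \<bar>ap u0 x\<bar> \<le> 1) \<longrightarrow> (\<forall>x. \<bar>ap u1 x\<bar> \<le> 1) \<longrightarrow> (\<forall>x. \<bar>ap u2 x\<bar> \<le> 1) \<longrightarrow>
    (\<forall>v. almost_periodic v \<longrightarrow> (\<forall>x. \<bar>ap v x\<bar> \<le> 1) \<longrightarrow> m (u2 * v) \<le> \<delta>) \<longrightarrow>
    \<bar>M (Bfun (\<lambda>g. ap w g * m (u0 * (tr (\<phi> g) u1 * tr (\<psi> g) u2))))\<bar> \<le> e"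
proof -
  have m': "inv_mean m" using m by (simp add: ergodic_mean_def)
  define \<theta> where "\<theta> x = \<psi> x - \<phi> x" for x
  have hom\<theta>: "additive_hom \<theta>"
    using hom by (simp add: additive_hom_def \<theta>_def)
  obtain R where R: "transversal \<psi> R" using transversal_exists[OF hom(2) fin(1)] by blast
  obtain R' where R': "transversal \<theta> R'" using transversal_exists[OF hom\<theta>] fin(2) unfolding \<theta>_def by blast
  have "card R > 0" "card R' > 0" using R R' by (auto simp: transversal_def card_gt_0_iff)
  moreover define K where "K = real (card R) * real (card R')"
  ultimately have K: "K > 0" by simp
  obtain S where S: "finite S" "\<And>s. \<exists>t\<in>S. \<forall>x. \<bar>ap w (x + s) - ap w (x + t)\<bar> \<le> e / 2"
    using w(1) half_gt_zero[OF e] unfolding almost_periodic_def by blast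
  define W where "W = (\<lambda>s x. ap w (x + s)) ` S"
  define \<beta> where "\<beta> = e / (2 * (real (card W) + 1))"
  have \<beta>: "\<beta> > 0" "e / 2 + real (card W) * \<beta> \<le> e" using e by (auto simp: \<beta>_def field_simps)
  \<comment> \<open>Once \<open>\<mu> \<le> \<eta>\<close>, the box bound
    \<open>K * (\<mu> + \<eta>)\<close> is at most \<open>\<beta> ^ 4\<close>. The threshold taken
    below is \<open>\<eta>\<^sup>2\<close> because \<open>uniformity_inverse\<close> bounds
    \<open>\<mu>\<^sup>2\<close>.\<close>
  define \<eta> where "\<eta> = \<beta> ^ 4 / (2 * K)"
  have \<eta>: "\<eta> > 0" using \<beta> K by (simp add: \<eta>_def)
  show ?thesis
  proof (intro exI[of _ "\<eta>\<^sup>2"] conjI allI impI)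
    show "\<eta>\<^sup>2 > 0" using \<eta> by simp
    fix u0 u1 u2 :: "'g bfun"
    assume u: "\<forall>x. \<bar>ap u0 x\<bar> \<le> 1" "\<forall>x. \<bar>ap u1 x\<bar> \<le> 1" "\<forall>x. \<bar>ap u2 x\<bar> \<le> 1"
      and small: "\<forall>v. almost_periodic v \<longrightarrow> (\<forall>x. \<bar>ap v x\<bar> \<le> 1) \<longrightarrow> m (u2 * v) \<le> \<eta>\<^sup>2"
    define \<mu> where "\<mu> = coset_mean M \<psi> R (autocorr m u2 * autocorr m u2)"
    have "\<mu>\<^sup>2 \<le> \<eta>\<^sup>2"
      using uniformity_inverse[OF m inv_mean_coset_mean[OF M hom(2) R], of u2] u(3) small
      unfolding \<mu>_def by (meson order_trans)
    then have \<mu>: "\<mu> \<le> \<eta>" using \<eta> by (meson less_imp_le power2_le_imp_le)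
    obtain n n' :: nat and h k where n: "n > 0" "n' > 0"
      and gb: "gbox m u2 {..<n} (\<psi> \<circ> h) {..<n'} (\<theta> \<circ> k) \<le> (real n)\<^sup>2 * (real n')\<^sup>2 * (K * (\<mu> + \<eta>))"
      using small_gbox[OF m M hom(2) hom\<theta> R R' \<eta>, of u2] unfolding \<mu>_def K_def by blast
    have "K * (\<mu> + \<eta>) \<le> K * (2 * \<eta>)" using \<mu> K by (intro mult_left_mono) auto
    also have "\<dots> = \<beta> ^ 4" using K by (simp add: \<eta>_def)
    finally have "(real n)\<^sup>2 * (real n')\<^sup>2 * (K * (\<mu> + \<eta>)) \<le> (real n)\<^sup>2 * (real n')\<^sup>2 * \<beta> ^ 4"
      by (intro mult_left_mono) auto
    then have gb': "gbox m u2 {..<n} (\<psi> \<circ> h) {..<n'} (\<lambda>j. \<psi> (k j) - \<phi> (k j)) \<le> (real n)\<^sup>2 * (real n')\<^sup>2 * \<beta> ^ 4"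
      using gb by (simp add: \<theta>_def comp_def)
    have W3: "\<exists>\<omega>\<in>W. \<forall>x. \<bar>ap w (g + x) - \<omega> x\<bar> \<le> e / 2" for g
      using S(2)[of g] by (auto simp: W_def add.commute)
    have "\<bar>M (Bfun (\<lambda>g. ap w g * m (u0 * (tr (\<phi> g) u1 * tr (\<psi> g) u2))))\<bar> \<le> e / 2 + real (card W) * \<beta>"
      by (rule weighted_van_der_corput[OF m' M hom _ _ _ bnd_ap _ _ W3 n _ gb'])
         (use u S(1) w(2) \<beta>(1) in \<open>auto simp: W_def\<close>)
    then show "\<bar>M (Bfun (\<lambda>g. ap w g * m (u0 * (tr (\<phi> g) u1 * tr (\<psi> g) u2))))\<bar> \<le> e"
      using \<beta>(2) by linarith
  qed
qed

text \<open>\<open>F\<close> nearly minimises the mean-square distance to \<open>f\<close> among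
  almost periodic functions with values in \<open>[0, 1]\<close>. A perturbation
  \<open>F + s *\<^sub>R v\<close> may leave that range, but clamping brings it no farther from
  \<open>f\<close>, whose values lie there; so every \<open>s\<close> is admissible in the
  discriminant argument.\<close>

lemma (in inv_mean) almost_periodic_projection:
  assumes f: "\<And>x. 0 \<le> ap f x" "\<And>x. ap f x \<le> 1" and "\<epsilon> > 0"
  shows "\<exists>F. almost_periodic F \<and> (\<forall>x. 0 \<le> ap F x \<and> ap F x \<le> 1) \<and>
    (\<forall>v. almost_periodic v \<longrightarrow> (m ((f - F) * v))\<^sup>2 \<le> \<epsilon>\<^sup>2 * m (v * v))"
proof -
  define \<A> where "\<A> = {F :: 'g bfun. almost_periodic F \<and> (\<forall>x. 0 \<le> ap F x \<and> ap F x \<le> 1)}"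
  define Q where "Q F = m ((f - F) * (f - F))" for F
  have bdd: "bdd_below (Q ` \<A>)" using m_self_nonneg by (auto simp: Q_def bdd_below_def)
  have "0 *\<^sub>R 1 \<in> \<A>" unfolding \<A>_def using almost_periodic_const[of 0] by simp
  then have "\<A> \<noteq> {}" by blast
  moreover have "Inf (Q ` \<A>) < Inf (Q ` \<A>) + \<epsilon>\<^sup>2" using \<open>\<epsilon> > 0\<close> by simp
  ultimately obtain F where F: "F \<in> \<A>" "Q F < Inf (Q ` \<A>) + \<epsilon>\<^sup>2"
    using cInf_lessD[of "Q ` \<A>"] by blast
  have "(- m ((f - F) * v))\<^sup>2 \<le> m (v * v) * \<epsilon>\<^sup>2" if v: "almost_periodic v" for v
  proof (rule quadratic_nonneg_discriminant)
    fix s :: real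
    define H where "H = F + s *\<^sub>R v"
    define C where "C = Bfun (\<lambda>x. max 0 (min 1 (ap H x)))"
    have "bnd (\<lambda>x. max 0 (min 1 (ap H x)))" by (rule bndI[of _ 1]) (simp add: max_def min_def)
    then have C: "ap C x = max 0 (min 1 (ap H x))" for x by (simp add: C_def)
    have H: "almost_periodic H"
      unfolding H_def using F(1) v by (auto simp: \<A>_def intro!: almost_periodic_add almost_periodic_scaleR)
    have "almost_periodic C"
      by (rule almost_periodic_lipschitz[OF H H, of 1]) (auto simp: C max_def min_def abs_if)
    then have "C \<in> \<A>" by (auto simp: \<A>_def C)
    then have "Inf (Q ` \<A>) \<le> Q C" using bdd by (intro cInf_lower) auto
    also have "Q C \<le> m ((f - H) * (f - H))"
      unfolding Q_def
    proof (rule m_mono)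
      fix x
      have "\<bar>ap f x - ap C x\<bar> \<le> \<bar>ap f x - ap H x\<bar>"
        using f[of x] by (auto simp: C max_def min_def abs_if)
      then have "\<bar>ap f x - ap C x\<bar> * \<bar>ap f x - ap C x\<bar> \<le> \<bar>ap f x - ap H x\<bar> * \<bar>ap f x - ap H x\<bar>"
        by (intro mult_mono) auto
      then show "ap ((f - C) * (f - C)) x \<le> ap ((f - H) * (f - H)) x" by simp
    qed
    also have "f - H = (f - F) + (- s) *\<^sub>R v" by (simp add: H_def)
    finally have "Q F - \<epsilon>\<^sup>2 \<le> m (((f - F) + (- s) *\<^sub>R v) * ((f - F) + (- s) *\<^sub>R v))"
      using F(2) by linarith
    then show "0 \<le> m (v * v) * s\<^sup>2 + 2 * - m ((f - F) * v) * s + \<epsilon>\<^sup>2"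
      unfolding m_expand Q_def by simp
  qed (rule m_self_nonneg)
  then show ?thesis using F(1) by (intro exI[of _ F]) (auto simp: \<A>_def mult.commute)
qed

text \<open>Finitely many translates of \<open>w\<close> add up to at least
  \<open>ap w 0 / 2\<close> everywhere: for each \<open>x\<close>, the net point \<open>t\<close>
  attached to \<open>- x\<close> has \<open>ap w (x + t)\<close> close to
  \<open>ap w 0\<close>.\<close>

lemma (in inv_mean) almost_periodic_mean_pos:
  assumes w: "almost_periodic w" "\<And>x. 0 \<le> ap w x" "ap w 0 > 0"
  shows "m w > 0"
proof -
  obtain S where S: "finite S" "\<And>s. \<exists>t\<in>S. \<forall>x. \<bar>ap w (x + s) - ap w (x + t)\<bar> \<le> ap w 0 / 2"
    using w(1,3) unfolding almost_periodic_def by (meson half_gt_zero)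
  have "ap w 0 / 2 \<le> ap (\<Sum>t\<in>S. tr t w) x" for x
  proof -
    obtain t where t: "t \<in> S" "\<bar>ap w (x + - x) - ap w (x + t)\<bar> \<le> ap w 0 / 2" using S(2)[of "- x"] by blast
    then have "ap w 0 / 2 \<le> ap w (x + t)" by (simp add: abs_if split: if_splits)
    also have "\<dots> \<le> (\<Sum>t\<in>S. ap w (x + t))" using t(1) S(1) w(2) by (intro member_le_sum) auto
    finally show ?thesis by (simp add: ap_sum)
  qed
  then have "ap w 0 / 2 \<le> m (\<Sum>t\<in>S. tr t w)" by (rule m_ge)
  also have "\<dots> = real (card S) * m w" by (simp add: m_sum)
  finally have "0 < real (card S) * m w" using w(3) by linarith
  then show ?thesis by (simp add: zero_less_mult_iff)
qed

section \<open>Large intersections\<close>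

text \<open>A continuous cutoff of the sup distance \<open>d t\<close> between \<open>F\<close> and
  its translate by \<open>t\<close>. It inherits almost periodicity from \<open>F\<close>, which an
  indicator of \<open>d t \<le> \<epsilon>\<close> need not do.\<close>

lemma almost_periodic_return_weight:
  fixes F :: "'g::ab_group_add bfun"
  assumes F: "almost_periodic F" and \<epsilon>: "\<epsilon> > 0"
  shows "\<exists>w. almost_periodic w \<and> ap w 0 = \<epsilon> \<and>
    (\<forall>t. 0 \<le> ap w t \<and> ap w t \<le> \<epsilon> \<and> (ap w t \<noteq> 0 \<longrightarrow> (\<forall>x. \<bar>ap F (x + t) - ap F x\<bar> \<le> \<epsilon>)))"
proof -
  define d where "d t = (SUP x. \<bar>ap (tr t F - F) x\<bar>)" for t
  have d_ge: "\<bar>ap F (x + t) - ap F x\<bar> \<le> d t" for x t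
    using ap_le_SUP[of "tr t F - F" x] by (simp add: d_def)
  have d_le: "d t \<le> B" if "\<And>x. \<bar>ap F (x + t) - ap F x\<bar> \<le> B" for t B
    unfolding d_def by (rule cSUP_least) (use that in auto)
  have d_nonneg: "0 \<le> d t" for t using d_ge[of 0 t] by linarith
  define w where "w = Bfun (\<lambda>t. max 0 (\<epsilon> - d t))"
  have "bnd (\<lambda>t. max 0 (\<epsilon> - d t))"
    using d_nonneg \<epsilon> by (intro bndI[of _ \<epsilon>]) (auto simp: max_def)
  then have w: "ap w t = max 0 (\<epsilon> - d t)" for t by (simp add: w_def)
  have "almost_periodic w"
    unfolding almost_periodic_def
  proof (intro allI impI)
    fix e :: real assume "e > 0"
    then obtain S where S: "finite S" "\<And>s. \<exists>t\<in>S. \<forall>x. \<bar>ap F (x + s) - ap F (x + t)\<bar> \<le> e"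
      using F unfolding almost_periodic_def by blast
    have tri: "d (x + s) \<le> d (x + t) + e" if "\<forall>x. \<bar>ap F (x + s) - ap F (x + t)\<bar> \<le> e" for x s t
    proof (rule d_le)
      fix y
      have "\<bar>ap F (y + x + s) - ap F (y + x + t)\<bar> \<le> e" using that by blast
      then show "\<bar>ap F (y + (x + s)) - ap F y\<bar> \<le> d (x + t) + e"
        using d_ge[of y "x + t"] by (simp add: add.assoc)
    qed
    have "\<bar>ap w (x + s) - ap w (x + t)\<bar> \<le> e" if st: "\<forall>x. \<bar>ap F (x + s) - ap F (x + t)\<bar> \<le> e" for x s t
    proof -
      have "d (x + s) \<le> d (x + t) + e" by (rule tri[OF st])
      moreover have "d (x + t) \<le> d (x + s) + e" by (rule tri) (use st in \<open>simp add: abs_minus_commute\<close>)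
      ultimately show ?thesis using \<open>e > 0\<close> unfolding w by linarith
    qed
    then show "\<exists>S. finite S \<and> (\<forall>s. \<exists>t\<in>S. \<forall>x. \<bar>ap w (x + s) - ap w (x + t)\<bar> \<le> e)"
      using S by meson
  qed
  moreover have "d 0 = 0" using d_le[of 0 0] d_nonneg[of 0] by simp
  then have "ap w 0 = \<epsilon>" using \<epsilon> by (simp add: w)
  moreover have "0 \<le> ap w t" "ap w t \<le> \<epsilon>" for t using d_nonneg[of t] \<epsilon> by (auto simp: w)
  moreover have "\<bar>ap F (x + t) - ap F x\<bar> \<le> \<epsilon>" if "ap w t \<noteq> 0" for t x
    using that d_ge[of x t] by (auto simp: w max_def split: if_splits)
  ultimately show ?thesis by blast
qed

text \<open>Jensen through the tangent at \<open>a = m F\<close>: the cube exceeds it by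
  \<open>(x - a)\<^sup>2 * (x + 2 * a)\<close>, which is nonnegative for
  \<open>x \<ge> 0\<close>.\<close>

lemma (in inv_mean) mean_cube_ge:
  assumes "\<And>x. 0 \<le> ap F x"
  shows "(m F) ^ 3 \<le> m (F * (F * F))"
proof -
  define a where "a = m F"
  have a: "a \<ge> 0" unfolding a_def by (rule m_nonneg) (rule assms)
  have "m ((3 * a\<^sup>2) *\<^sub>R F - (2 * a ^ 3) *\<^sub>R 1) \<le> m (F * (F * F))"
  proof (rule m_mono)
    fix x
    have "0 \<le> (ap F x - a)\<^sup>2 * (ap F x + 2 * a)" using a assms[of x] by (intro mult_nonneg_nonneg) auto
    also have "\<dots> = ap F x * (ap F x * ap F x) - (3 * a\<^sup>2 * ap F x - 2 * a ^ 3)"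
      by (simp add: power2_eq_square power3_eq_cube algebra_simps)
    finally show "ap ((3 * a\<^sup>2) *\<^sub>R F - (2 * a ^ 3) *\<^sub>R 1) x \<le> ap (F * (F * F)) x" by simp
  qed
  then show ?thesis
    by (simp add: m_diff m_scale a_def[symmetric] power2_eq_square power3_eq_cube)
qed

lemma abs_diff_unit_le: "0 \<le> a \<Longrightarrow> a \<le> 1 \<Longrightarrow> 0 \<le> b \<Longrightarrow> b \<le> 1 \<Longrightarrow> \<bar>a - b\<bar> \<le> (1::real)"
  by linarith

text \<open>The \<open>w\<close>-weighted \<open>M\<close>-average of the triple correlation is
  estimated twice. As \<open>R\<close> is \<open>M\<close>-null, it is at most
  \<open>M w * ((m f) ^ 3 - \<epsilon>0)\<close>; the decomposition of \<open>f\<close> shows that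
  it is at least \<open>M w * ((m f) ^ 3 - 12 * \<epsilon>)\<close>.\<close>

lemma ergodic_recurrence:
  fixes m M :: "'g::ab_group_add bfun \<Rightarrow> real" and f :: "'g bfun"
  assumes m: "ergodic_mean m" and M: "inv_mean M" and hom: "additive_hom \<phi>" "additive_hom \<psi>"
    and fin: "finite_index (range \<phi>)" "finite_index (range \<psi>)" "finite_index (range (\<lambda>x. \<phi> x - \<psi> x))"
    and f: "\<And>x. 0 \<le> ap f x" "\<And>x. ap f x \<le> 1"
    and \<epsilon>0: "\<epsilon>0 > 0"
    and R: "M (ind R) = 0" "\<And>g. g \<notin> R \<Longrightarrow> m (f * (tr (\<phi> g) f * tr (\<psi> g) f)) \<le> (m f) ^ 3 - \<epsilon>0"
  shows False
proof -
  have m': "inv_mean m" using m by (simp add: ergodic_mean_def)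
  interpret m: inv_mean m by (rule m')
  interpret M: inv_mean M by fact
  have fin': "finite_index (range (\<lambda>x. \<psi> x - \<phi> x))"
  proof -
    have "range (\<lambda>x. \<psi> x - \<phi> x) = range (\<lambda>x. \<phi> x - \<psi> x)"
    proof -
      have e: "\<psi> x - \<phi> x = \<phi> (- x) - \<psi> (- x)" "\<phi> x - \<psi> x = \<psi> (- x) - \<phi> (- x)" for x
        by (simp_all add: additive_hom_simps[OF hom(1)] additive_hom_simps[OF hom(2)])
      show ?thesis
        by (intro subset_antisym image_subsetI) (rule range_eqI, rule e)+
    qed
    then show ?thesis using fin(3) by simp
  qed
  have f1: "\<bar>ap f x\<bar> \<le> 1" for x using f[of x] by simp
  \<comment> \<open>Budget in units of \<open>\<epsilon>\<close>: 4 in \<open>main\<close>, 2 for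
    each of the two \<open>d\<close> terms, 2 for moving the translates of \<open>F1\<close> back,
    and 2 for the averaged terms \<open>s1\<close> and \<open>s2\<close>. The total 12 stays below
    20.\<close>
  define \<epsilon> where "\<epsilon> = min 1 \<epsilon>0 / 20"
  have \<epsilon>: "\<epsilon> > 0" "\<epsilon> \<le> 1" "20 * \<epsilon> \<le> \<epsilon>0" using \<epsilon>0 by (auto simp: \<epsilon>_def min_def)
  obtain F1 where F1: "almost_periodic F1" "\<And>x. 0 \<le> ap F1 x" "\<And>x. ap F1 x \<le> 1"
    "\<And>v. almost_periodic v \<Longrightarrow> (m ((f - F1) * v))\<^sup>2 \<le> \<epsilon>\<^sup>2 * m (v * v)"
    using m.almost_periodic_projection[OF f \<epsilon>(1)] by blast
  have F1a: "\<bar>ap F1 x\<bar> \<le> 1" for x using F1(2,3)[of x] by simp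
  obtain w1 where w1: "almost_periodic w1" "ap w1 0 = \<epsilon>" "\<And>t. 0 \<le> ap w1 t" "\<And>t. ap w1 t \<le> \<epsilon>"
    "\<And>t x. ap w1 t \<noteq> 0 \<Longrightarrow> \<bar>ap F1 (x + t) - ap F1 x\<bar> \<le> \<epsilon>"
    using almost_periodic_return_weight[OF F1(1) \<epsilon>(1)] by blast
  define w where "w = Bfun (\<lambda>g. ap w1 (\<phi> g)) * Bfun (\<lambda>g. ap w1 (\<psi> g))"
  have w: "ap w g = ap w1 (\<phi> g) * ap w1 (\<psi> g)" for g by (simp add: w_def bnd_intros)
  have wap: "almost_periodic w"
    unfolding w_def by (intro almost_periodic_mult almost_periodic_comp_hom w1(1) hom)
  have w_nonneg: "0 \<le> ap w g" for g unfolding w using w1(3) by simp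
  have w_le: "\<bar>ap w g\<bar> \<le> 1" for g
    unfolding w using w1(3,4) \<epsilon>(2) by (intro abs_mult_le_1) (auto intro: order_trans)
  have "ap w 0 > 0"
    unfolding w using w1(2) \<epsilon>(1) by (simp add: additive_hom_simps[OF hom(1)] additive_hom_simps[OF hom(2)])
  then have Mw: "M w > 0" by (rule M.almost_periodic_mean_pos[OF wap w_nonneg])
  \<comment> \<open>The averaged terms compete with the total weight, so they must be small relative
    to \<open>M w\<close>.\<close>
  define e where "e = \<epsilon> * M w"
  have e: "e > 0" using Mw \<epsilon> by (simp add: e_def)
  obtain \<delta>a where \<delta>a: "\<delta>a > 0" "\<forall>u0 u1 u2. (\<forall>x. \<bar>ap u0 x\<bar> \<le> 1) \<longrightarrow> (\<forall>x. \<bar>ap u1 x\<bar> \<le> 1) \<longrightarrow>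
      (\<forall>x. \<bar>ap u2 x\<bar> \<le> 1) \<longrightarrow>
      (\<forall>v. almost_periodic v \<longrightarrow> (\<forall>x. \<bar>ap v x\<bar> \<le> 1) \<longrightarrow> m (u2 * v) \<le> \<delta>a) \<longrightarrow>
      \<bar>M (Bfun (\<lambda>g. ap w g * m (u0 * (tr (\<phi> g) u1 * tr (\<psi> g) u2))))\<bar> \<le> e"
    using weighted_average_small[OF m M hom fin(2) fin' wap w_le e] by blast
  obtain \<delta>b where \<delta>b: "\<delta>b > 0" "\<forall>u0 u1 u2. (\<forall>x. \<bar>ap u0 x\<bar> \<le> 1) \<longrightarrow> (\<forall>x. \<bar>ap u1 x\<bar> \<le> 1) \<longrightarrow>
      (\<forall>x. \<bar>ap u2 x\<bar> \<le> 1) \<longrightarrow>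
      (\<forall>v. almost_periodic v \<longrightarrow> (\<forall>x. \<bar>ap v x\<bar> \<le> 1) \<longrightarrow> m (u2 * v) \<le> \<delta>b) \<longrightarrow>
      \<bar>M (Bfun (\<lambda>g. ap w g * m (u0 * (tr (\<psi> g) u1 * tr (\<phi> g) u2))))\<bar> \<le> e"
    using weighted_average_small[OF m M hom(2,1) fin(1) fin(3) wap w_le e] by blast
  define \<epsilon>2 where "\<epsilon>2 = min \<epsilon> (min \<delta>a \<delta>b)"
  have \<epsilon>2: "\<epsilon>2 > 0" "\<epsilon>2 \<le> \<epsilon>" "\<epsilon>2 \<le> \<delta>a" "\<epsilon>2 \<le> \<delta>b" using \<epsilon> \<delta>a(1) \<delta>b(1) by (auto simp: \<epsilon>2_def)
  obtain F2 where F2: "almost_periodic F2" "\<And>x. 0 \<le> ap F2 x" "\<And>x. ap F2 x \<le> 1"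
    "\<And>v. almost_periodic v \<Longrightarrow> (m ((f - F2) * v))\<^sup>2 \<le> \<epsilon>2\<^sup>2 * m (v * v)"
    using m.almost_periodic_projection[OF f \<epsilon>2(1)] by blast
  define u where "u = f - F2"
  define d where "d = F2 - F1"
  have u1: "\<bar>ap u x\<bar> \<le> 1" for x using abs_diff_unit_le[OF f F2(2,3)] by (simp add: u_def)
  have proj_le: "\<bar>m ((f - F) * v)\<bar> \<le> \<epsilon>'"
    if "\<And>v. almost_periodic v \<Longrightarrow> (m ((f - F) * v))\<^sup>2 \<le> \<epsilon>'\<^sup>2 * m (v * v)"
      "almost_periodic v" "\<And>x. \<bar>ap v x\<bar> \<le> 1" "\<epsilon>' > 0" for F v \<epsilon>'
  proof -
    have "(m ((f - F) * v))\<^sup>2 \<le> \<epsilon>'\<^sup>2 * m (v * v)" using that by blast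
    also have "\<dots> \<le> \<epsilon>'\<^sup>2" using m.m_self_le_1[of v] that(3) by (simp add: mult_left_le)
    finally show ?thesis using that(4) by (simp add: abs_le_square_iff[symmetric])
  qed
  have u_small: "m (u * v) \<le> \<epsilon>2" if "almost_periodic v" "\<And>x. \<bar>ap v x\<bar> \<le> 1" for v
    using proj_le[OF F2(4) that \<epsilon>2(1)] unfolding u_def by linarith
  \<comment> \<open>\<open>d\<close> is almost periodic and is the difference of
    \<open>f - F1\<close> and \<open>f - F2\<close>, both nearly orthogonal to almost periodic
    functions. This bounds the square of \<open>m (d * d)\<close> by
    \<open>(2 * \<epsilon>)\<^sup>2 * m (d * d)\<close>, and one factor cancels.\<close>
  have dd: "m (d * d) \<le> (2 * \<epsilon>)\<^sup>2"
  proof -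
    have d_ap: "almost_periodic d" unfolding d_def by (intro almost_periodic_diff F1 F2)
    define a where "a = m ((f - F1) * d)"
    define b where "b = m ((f - F2) * d)"
    have "d * d = (f - F1) * d - (f - F2) * d" by (simp add: d_def algebra_simps)
    then have N: "m (d * d) = a - b" by (simp add: m.m_diff a_def b_def)
    have "\<epsilon>2\<^sup>2 \<le> \<epsilon>\<^sup>2" using \<epsilon>2 by (intro power_mono) auto
    then have "\<epsilon>2\<^sup>2 * m (d * d) \<le> \<epsilon>\<^sup>2 * m (d * d)" by (intro mult_right_mono m.m_self_nonneg)
    then have "a\<^sup>2 \<le> \<epsilon>\<^sup>2 * m (d * d)" "b\<^sup>2 \<le> \<epsilon>\<^sup>2 * m (d * d)"
      using F1(4)[OF d_ap] F2(4)[OF d_ap] by (auto simp: a_def b_def)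
    moreover have "(a - b)\<^sup>2 \<le> 2 * a\<^sup>2 + 2 * b\<^sup>2"
      using zero_le_power2[of "a + b"] by (simp add: power2_diff power2_sum)
    ultimately have "m (d * d) * m (d * d) \<le> (2 * \<epsilon>)\<^sup>2 * m (d * d)"
      unfolding N[symmetric] by (simp add: power2_eq_square)
    then show ?thesis
      using m.m_self_nonneg[of d] by (cases "m (d * d) = 0") auto
  qed
  have d_small: "\<bar>m (X * tr t d)\<bar> \<le> 2 * \<epsilon>" if "\<And>x. \<bar>ap X x\<bar> \<le> 1" for X t
  proof -
    have "(m (X * tr t d))\<^sup>2 \<le> m (tr t d * tr t d)" using that by (rule m.m_CS_1)
    also have "\<dots> = m (d * d)" by (simp add: tr_simps(3)[symmetric])
    also have "\<dots> \<le> (2 * \<epsilon>)\<^sup>2" by (rule dd)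
    finally have "\<bar>m (X * tr t d)\<bar>\<^sup>2 \<le> (2 * \<epsilon>)\<^sup>2" by (simp only: power2_abs)
    then show ?thesis by (rule power2_le_imp_le) (use \<epsilon> in simp)
  qed
  \<comment> \<open>\<open>f = F1 + d + u\<close> is inserted first in the \<open>\<psi>\<close>
    slot and then in the \<open>\<phi>\<close> slot, so \<open>s1\<close> still has \<open>f\<close>
    in the other slot while \<open>s2\<close> already has \<open>F1\<close>.\<close>
  define s1 where "s1 g = m (f * (tr (\<phi> g) f * tr (\<psi> g) u))" for g
  define s2 where "s2 g = m (f * (tr (\<psi> g) F1 * tr (\<phi> g) u))" for g
  have small: "\<forall>v. almost_periodic v \<longrightarrow> (\<forall>x. \<bar>ap v x\<bar> \<le> 1) \<longrightarrow> m (u * v) \<le> \<delta>a"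
    "\<forall>v. almost_periodic v \<longrightarrow> (\<forall>x. \<bar>ap v x\<bar> \<le> 1) \<longrightarrow> m (u * v) \<le> \<delta>b"
    using u_small \<epsilon>2(3,4) by (meson order_trans)+
  have S1: "\<bar>M (Bfun (\<lambda>g. ap w g * s1 g))\<bar> \<le> e"
    using \<delta>a(2)[THEN spec[of _ f], THEN spec[of _ f], THEN spec[of _ u]] f1 u1 small(1) unfolding s1_def by simp
  have S2: "\<bar>M (Bfun (\<lambda>g. ap w g * s2 g))\<bar> \<le> e"
    using \<delta>b(2)[THEN spec[of _ f], THEN spec[of _ F1], THEN spec[of _ u]] f1 u1 F1a small(2) unfolding s2_def by simp
  define a where "a g = m (f * (tr (\<phi> g) f * tr (\<psi> g) f))" for g
  have main: "(m f) ^ 3 - 4 * \<epsilon> \<le> m (f * (F1 * F1))"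
  proof -
    have "\<bar>m ((f - F1) * (F1 * F1))\<bar> \<le> \<epsilon>"
    proof (rule proj_le[OF F1(4) almost_periodic_mult[OF F1(1) F1(1)] _ \<epsilon>(1)])
      show "\<bar>ap (F1 * F1) x\<bar> \<le> 1" for x unfolding ap_simps by (intro abs_mult_le_1 F1a)
    qed
    then have 1: "m (F1 * (F1 * F1)) - \<epsilon> \<le> m (f * (F1 * F1))"
      by (simp add: left_diff_distrib m.m_diff)
    have "\<bar>m ((f - F1) * (1 *\<^sub>R 1))\<bar> \<le> \<epsilon>"
      by (rule proj_le[OF F1(4) almost_periodic_const _ \<epsilon>(1)]) simp_all
    then have 2: "m f - m F1 \<le> \<epsilon>" by (simp add: m.m_diff)
    have p: "0 \<le> m F1" "m F1 \<le> 1" "0 \<le> m f" "m f \<le> 1"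
      using F1 f by (auto intro: m.m_nonneg m.m_le)
    have "(m f) ^ 3 - (m F1) ^ 3 \<le> 3 * \<epsilon>"
    proof (cases "m f \<le> m F1")
      case True
      then have "(m f) ^ 3 \<le> (m F1) ^ 3" using p by (intro power_mono)
      then show ?thesis using \<epsilon> by simp
    next
      case False
      have "(m f) ^ 3 - (m F1) ^ 3 = (m f - m F1) * (m f * m f + m f * m F1 + m F1 * m F1)"
        by (simp add: power3_eq_cube algebra_simps)
      also have "\<dots> \<le> \<epsilon> * 3"
        using p False 2 mult_mono[OF p(4,4)] mult_mono[OF p(4,2)] mult_mono[OF p(2,2)]
        by (intro mult_mono) auto
      finally show ?thesis by simp
    qed
    then show ?thesis using 1 m.mean_cube_ge[of F1] F1(2) by auto
  qed
  have lower: "ap w g * ((m f) ^ 3 - 10 * \<epsilon>) + ap w g * s1 g + ap w g * s2 g \<le> ap w g * a g" for g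
  proof (cases "ap w g = 0")
    case False
    then have nz: "ap w1 (\<phi> g) \<noteq> 0" "ap w1 (\<psi> g) \<noteq> 0" by (auto simp: w)
    have fdec: "f = F1 + d + u" by (simp add: d_def u_def)
    have a1: "a g = m (f * (tr (\<phi> g) f * tr (\<psi> g) F1)) + m ((f * tr (\<phi> g) f) * tr (\<psi> g) d) + s1 g"
    proof -
      have "tr (\<psi> g) f = tr (\<psi> g) F1 + tr (\<psi> g) d + tr (\<psi> g) u" by (metis fdec tr_simps(1))
      then show ?thesis
        unfolding a_def s1_def by (simp add: distrib_left m.m_add mult.assoc)
    qed
    have a2: "m (f * (tr (\<phi> g) f * tr (\<psi> g) F1))
        = m (f * (tr (\<phi> g) F1 * tr (\<psi> g) F1)) + m ((f * tr (\<psi> g) F1) * tr (\<phi> g) d) + s2 g"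
    proof -
      have "tr (\<phi> g) f = tr (\<phi> g) F1 + tr (\<phi> g) d + tr (\<phi> g) u" by (metis fdec tr_simps(1))
      then show ?thesis
        unfolding s2_def by (simp add: distrib_left distrib_right m.m_add ac_simps)
    qed
    have d1: "\<bar>m ((f * tr (\<phi> g) f) * tr (\<psi> g) d)\<bar> \<le> 2 * \<epsilon>"
      by (rule d_small) (simp add: abs_mult_le_1 f1)
    have d2: "\<bar>m ((f * tr (\<psi> g) F1) * tr (\<phi> g) d)\<bar> \<le> 2 * \<epsilon>"
      by (rule d_small) (simp add: abs_mult_le_1 f1 F1a)
    have "m (f * (F1 * F1) - (2 * \<epsilon>) *\<^sub>R 1) \<le> m (f * (tr (\<phi> g) F1 * tr (\<psi> g) F1))"
    proof (rule m.m_mono)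
      fix x
      let ?p = "ap F1 x" and ?q = "ap F1 (x + \<phi> g)" and ?r = "ap F1 (x + \<psi> g)"
      have "\<bar>?q - ?p\<bar> \<le> \<epsilon>" "\<bar>?r - ?p\<bar> \<le> \<epsilon>" using w1(5) nz by auto
      then have fin: "\<bar>ap f x\<bar> * (\<bar>?p\<bar> * \<bar>?r - ?p\<bar> + \<bar>?r\<bar> * \<bar>?q - ?p\<bar>) \<le> 1 * (1 * \<epsilon> + 1 * \<epsilon>)"
        using f1 F1a \<epsilon> by (intro mult_mono add_mono) auto
      have "ap f x * (?p * ?p) - ap f x * (?q * ?r) = - (ap f x * (?p * (?r - ?p) + ?r * (?q - ?p)))"
        by (simp add: algebra_simps)
      also have "\<dots> \<le> \<bar>ap f x * (?p * (?r - ?p) + ?r * (?q - ?p))\<bar>" by (rule abs_ge_minus_self)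
      also have "\<dots> \<le> \<bar>ap f x\<bar> * (\<bar>?p\<bar> * \<bar>?r - ?p\<bar> + \<bar>?r\<bar> * \<bar>?q - ?p\<bar>)"
        unfolding abs_mult[of "ap f x"]
        by (intro mult_left_mono) (auto simp: abs_mult[symmetric])
      also note fin
      finally have "ap f x * (?p * ?p) - ap f x * (?q * ?r) \<le> 2 * \<epsilon>" by simp
      then show "ap (f * (F1 * F1) - (2 * \<epsilon>) *\<^sub>R 1) x \<le> ap (f * (tr (\<phi> g) F1 * tr (\<psi> g) F1)) x"
        by simp
    qed
    then have "m (f * (F1 * F1)) - 2 * \<epsilon> \<le> m (f * (tr (\<phi> g) F1 * tr (\<psi> g) F1))"
      by (simp add: m.m_diff m.m_scale)
    then have "(m f) ^ 3 - 10 * \<epsilon> + s1 g + s2 g \<le> a g"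
      using a1 a2 d1 d2 main by linarith
    then have "ap w g * ((m f) ^ 3 - 10 * \<epsilon> + s1 g + s2 g) \<le> ap w g * a g"
      using w_nonneg by (rule mult_left_mono)
    then show ?thesis by (simp add: distrib_left)
  qed simp
  have ba: "bnd a" unfolding a_def by (intro m.bnd_m bnd_intros)
  have b1: "bnd s1" unfolding s1_def by (intro m.bnd_m bnd_intros)
  have b2: "bnd s2" unfolding s2_def by (intro m.bnd_m bnd_intros)
  have a_le: "a g \<le> 1" for g
    unfolding a_def by (rule abs_le_D1, rule m.m_abs_le) (simp add: abs_mult_le_1 f1)
  have "M w * ((m f) ^ 3 - 10 * \<epsilon>) + M (Bfun (\<lambda>g. ap w g * s1 g)) + M (Bfun (\<lambda>g. ap w g * s2 g))
      = M (((m f) ^ 3 - 10 * \<epsilon>) *\<^sub>R w + Bfun (\<lambda>g. ap w g * s1 g) + Bfun (\<lambda>g. ap w g * s2 g))"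
    by (simp add: M.m_add M.m_scale)
  also have "\<dots> \<le> M (Bfun (\<lambda>g. ap w g * a g))"
    by (rule M.m_mono) (use lower in \<open>simp add: bnd_mult bnd_ap ba b1 b2 mult.commute\<close>)
  \<comment> \<open>On \<open>R\<close> the bounds \<open>a g \<le> 1\<close> and
    \<open>ap w g \<le> 1\<close> limit the excess to \<open>1 + \<epsilon>0\<close>, and it sits on
    an \<open>M\<close>-null set.\<close>
  also have "\<dots> \<le> M (((m f) ^ 3 - \<epsilon>0) *\<^sub>R w + (1 + \<epsilon>0) *\<^sub>R ind R)"
  proof (rule M.m_mono)
    fix g
    have "ap w g * a g \<le> ap w g * ((m f) ^ 3 - \<epsilon>0) + (1 + \<epsilon>0) * indicator R g"
    proof (cases "g \<in> R")
      case True
      have "a g - ((m f) ^ 3 - \<epsilon>0) \<le> 1 + \<epsilon>0"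
        using a_le[of g] zero_le_power[OF m.m_nonneg[of f, OF f(1)], of 3] by linarith
      then have "ap w g * (a g - ((m f) ^ 3 - \<epsilon>0)) \<le> ap w g * (1 + \<epsilon>0)"
        using w_nonneg by (rule mult_left_mono)
      also have "\<dots> \<le> 1 * (1 + \<epsilon>0)" using w_le[of g] \<epsilon>0 by (intro mult_right_mono) auto
      finally show ?thesis using True by (simp add: right_diff_distrib)
    next
      case False
      then have "ap w g * a g \<le> ap w g * ((m f) ^ 3 - \<epsilon>0)"
        using R(2)[of g] w_nonneg by (intro mult_left_mono) (auto simp: a_def)
      then show ?thesis using False by simp
    qed
    then show "ap (Bfun (\<lambda>g. ap w g * a g)) g \<le> ap (((m f) ^ 3 - \<epsilon>0) *\<^sub>R w + (1 + \<epsilon>0) *\<^sub>R ind R) g"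
      by (simp add: bnd_mult bnd_ap ba mult.commute)
  qed
  also have "\<dots> = M w * ((m f) ^ 3 - \<epsilon>0)" using R(1) by (simp add: M.m_add M.m_scale)
  finally have "M w * ((m f) ^ 3 - 10 * \<epsilon>) - 2 * e \<le> M w * ((m f) ^ 3 - \<epsilon>0)"
    using S1 S2 by linarith
  then have "M w * \<epsilon>0 \<le> M w * (12 * \<epsilon>)" by (simp add: e_def algebra_simps)
  then show False using Mw \<epsilon> by simp
qed

theorem theorem1p14:
  fixes \<phi> \<psi> :: "'g::{ab_group_add, countable} \<Rightarrow> 'g"
    and E :: "'g set" and \<epsilon> :: real
  assumes "additive_hom \<phi>" and "additive_hom \<psi>"
    and "finite_index (range \<phi>)" and "finite_index (range \<psi>)"
    and "finite_index (range (\<lambda>x. \<phi> x - \<psi> x))"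
    and "upper_banach_density E > 0"
    and "\<epsilon> > 0"
  shows "syndetic {g. upper_banach_density
            (E \<inter> (\<lambda>e. e - \<phi> g) ` E \<inter> (\<lambda>e. e - \<psi> g) ` E)
          > upper_banach_density E ^ 3 - ereal \<epsilon>}"
proof (rule ccontr)
  define R where "R = {g. upper_banach_density (E \<inter> (\<lambda>e. e - \<phi> g) ` E \<inter> (\<lambda>e. e - \<psi> g) ` E)
          > upper_banach_density E ^ 3 - ereal \<epsilon>}"
  assume "\<not> syndetic {g. upper_banach_density (E \<inter> (\<lambda>e. e - \<phi> g) ` E \<inter> (\<lambda>e. e - \<psi> g) ` E)
          > upper_banach_density E ^ 3 - ereal \<epsilon>}"
  then have nsyn: "\<not> syndetic R" by (simp add: R_def)
  \<comment> \<open>Positive density itself supplies a Folner sequence: over an empty family the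
    supremum would be \<open>- \<infinity>\<close>.\<close>
  have "{F :: nat \<Rightarrow> 'g set. folner F} \<noteq> {}"
  proof
    assume "{F :: nat \<Rightarrow> 'g set. folner F} = {}"
    then have "upper_banach_density E = bot" unfolding upper_banach_density_def by simp
    then show False using assms(6) by (simp add: bot_ereal_def)
  qed
  then obtain F :: "nat \<Rightarrow> 'g set" where F: "folner F" by blast
  obtain m where m: "ergodic_mean m" "upper_banach_density E \<le> ereal (m (ind E))"
    using ergodic_mean_attaining_density[OF F, of E] by blast
  have m': "inv_mean m" using m by (simp add: ergodic_mean_def)
  interpret inv_mean m by (rule m')
  obtain M where M: "inv_mean M" "M (ind R) = 0"
    using not_syndetic_null_mean[OF F nsyn] by blast
  have dens: "upper_banach_density E = ereal (m (ind E))"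
    using m(2) upper_banach_density_ge_mean[OF m' F, of E] by simp
  show False
  proof (rule ergodic_recurrence[OF m(1) M(1) assms(1-5) _ _ assms(7) M(2)])
    fix x show "0 \<le> ap (ind E) x" "ap (ind E) x \<le> 1" by (simp_all add: indicator_def)
  next
    fix g assume "g \<notin> R"
    have mem: "x \<in> (\<lambda>e. e - t) ` E \<longleftrightarrow> x + t \<in> E" for x t
      by (auto simp: image_iff intro!: bexI[of _ "x + t"])
    have "ind E * (tr (\<phi> g) (ind E) * tr (\<psi> g) (ind E)) = ind (E \<inter> (\<lambda>e. e - \<phi> g) ` E \<inter> (\<lambda>e. e - \<psi> g) ` E)"
      by (rule bfun_eqI) (simp add: indicator_def mem)
    \<comment> \<open>\<open>m\<close> attains the density of \<open>E\<close>; for the intersection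
      its value is a lower bound for the density, which is the direction required.\<close>
    then have "ereal (m (ind E * (tr (\<phi> g) (ind E) * tr (\<psi> g) (ind E))))
        \<le> upper_banach_density (E \<inter> (\<lambda>e. e - \<phi> g) ` E \<inter> (\<lambda>e. e - \<psi> g) ` E)"
      using upper_banach_density_ge_mean[OF m' F] by simp
    also have "\<dots> \<le> upper_banach_density E ^ 3 - ereal \<epsilon>"
      using \<open>g \<notin> R\<close> by (simp add: R_def not_less)
    also have "\<dots> = ereal ((m (ind E)) ^ 3 - \<epsilon>)" by (simp add: dens)
    finally show "m (ind E * (tr (\<phi> g) (ind E) * tr (\<psi> g) (ind E))) \<le> (m (ind E)) ^ 3 - \<epsilon>" by simp
  qed
qed

end
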